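(* Let $R$ be a commutative Noetherian local ring with residue field $k$, and let $\mathfrak{X}$ be a prethick subcategory of $\operatorname{mod} R$. Suppose there exists a finitely generated $R$-module $M$ satisfying the following two conditions: (1) $\dim R \geq \operatorname{depth}_R M + 1$; (2) $M/(x_1,\ldots,x_i)M$ is in $\mathfrak{X}$ for all $i = 0,\ldots,\operatorname{depth}_R M + 1$ and all subsystems of parameters $x_1,\ldots,x_i$ for $R$. Then $\mathfrak{X}$ contains $k$.
   Context: $R$ is a commutative Noetherian local ring with maximal ideal $\mathfrak{m}$ and residue field $k = R/\mathfrak{m}$, and $\operatorname{mod} R$ denotes the category of finitely generated $R$-modules; $\dim R$ is the Krull dimension. A full subcategory $\mathfrak{X}$ of $\operatorname{mod} R$ is called prethick if: (a) it is closed under isomorphisms: if $M\in\mathfrak{X}$ and $N\in\operatorname{mod} R$ is isomorphic to $M$, then $N\in\mathfrak{X}$; (b) it is closed under finite direct sums: if $M_1,\ldots,M_n\in\mathfrak{X}$, then $M_1\oplus\cdots\oplus M_n\in\mathfrak{X}$; (c) it is closed under direct summands: if $M\in\mathfrak{X}$ and $N$ is a direct summand of $M$, then $N\in\mathfrak{X}$; (d) it is closed under kernels of epimorphisms: for any exact sequence $0\to L\to M\to N\to 0$ in $\operatorname{mod} R$, if $M,N\in\mathfrak{X}$ then $L\in\mathfrak{X}$; (e) it is closed under cokernels of monomorphisms: for any exact sequence $0\to L\to M\to N\to 0$ in $\operatorname{mod} R$, if $L,M\in\mathfrak{X}$ then $N\in\mathfrak{X}$. (Closure under extensions is not required.) Conventions: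 a subsystem of parameters for $R$ is a sequence $x_1,\ldots,x_i$ of elements of $\mathfrak{m}$ that can be extended to a system of parameters of $R$ (equivalently, $\dim R/(x_1,\ldots,x_i) = \dim R - i$); for $i=0$ the sequence is empty and $M/(x_1,\ldots,x_i)M = M$; the zero module has depth $\infty$. *)

theory Defs
  imports "HOL-Algebra.Algebra" "HOL-Library.Extended_Nat"
begin

section \<open>Noetherian local rings and Krull dimension\<close>

locale noetherian_local_ring = noetherian_ring R + cring R for R (structure) +
  fixes \<mm> :: "'a set"
  assumes maximal: "maximalideal \<mm> R"
    and unique_maximal: "maximalideal I R \<Longrightarrow> I = \<mm>"

definition krull_dim :: "('a, 'r) ring_scheme \<Rightarrow> enat" where
  "krull_dim R = Sup {enat n | n. \<exists>P :: nat \<Rightarrow> 'a set.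
     (\<forall>i\<le>n. primeideal (P i) R) \<and> (\<forall>i<n. P i \<subset> P (Suc i))}"

definition ideal_radical :: "('a, 'r) ring_scheme \<Rightarrow> 'a set \<Rightarrow> 'a set" where
  "ideal_radical R I = {a \<in> carrier R. \<exists>n :: nat. a [^]\<^bsub>R\<^esub> n \<in> I}"

text \<open>A system of parameters: \<open>dim R\<close> elements of the maximal ideal that generate
  an \<open>\<mm>\<close>-primary ideal, that is, an ideal with radical \<open>\<mm>\<close>.\<close>

definition system_of_parameters :: "('a, 'r) ring_scheme \<Rightarrow> 'a set \<Rightarrow> 'a list \<Rightarrow> bool" where
  "system_of_parameters R \<mm> xs \<longleftrightarrow>
     set xs \<subseteq> \<mm> \<and> enat (length xs) = krull_dim R \<and> ideal_radical R (Idl\<^bsub>R\<^esub> (set xs)) = \<mm>"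

definition subsystem_of_parameters :: "('a, 'r) ring_scheme \<Rightarrow> 'a set \<Rightarrow> 'a list \<Rightarrow> bool" where
  "subsystem_of_parameters R \<mm> xs \<longleftrightarrow> (\<exists>ys. system_of_parameters R \<mm> (xs @ ys))"


section \<open>Modules\<close>

text \<open>The record type of modules extends that of rings. Its fields \<open>mult\<close> and \<open>one\<close>
  have no meaning for a module: none of the notions below depends on them, and direct sums and
  quotients leave them undefined.\<close>

definition mod_span ::
    "('a, 'r) ring_scheme \<Rightarrow> ('a, 'b, 'm) module_scheme \<Rightarrow> 'b set \<Rightarrow> 'b set" where
  "mod_span R M S = \<Inter>{H. submodule H R M \<and> S \<subseteq> H}"

definition fg_module :: "('a, 'r) ring_scheme \<Rightarrow> ('a, 'b) module \<Rightarrow> bool" where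
  "fg_module R M \<longleftrightarrow>
     module R M \<and> (\<exists>A. finite A \<and> A \<subseteq> carrier M \<and> mod_span R M A = carrier M)"

definition mod_hom ::
    "('a, 'r) ring_scheme \<Rightarrow> ('a, 'b) module \<Rightarrow> ('a, 'c) module \<Rightarrow> ('b \<Rightarrow> 'c) set" where
  "mod_hom R M N = {h. h \<in> carrier M \<rightarrow> carrier N \<and>
     (\<forall>x\<in>carrier M. \<forall>y\<in>carrier M. h (x \<oplus>\<^bsub>M\<^esub> y) = h x \<oplus>\<^bsub>N\<^esub> h y) \<and>
     (\<forall>a\<in>carrier R. \<forall>x\<in>carrier M. h (a \<odot>\<^bsub>M\<^esub> x) = a \<odot>\<^bsub>N\<^esub> h x)}"

definition mod_isomorphic ::
    "('a, 'r) ring_scheme \<Rightarrow> ('a, 'b) module \<Rightarrow> ('a, 'c) module \<Rightarrow> bool" where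
  "mod_isomorphic R M N \<longleftrightarrow> (\<exists>h\<in>mod_hom R M N. bij_betw h (carrier M) (carrier N))"

definition short_exact ::
    "('a, 'r) ring_scheme \<Rightarrow> ('a, 'b) module \<Rightarrow> ('a, 'c) module \<Rightarrow> ('a, 'd) module
      \<Rightarrow> ('b \<Rightarrow> 'c) \<Rightarrow> ('c \<Rightarrow> 'd) \<Rightarrow> bool" where
  "short_exact R L M N f g \<longleftrightarrow>
     f \<in> mod_hom R L M \<and> g \<in> mod_hom R M N \<and>
     inj_on f (carrier L) \<and>
     f ` carrier L = {x \<in> carrier M. g x = \<zero>\<^bsub>N\<^esub>} \<and>
     g ` carrier M = carrier N"

definition direct_sum :: "('a, 'b) module list \<Rightarrow> ('a, 'b list) module" where
  "direct_sum Ms =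
     \<lparr>carrier = {xs. length xs = length Ms \<and> (\<forall>i<length Ms. xs ! i \<in> carrier (Ms ! i))},
      monoid.mult = undefined, monoid.one = undefined,
      ring.zero = map (\<lambda>M. \<zero>\<^bsub>M\<^esub>) Ms,
      ring.add = (\<lambda>xs ys. map (\<lambda>i. xs ! i \<oplus>\<^bsub>Ms ! i\<^esub> ys ! i) [0..<length Ms]),
      module.smult = (\<lambda>a xs. map (\<lambda>i. a \<odot>\<^bsub>Ms ! i\<^esub> xs ! i) [0..<length Ms])\<rparr>"

definition quot_module :: "('a, 'b) module \<Rightarrow> 'b set \<Rightarrow> ('a, 'b set) module" where
  "quot_module M K =
     \<lparr>carrier = a_rcosets\<^bsub>M\<^esub> K,
      monoid.mult = undefined, monoid.one = undefined,
      ring.zero = K,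
      ring.add = set_add M,
      module.smult = (\<lambda>a C. \<Union>x\<in>C. K +>\<^bsub>M\<^esub> (a \<odot>\<^bsub>M\<^esub> x))\<rparr>"

definition ideal_smult ::
    "('a, 'r) ring_scheme \<Rightarrow> 'a set \<Rightarrow> ('a, 'b) module \<Rightarrow> 'b set" where
  "ideal_smult R I M = mod_span R M {a \<odot>\<^bsub>M\<^esub> v | a v. a \<in> I \<and> v \<in> carrier M}"

text \<open>\<open>M/(x\<^sub>1,\<dots>,x\<^sub>i)M\<close>\<close>

definition quot_by_seq ::
    "('a, 'r) ring_scheme \<Rightarrow> ('a, 'b) module \<Rightarrow> 'a list \<Rightarrow> ('a, 'b set) module" where
  "quot_by_seq R M xs = quot_module M (ideal_smult R (Idl\<^bsub>R\<^esub> (set xs)) M)"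

definition residue_module :: "('a, 'r) ring_scheme \<Rightarrow> 'a set \<Rightarrow> ('a, 'a set) module" where
  "residue_module R \<mm> =
     \<lparr>carrier = carrier (R Quot \<mm>),
      monoid.mult = monoid.mult (R Quot \<mm>), monoid.one = monoid.one (R Quot \<mm>),
      ring.zero = ring.zero (R Quot \<mm>), ring.add = ring.add (R Quot \<mm>),
      module.smult = (\<lambda>a C. (\<mm> +>\<^bsub>R\<^esub> a) \<otimes>\<^bsub>R Quot \<mm>\<^esub> C)\<rparr>"


section \<open>Depth\<close>

definition nonzerodivisor_on :: "'a \<Rightarrow> ('a, 'b) module \<Rightarrow> bool" where
  "nonzerodivisor_on a M \<longleftrightarrow> (\<forall>v\<in>carrier M. a \<odot>\<^bsub>M\<^esub> v = \<zero>\<^bsub>M\<^esub> \<longrightarrow> v = \<zero>\<^bsub>M\<^esub>)"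

definition regular_sequence ::
    "('a, 'r) ring_scheme \<Rightarrow> ('a, 'b) module \<Rightarrow> 'a list \<Rightarrow> bool" where
  "regular_sequence R M xs \<longleftrightarrow>
     set xs \<subseteq> carrier R \<and>
     (\<forall>i<length xs. nonzerodivisor_on (xs ! i) (quot_by_seq R M (take i xs))) \<and>
     carrier (quot_by_seq R M xs) \<noteq> {\<zero>\<^bsub>quot_by_seq R M xs\<^esub>}"

definition depth :: "('a, 'r) ring_scheme \<Rightarrow> 'a set \<Rightarrow> ('a, 'b) module \<Rightarrow> enat" where
  "depth R \<mm> M =
     (if carrier M = {\<zero>\<^bsub>M\<^esub>} then \<infinity>
      else Sup {enat (length xs) | xs. set xs \<subseteq> \<mm> \<and> regular_sequence R M xs})"


section \<open>Prethick subcategories\<close>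

text \<open>A single HOL type has to carry all objects of \<open>mod R\<close>. We take lists over the element
  type of \<open>R\<close>: every finitely generated module, with elements of whatever type, is isomorphic
  to one whose elements are such lists (lemma \<open>fg_module_on_lists\<close> below; list an
  element's coefficients with respect to finitely many generators). A full subcategory is then
  a set of such modules, and \<open>contains_up_to_iso\<close> extends membership to modules on
  other types.\<close>

definition contains_up_to_iso ::
    "('a, 'r) ring_scheme \<Rightarrow> ('a, 'a list) module set \<Rightarrow> ('a, 'b) module \<Rightarrow> bool" where
  "contains_up_to_iso R \<XX> N \<longleftrightarrow> (\<exists>M\<in>\<XX>. mod_isomorphic R N M)"

locale prethick =
  fixes R :: "('a, 'r) ring_scheme" and \<XX> :: "('a, 'a list) module set"
  assumes objects: "M \<in> \<XX> \<Longrightarrow> fg_module R M"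
    and iso_closed: "\<lbrakk>M \<in> \<XX>; fg_module R N; mod_isomorphic R N M\<rbrakk> \<Longrightarrow> N \<in> \<XX>"
    and direct_sum_closed:
      "\<lbrakk>Ms \<noteq> []; set Ms \<subseteq> \<XX>\<rbrakk> \<Longrightarrow> contains_up_to_iso R \<XX> (direct_sum Ms)"
    and summand_closed:
      "\<lbrakk>M \<in> \<XX>; fg_module R N; fg_module R N'; mod_isomorphic R (direct_sum [N, N']) M\<rbrakk>
        \<Longrightarrow> N \<in> \<XX>"
    and kernel_closed:
      "\<lbrakk>fg_module R L; short_exact R L M N f g; M \<in> \<XX>; N \<in> \<XX>\<rbrakk> \<Longrightarrow> L \<in> \<XX>"
    and cokernel_closed:
      "\<lbrakk>fg_module R N; short_exact R L M N f g; L \<in> \<XX>; M \<in> \<XX>\<rbrakk> \<Longrightarrow> N \<in> \<XX>"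

lemma (in prethick) contains_up_to_iso_iff:
  assumes "fg_module R N"
  shows "contains_up_to_iso R \<XX> N \<longleftrightarrow> N \<in> \<XX>"
proof
  show "N \<in> \<XX>" if "contains_up_to_iso R \<XX> N"
    using that iso_closed assms unfolding contains_up_to_iso_def by blast
  have "mod_isomorphic R N N"
    unfolding mod_isomorphic_def mod_hom_def
    by (rule bexI[of _ id]) auto
  then show "contains_up_to_iso R \<XX> N" if "N \<in> \<XX>"
    using that unfolding contains_up_to_iso_def by blast
qed

lemma (in module) submodule_mod_span:
  assumes "S \<subseteq> carrier M"
  shows "submodule (mod_span R M S) R M"
proof (rule submoduleI)
  note E = submoduleE
  show "mod_span R M S \<subseteq> carrier M"
    unfolding mod_span_def using carrier_is_submodule assms by blast
  have z: "\<zero>\<^bsub>M\<^esub> \<in> H" if "submodule H R M" for H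
    using that by (metis submodule_def subgroup.one_closed monoid.simps(2))
  show "\<zero>\<^bsub>M\<^esub> \<in> mod_span R M S"
    unfolding mod_span_def using z by blast
  show "\<ominus>\<^bsub>M\<^esub> a \<in> mod_span R M S" if "a \<in> mod_span R M S" for a
    using that E(3) unfolding mod_span_def by blast
  show "a \<oplus>\<^bsub>M\<^esub> b \<in> mod_span R M S" if "a \<in> mod_span R M S" "b \<in> mod_span R M S" for a b
    using that E(5) unfolding mod_span_def by blast
  show "a \<odot>\<^bsub>M\<^esub> x \<in> mod_span R M S" if "a \<in> carrier R" "x \<in> mod_span R M S" for a x
    using that E(4) unfolding mod_span_def by blast
qed

lemma (in module) mod_span_insert_subset:
  assumes "insert g S \<subseteq> carrier M"
  shows "mod_span R M (insert g S) \<subseteq> {a \<odot>\<^bsub>M\<^esub> g \<oplus>\<^bsub>M\<^esub> v | a v. a \<in> carrier R \<and> v \<in> mod_span R M S}"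
    (is "_ \<subseteq> ?H")
proof -
  have g: "g \<in> carrier M" and S: "submodule (mod_span R M S) R M"
    using assms submodule_mod_span by auto
  note E = submoduleE[OF S]
  have C: "v \<in> carrier M" if "v \<in> mod_span R M S" for v using that E(1) by blast
  have Z: "\<zero>\<^bsub>M\<^esub> \<in> mod_span R M S"
    using S by (metis submodule_def subgroup.one_closed monoid.simps(2))
  have "submodule ?H R M"
  proof (rule submoduleI)
    show "?H \<subseteq> carrier M" using g C by auto
    have "\<zero>\<^bsub>M\<^esub> = \<zero>\<^bsub>R\<^esub> \<odot>\<^bsub>M\<^esub> g \<oplus>\<^bsub>M\<^esub> \<zero>\<^bsub>M\<^esub>" using g by simp
    then show "\<zero>\<^bsub>M\<^esub> \<in> ?H" using Z R.zero_closed by blast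
    fix x assume "x \<in> ?H"
    then obtain a v where x: "x = a \<odot>\<^bsub>M\<^esub> g \<oplus>\<^bsub>M\<^esub> v" "a \<in> carrier R" "v \<in> mod_span R M S" by blast
    have "\<ominus>\<^bsub>M\<^esub> x = (\<ominus>\<^bsub>R\<^esub> a) \<odot>\<^bsub>M\<^esub> g \<oplus>\<^bsub>M\<^esub> (\<ominus>\<^bsub>M\<^esub> v)"
      using x g C by (simp add: smult_l_minus M.minus_add)
    then show "\<ominus>\<^bsub>M\<^esub> x \<in> ?H" using x E(3) R.a_inv_closed by blast
    show "c \<odot>\<^bsub>M\<^esub> x \<in> ?H" if c: "c \<in> carrier R" for c
    proof -
      have "c \<odot>\<^bsub>M\<^esub> x = (c \<otimes>\<^bsub>R\<^esub> a) \<odot>\<^bsub>M\<^esub> g \<oplus>\<^bsub>M\<^esub> c \<odot>\<^bsub>M\<^esub> v"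
        using x g C c by (simp add: smult_r_distr smult_assoc1)
      then show ?thesis using x c E(4) R.m_closed by blast
    qed
    fix y assume "y \<in> ?H"
    then obtain b w where y: "y = b \<odot>\<^bsub>M\<^esub> g \<oplus>\<^bsub>M\<^esub> w" "b \<in> carrier R" "w \<in> mod_span R M S" by blast
    have "x \<oplus>\<^bsub>M\<^esub> y = (a \<oplus>\<^bsub>R\<^esub> b) \<odot>\<^bsub>M\<^esub> g \<oplus>\<^bsub>M\<^esub> (v \<oplus>\<^bsub>M\<^esub> w)"
      using x y g C by (simp add: smult_l_distr M.a_ac)
    then show "x \<oplus>\<^bsub>M\<^esub> y \<in> ?H" using x y E(5) R.a_closed by blast
  qed
  moreover have "insert g S \<subseteq> ?H"
  proof -
    have "g = \<one>\<^bsub>R\<^esub> \<odot>\<^bsub>M\<^esub> g \<oplus>\<^bsub>M\<^esub> \<zero>\<^bsub>M\<^esub>" using g by simp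
    then have "g \<in> ?H" using Z R.one_closed by blast
    moreover have "s \<in> ?H" if "s \<in> S" for s
    proof -
      have "s = \<zero>\<^bsub>R\<^esub> \<odot>\<^bsub>M\<^esub> g \<oplus>\<^bsub>M\<^esub> s" using g that assms by auto
      moreover have "s \<in> mod_span R M S" using that unfolding mod_span_def by blast
      ultimately show ?thesis using R.zero_closed by blast
    qed
    ultimately show ?thesis by blast
  qed
  ultimately show ?thesis unfolding mod_span_def[of R M "insert g S"] by blast
qed

lemma (in module) mod_span_inj_lists:
  assumes "finite A" "A \<subseteq> carrier M"
  shows "\<exists>h :: 'c \<Rightarrow> 'a list. inj_on h (mod_span R M A)"
  using assms
proof (induction A rule: finite_induct)
  case empty
  have "submodule {\<zero>\<^bsub>M\<^esub>} R M" by (rule submoduleI) auto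
  then have "mod_span R M {} \<subseteq> {\<zero>\<^bsub>M\<^esub>}" unfolding mod_span_def by blast
  then have "inj_on (\<lambda>_. [] :: 'a list) (mod_span R M {})" by (auto simp: inj_on_def)
  then show ?case by blast
next
  case (insert g A)
  then obtain h :: "'c \<Rightarrow> 'a list" where h: "inj_on h (mod_span R M A)" by auto
  have "\<forall>x\<in>mod_span R M (insert g A). \<exists>a v. x = a \<odot>\<^bsub>M\<^esub> g \<oplus>\<^bsub>M\<^esub> v \<and> v \<in> mod_span R M A"
    using mod_span_insert_subset[OF insert.prems] by blast
  then obtain a v where av: "\<And>x. x \<in> mod_span R M (insert g A) \<Longrightarrow>
      x = a x \<odot>\<^bsub>M\<^esub> g \<oplus>\<^bsub>M\<^esub> v x \<and> v x \<in> mod_span R M A"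
    by metis
  have "inj_on (\<lambda>x. a x # h (v x)) (mod_span R M (insert g A))"
  proof (rule inj_onI)
    fix x y assume x: "x \<in> mod_span R M (insert g A)" and y: "y \<in> mod_span R M (insert g A)"
      and eq: "a x # h (v x) = a y # h (v y)"
    then have "v x = v y" using h av by (auto dest: inj_onD)
    then show "x = y" using eq av[OF x] av[OF y] by auto
  qed
  then show ?case by blast
qed

lemma fg_module_on_lists:
  fixes R :: "('a, 'r) ring_scheme" and M :: "('a, 'b) module"
  assumes "fg_module R M"
  shows "\<exists>N :: ('a, 'a list) module. fg_module R N \<and> mod_isomorphic R M N"
proof -
  interpret module R M using assms unfolding fg_module_def by blast
  obtain A where A: "finite A" "A \<subseteq> carrier M" "mod_span R M A = carrier M"
    using assms unfolding fg_module_def by blast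
  obtain h :: "'b \<Rightarrow> 'a list" where h: "inj_on h (carrier M)"
    using mod_span_inj_lists[OF A(1,2)] A(3) by auto
  define k where "k = inv_into (carrier M) h"
  have kh: "k (h x) = x" if "x \<in> carrier M" for x
    unfolding k_def using h that by simp
  define N :: "('a, 'a list) module" where
    "N = \<lparr>carrier = h ` carrier M, monoid.mult = undefined, monoid.one = undefined, ring.zero = h \<zero>\<^bsub>M\<^esub>,
          ring.add = (\<lambda>u v. h (k u \<oplus>\<^bsub>M\<^esub> k v)), module.smult = (\<lambda>a u. h (a \<odot>\<^bsub>M\<^esub> k u))\<rparr>"
  have N: "carrier N = h ` carrier M" "\<zero>\<^bsub>N\<^esub> = h \<zero>\<^bsub>M\<^esub>"
    "\<And>x y. x \<in> carrier M \<Longrightarrow> y \<in> carrier M \<Longrightarrow> h x \<oplus>\<^bsub>N\<^esub> h y = h (x \<oplus>\<^bsub>M\<^esub> y)"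
    "\<And>a x. x \<in> carrier M \<Longrightarrow> a \<odot>\<^bsub>N\<^esub> h x = h (a \<odot>\<^bsub>M\<^esub> x)"
    by (auto simp: N_def kh)
  have mN: "module R N"
  proof (rule moduleI)
    show "cring R" by (rule R.is_cring)
    show "abelian_group N"
    proof (rule abelian_groupI)
      fix x assume "x \<in> carrier N"
      then obtain x' where x': "x = h x'" "x' \<in> carrier M" by (auto simp: N)
      then have "h (\<ominus>\<^bsub>M\<^esub> x') \<oplus>\<^bsub>N\<^esub> x = \<zero>\<^bsub>N\<^esub>" by (simp add: N M.l_neg)
      then show "\<exists>y\<in>carrier N. y \<oplus>\<^bsub>N\<^esub> x = \<zero>\<^bsub>N\<^esub>" using x' by (auto simp: N)
    qed (auto simp: N M.a_ac)
  qed (auto simp: N smult_l_distr smult_r_distr smult_assoc1)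
  interpret N: module R N by (rule mN)
  have "mod_span R N (h ` A) = carrier N"
  proof
    show "mod_span R N (h ` A) \<subseteq> carrier N"
      using N.carrier_is_submodule image_mono[OF A(2), of h]
      unfolding mod_span_def N(1) by blast
    show "carrier N \<subseteq> mod_span R N (h ` A)"
      unfolding mod_span_def
    proof (rule Inter_greatest)
      fix H assume "H \<in> {H. submodule H R N \<and> h ` A \<subseteq> H}"
      then have H: "submodule H R N" "h ` A \<subseteq> H" by auto
      note E = N.submoduleE[OF H(1)]
      have zH: "\<zero>\<^bsub>N\<^esub> \<in> H"
        using H(1) by (metis submodule_def subgroup.one_closed monoid.simps(2))
      have neg: "h (\<ominus>\<^bsub>M\<^esub> x) = \<ominus>\<^bsub>N\<^esub> (h x)" if "x \<in> carrier M" for x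
        using that by (intro N.minus_equality[symmetric]) (auto simp: N M.l_neg)
      define H' where "H' = {x \<in> carrier M. h x \<in> H}"
      have "submodule H' R M"
      proof (rule submoduleI)
        show "H' \<subseteq> carrier M" by (auto simp: H'_def)
        show "\<zero>\<^bsub>M\<^esub> \<in> H'" using zH by (auto simp: H'_def N)
        show "\<ominus>\<^bsub>M\<^esub> x \<in> H'" if "x \<in> H'" for x
          using that E(3) neg by (auto simp: H'_def)
        show "x \<oplus>\<^bsub>M\<^esub> y \<in> H'" if "x \<in> H'" "y \<in> H'" for x y
          using that E(5)[of "h x" "h y"] by (auto simp: H'_def N)
        show "a \<odot>\<^bsub>M\<^esub> x \<in> H'" if "a \<in> carrier R" "x \<in> H'" for a x
          using that E(4)[of a "h x"] by (auto simp: H'_def N)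
      qed
      moreover have "A \<subseteq> H'" using A(2) H(2) by (auto simp: H'_def)
      ultimately have "carrier M \<subseteq> H'" using A(3) unfolding mod_span_def by blast
      then show "carrier N \<subseteq> H" by (auto simp: N H'_def)
    qed
  qed
  then have "fg_module R N"
    unfolding fg_module_def using mN A(1,2) by (intro conjI exI[of _ "h ` A"]) (auto simp: N)
  moreover have "mod_isomorphic R M N"
    unfolding mod_isomorphic_def mod_hom_def
    by (rule bexI[of _ h]) (auto simp: N bij_betw_def h)
  ultimately show ?thesis by blast
qed

end

theory Submission
  imports Defs
begin

text \<open>
  Why the theorem holds. Call elements of \<open>\<mm>\<close> generic if they avoid a suitable finite set of
  primes different from \<open>\<mm>\<close>. Take a sequence \<open>x\<^sub>1,\<dots>,x\<^sub>s\<close> in \<open>\<mm>\<close> of maximal length that is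
  \<open>M\<close>-regular and such that every prime containing it has height at least \<open>s\<close>. Regularity gives
  \<open>s \<le> depth M < dim R\<close>, and the condition on heights makes it a subsystem of parameters
  (\<open>height_generic_subsystem\<close>). So \<open>N = M/(x\<^sub>1,\<dots>,x\<^sub>s)M\<close> is in \<open>\<XX>\<close>, and so is \<open>N/yN\<close> for every
  generic \<open>y\<close>, because appending \<open>y\<close> keeps the condition on heights (\<open>height_generic_extend\<close>).

  Let \<open>\<Gamma>\<close> be the submodule of \<open>N\<close> of elements on which every member of \<open>\<mm>\<close> is nilpotent. A
  generic \<open>y\<close> is a nonzerodivisor on \<open>N/\<Gamma>\<close> (\<open>generic_elements_regular_mod_torsion\<close>). If \<open>\<Gamma>\<close> were
  zero, the sequence could be prolonged by \<open>y\<close>; hence \<open>\<Gamma> \<noteq> 0\<close>. The exact sequences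
  \<open>0 \<rightarrow> yN \<rightarrow> N \<rightarrow> N/yN \<rightarrow> 0\<close> and \<open>0 \<rightarrow> (0 : y) \<rightarrow> N \<rightarrow> yN \<rightarrow> 0\<close> put \<open>yN\<close> and \<open>(0 : y)\<close> into \<open>\<XX>\<close>.
  A high power of a generic \<open>y\<close> kills \<open>\<Gamma>\<close>, so that \<open>\<Gamma> = (0 : y\<^sup>n)\<close> lies in \<open>\<XX>\<close>; and for generic
  \<open>z\<close> the quotient \<open>z\<Gamma>\<close> of \<open>\<Gamma>\<close> by \<open>(0 : z)\<close> lies in \<open>\<XX>\<close>. Among the generic \<open>z\<close> and \<open>z = 1\<close> choose
  one with \<open>z\<Gamma> \<noteq> 0\<close> for which the kernel of \<open>z\<close> on \<open>\<Gamma>\<close> is maximal. Then every generic element kills \<open>z\<Gamma>\<close>, and by prime avoidance all of \<open>\<mm>\<close>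
  does (\<open>torsion_contains_vector_space\<close>). Thus \<open>\<XX>\<close> contains a nonzero vector space over the
  residue field, and with it the one-dimensional direct summand
  (\<open>vector_space_contains_residue_field\<close>).

  All of this presupposes that \<open>dim R\<close> is finite: this excludes \<open>M = 0\<close>, whose depth is \<open>\<infinity>\<close>, and it
  makes systems of parameters exist. Finiteness is Krull's height theorem (\<open>krull_height\<close>). It is
  proved here inside the ring \<open>R\<close>: the ideals of a localisation \<open>R\<^sub>p\<close> are represented by the
  ideals of \<open>R\<close> that equal their \<open>p\<close>-saturation, and arguments by length or by determinants are
  replaced by the choice of maximal elements in sets of ideals.
\<close>

section \<open>Ideals in Noetherian rings\<close>

locale noetherian_cring = noetherian_ring R + cring R for R (structure)

sublocale noetherian_local_ring \<subseteq> noetherian_cring ..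

definition ideal_adjoin :: "('a, 'r) ring_scheme \<Rightarrow> 'a set \<Rightarrow> 'a \<Rightarrow> 'a set" where
  "ideal_adjoin R I a = {i \<oplus>\<^bsub>R\<^esub> r \<otimes>\<^bsub>R\<^esub> a | i r. i \<in> I \<and> r \<in> carrier R}"

text \<open>The contraction to \<open>R\<close> of the extension of \<open>I\<close> to the localisation \<open>R\<^sub>p\<close>. Ideals that are equal
  to their \<open>p\<close>-saturation correspond to ideals of \<open>R\<^sub>p\<close>.\<close>
definition saturation :: "('a, 'r) ring_scheme \<Rightarrow> 'a set \<Rightarrow> 'a set \<Rightarrow> 'a set" where
  "saturation R p I = {r \<in> carrier R. \<exists>s \<in> carrier R - p. s \<otimes>\<^bsub>R\<^esub> r \<in> I}"

definition minimal_prime_over :: "('a, 'r) ring_scheme \<Rightarrow> 'a set \<Rightarrow> 'a set \<Rightarrow> bool" where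
  "minimal_prime_over R p I \<longleftrightarrow> primeideal p R \<and> I \<subseteq> p \<and>
     (\<forall>q. primeideal q R \<longrightarrow> I \<subseteq> q \<longrightarrow> q \<subseteq> p \<longrightarrow> q = p)"

context cring
begin

lemma ideal_mem:
  assumes "ideal I R"
  shows "I \<subseteq> carrier R" "\<zero> \<in> I"
    "\<And>a b. \<lbrakk>a \<in> I; b \<in> I\<rbrakk> \<Longrightarrow> a \<oplus> b \<in> I"
    "\<And>a b. \<lbrakk>a \<in> I; b \<in> I\<rbrakk> \<Longrightarrow> a \<ominus> b \<in> I"
    "\<And>a. a \<in> I \<Longrightarrow> \<ominus> a \<in> I"
    "\<And>a r. \<lbrakk>a \<in> I; r \<in> carrier R\<rbrakk> \<Longrightarrow> r \<otimes> a \<in> I"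
    "\<And>a r. \<lbrakk>a \<in> I; r \<in> carrier R\<rbrakk> \<Longrightarrow> a \<otimes> r \<in> I"
proof -
  interpret ideal I R by fact
  show "I \<subseteq> carrier R" by (rule a_subset)
  show "\<zero> \<in> I" by simp
  show "a \<oplus> b \<in> I" if "a \<in> I" "b \<in> I" for a b using that by simp
  show "\<ominus> a \<in> I" if "a \<in> I" for a using that by simp
  show "a \<ominus> b \<in> I" if "a \<in> I" "b \<in> I" for a b using that by (simp add: a_minus_def)
  show "r \<otimes> a \<in> I" if "a \<in> I" "r \<in> carrier R" for a r using that by (rule I_l_closed)
  show "a \<otimes> r \<in> I" if "a \<in> I" "r \<in> carrier R" for a r using that by (rule I_r_closed)
qed

lemma ideal_by_closure:
  assumes "I \<subseteq> carrier R" "\<zero> \<in> I"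
    and add: "\<And>a b. \<lbrakk>a \<in> I; b \<in> I\<rbrakk> \<Longrightarrow> a \<oplus> b \<in> I"
    and mult: "\<And>a r. \<lbrakk>a \<in> I; r \<in> carrier R\<rbrakk> \<Longrightarrow> r \<otimes> a \<in> I"
  shows "ideal I R"
proof (rule idealI)
  show "ring R" ..
  have "\<ominus> a \<in> I" if "a \<in> I" for a
  proof -
    have "\<ominus> a = (\<ominus> \<one>) \<otimes> a" using that assms(1) by (simp add: subset_iff l_minus)
    then show ?thesis using mult[OF that] by simp
  qed
  then show "subgroup I (add_monoid R)"
    using assms by (intro add.subgroupI) (auto simp: a_inv_def)
  show "x \<otimes> a \<in> I" if "a \<in> I" "x \<in> carrier R" for a x using mult that .
  show "a \<otimes> x \<in> I" if "a \<in> I" "x \<in> carrier R" for a x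
  proof -
    have "a \<in> carrier R" using assms(1) that(1) by blast
    then show ?thesis using mult[OF that] that m_comm by simp
  qed
qed

lemma primeD:
  assumes "primeideal p R"
  shows "ideal p R" "\<one> \<notin> p" "p \<subseteq> carrier R" "p \<noteq> carrier R"
    "\<And>a b. \<lbrakk>a \<in> carrier R; b \<in> carrier R; a \<otimes> b \<in> p\<rbrakk> \<Longrightarrow> a \<in> p \<or> b \<in> p"
proof -
  interpret primeideal p R by fact
  show 1: "ideal p R" by (rule is_ideal)
  show "\<one> \<notin> p" using one_imp_carrier I_notcarr by metis
  show "p \<subseteq> carrier R" by (rule a_subset)
  show "p \<noteq> carrier R" using I_notcarr by metis
  show "\<And>a b. \<lbrakk>a \<in> carrier R; b \<in> carrier R; a \<otimes> b \<in> p\<rbrakk> \<Longrightarrow> a \<in> p \<or> b \<in> p"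
    by (rule I_prime)
qed

lemma primeI_by_elements:
  assumes "ideal p R" "\<one> \<notin> p"
    "\<And>a b. \<lbrakk>a \<in> carrier R; b \<in> carrier R; a \<notin> p; b \<notin> p\<rbrakk> \<Longrightarrow> a \<otimes> b \<notin> p"
  shows "primeideal p R"
  by (rule primeidealI) (use assms cring_axioms in auto)

lemma prime_pow:
  assumes "primeideal p R" "a \<in> carrier R" "a [^] (n::nat) \<in> p"
  shows "a \<in> p"
  using assms(3)
proof (induction n)
  case 0 then show ?case using primeD(2)[OF assms(1)] by simp
next
  case (Suc n) then show ?case using primeD(5)[OF assms(1), of "a [^] n" a] assms(2) by auto
qed

lemma ideal_adjoin_ideal:
  assumes "ideal I R" "a \<in> carrier R"
  shows "ideal (ideal_adjoin R I a) R"
proof (rule ideal_by_closure)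
  note I = ideal_mem[OF assms(1)]
  have C: "i \<in> carrier R" if "i \<in> I" for i using I(1) that by blast
  show "ideal_adjoin R I a \<subseteq> carrier R" using C assms(2) by (auto simp: ideal_adjoin_def)
  have "\<zero> = \<zero> \<oplus> \<zero> \<otimes> a" using assms by simp
  then show "\<zero> \<in> ideal_adjoin R I a" using I(2) by (auto simp: ideal_adjoin_def)
  fix x assume "x \<in> ideal_adjoin R I a"
  then obtain i r where x: "x = i \<oplus> r \<otimes> a" "i \<in> I" "r \<in> carrier R" by (auto simp: ideal_adjoin_def)
  show "s \<otimes> x \<in> ideal_adjoin R I a" if s: "s \<in> carrier R" for s
  proof -
    have "s \<otimes> x = s \<otimes> i \<oplus> (s \<otimes> r) \<otimes> a" using x C s assms(2) by (simp add: r_distr m_assoc)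
    then show ?thesis using I(6) x s by (auto simp: ideal_adjoin_def)
  qed
  fix y assume "y \<in> ideal_adjoin R I a"
  then obtain j s where y: "y = j \<oplus> s \<otimes> a" "j \<in> I" "s \<in> carrier R" by (auto simp: ideal_adjoin_def)
  have "x \<oplus> y = (i \<oplus> j) \<oplus> (r \<oplus> s) \<otimes> a"
    using x y C assms(2) by (simp add: l_distr a_ac)
  then show "x \<oplus> y \<in> ideal_adjoin R I a"
    using I(3) x y by (auto simp: ideal_adjoin_def)
qed

lemma ideal_adjoin_contains:
  assumes "ideal I R" "a \<in> carrier R"
  shows "I \<subseteq> ideal_adjoin R I a" "a \<in> ideal_adjoin R I a"
proof -
  note I = ideal_mem[OF assms(1)]
  show "I \<subseteq> ideal_adjoin R I a"
  proof
    fix i assume "i \<in> I"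
    moreover from this have "i = i \<oplus> \<zero> \<otimes> a" using I(1) assms by auto
    ultimately show "i \<in> ideal_adjoin R I a" unfolding ideal_adjoin_def by blast
  qed
  have "a = \<zero> \<oplus> \<one> \<otimes> a" using assms by simp
  then show "a \<in> ideal_adjoin R I a" using I(2) unfolding ideal_adjoin_def by blast
qed

lemma ideal_adjoin_least:
  assumes "ideal K R" "I \<subseteq> K" "a \<in> K"
  shows "ideal_adjoin R I a \<subseteq> K"
  using assms(2,3) ideal_mem(3,6)[OF assms(1)] unfolding ideal_adjoin_def by blast

lemma saturation_ideal:
  assumes p: "primeideal p R" and I: "ideal I R"
  shows "ideal (saturation R p I) R"
proof (rule ideal_by_closure)
  note I' = ideal_mem[OF I] and p' = primeD[OF p]
  show "saturation R p I \<subseteq> carrier R" by (auto simp: saturation_def)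
  have "\<one> \<otimes> \<zero> \<in> I" using I'(2) by simp
  then show "\<zero> \<in> saturation R p I" using p'(2) by (auto simp: saturation_def)
  fix x assume "x \<in> saturation R p I"
  then obtain s where x: "x \<in> carrier R" "s \<in> carrier R" "s \<notin> p" "s \<otimes> x \<in> I"
    by (auto simp: saturation_def)
  show "r \<otimes> x \<in> saturation R p I" if r: "r \<in> carrier R" for r
  proof -
    have "s \<otimes> (r \<otimes> x) = r \<otimes> (s \<otimes> x)" using x r by (simp add: m_ac)
    then have "s \<otimes> (r \<otimes> x) \<in> I" using I'(6) x r by simp
    then show ?thesis using x r by (auto simp: saturation_def)
  qed
  fix y assume "y \<in> saturation R p I"
  then obtain t where y: "y \<in> carrier R" "t \<in> carrier R" "t \<notin> p" "t \<otimes> y \<in> I"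
    by (auto simp: saturation_def)
  have "(s \<otimes> t) \<otimes> (x \<oplus> y) = t \<otimes> (s \<otimes> x) \<oplus> s \<otimes> (t \<otimes> y)"
    using x y by (simp add: r_distr m_ac)
  then have "(s \<otimes> t) \<otimes> (x \<oplus> y) \<in> I" using I' x y by simp
  moreover have "s \<otimes> t \<in> carrier R - p" using p'(5) x y by auto
  ultimately show "x \<oplus> y \<in> saturation R p I" using x y by (auto simp: saturation_def)
qed

lemma saturation_contains:
  assumes "primeideal p R" "ideal I R"
  shows "I \<subseteq> saturation R p I"
proof
  fix i assume "i \<in> I"
  then have "i \<in> carrier R" "\<one> \<otimes> i \<in> I" using ideal_mem(1)[OF assms(2)] by auto
  then show "i \<in> saturation R p I"
    using primeD(2)[OF assms(1)] unfolding saturation_def by blast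
qed

lemma saturation_mono: "I \<subseteq> J \<Longrightarrow> saturation R p I \<subseteq> saturation R p J"
  by (auto simp: saturation_def)

text \<open>Localising at a larger prime ideal inverts fewer elements.\<close>
lemma saturation_anti_mono: "q \<subseteq> p \<Longrightarrow> saturation R p I \<subseteq> saturation R q I"
  by (auto simp: saturation_def)

lemma saturation_idem:
  assumes "primeideal p R" "ideal I R"
  shows "saturation R p (saturation R p I) = saturation R p I"
proof
  show "saturation R p (saturation R p I) \<subseteq> saturation R p I"
  proof
    fix x assume "x \<in> saturation R p (saturation R p I)"
    then obtain s t where x: "x \<in> carrier R" "s \<in> carrier R - p" "t \<in> carrier R - p" "t \<otimes> (s \<otimes> x) \<in> I"
      by (auto simp: saturation_def)
    then have "(t \<otimes> s) \<otimes> x \<in> I" by (simp add: m_assoc)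
    moreover have "t \<otimes> s \<in> carrier R - p" using primeD(5)[OF assms(1)] x by auto
    ultimately show "x \<in> saturation R p I" using x by (auto simp: saturation_def)
  qed
  show "saturation R p I \<subseteq> saturation R p (saturation R p I)"
    by (rule saturation_contains[OF assms(1) saturation_ideal[OF assms]])
qed

lemma saturatedD:
  assumes "saturation R p I = I" "s \<in> carrier R" "s \<notin> p" "r \<in> carrier R" "s \<otimes> r \<in> I"
  shows "r \<in> I"
  using assms by (auto simp: saturation_def)

end

context noetherian_cring
begin

lemma ideal_maximal_element:
  assumes "F \<noteq> {}" and F: "\<And>I. I \<in> F \<Longrightarrow> ideal I R"
  obtains K where "K \<in> F" "\<And>I. \<lbrakk>I \<in> F; K \<subseteq> I\<rbrakk> \<Longrightarrow> I = K"
proof -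
  have "\<exists>K\<in>F. \<forall>I\<in>F. K \<subseteq> I \<longrightarrow> I = K"
  proof (rule subset_Zorn_nonempty[OF assms(1)])
    fix C assume C: "C \<noteq> {}" "subset.chain F C"
    then have "subset.chain {I. ideal I R} C" using F by (auto simp: subset.chain_def)
    then have "\<Union>C \<in> C" by (rule ideal_chain_is_trivial[OF C(1)])
    then show "\<Union>C \<in> F" using C(2) by (auto simp: subset.chain_def)
  qed
  then show ?thesis using that by blast
qed

lemma ideal_noetherian_induct [consumes 1, case_names step]:
  assumes "ideal I R"
    and step: "\<And>I. \<lbrakk>ideal I R; \<And>J. \<lbrakk>ideal J R; I \<subset> J\<rbrakk> \<Longrightarrow> P J\<rbrakk> \<Longrightarrow> P I"
  shows "P I"
proof (rule ccontr)
  assume "\<not> P I"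
  then obtain K where K: "K \<in> {I. ideal I R \<and> \<not> P I}"
      "\<And>J. \<lbrakk>J \<in> {I. ideal I R \<and> \<not> P I}; K \<subseteq> J\<rbrakk> \<Longrightarrow> J = K"
    using ideal_maximal_element[of "{I. ideal I R \<and> \<not> P I}"] assms(1) by blast
  have "P J" if "ideal J R" "K \<subset> J" for J
    using K(2)[of J] that by blast
  then have "P K" using K(1) step[of K] by blast
  then show False using K(1) by simp
qed

text \<open>An ideal that is maximal among those disjoint from a multiplicatively closed set is prime: if
  neither \<open>a\<close> nor \<open>b\<close> lies in it, adjoining either one produces an element of the set, and the
  product of these two elements would lie in the ideal if \<open>ab\<close> did.\<close>
lemma exists_prime_disjoint:
  assumes I: "ideal I R" and T: "T \<subseteq> carrier R" "\<one> \<in> T" "\<And>a b. \<lbrakk>a \<in> T; b \<in> T\<rbrakk> \<Longrightarrow> a \<otimes> b \<in> T"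
    and disj: "I \<inter> T = {}"
  obtains p where "primeideal p R" "I \<subseteq> p" "p \<inter> T = {}"
proof -
  let ?F = "{K. ideal K R \<and> I \<subseteq> K \<and> K \<inter> T = {}}"
  obtain p where p: "p \<in> ?F" "\<And>K. \<lbrakk>K \<in> ?F; p \<subseteq> K\<rbrakk> \<Longrightarrow> K = p"
    using ideal_maximal_element[of ?F] I disj by blast
  have pI: "ideal p R" using p by simp
  have meets: "\<exists>i\<in>p. \<exists>r\<in>carrier R. i \<oplus> r \<otimes> a \<in> T" if a: "a \<in> carrier R" "a \<notin> p" for a
  proof (rule ccontr)
    assume "\<not> ?thesis"
    then have "ideal_adjoin R p a \<in> ?F"
      using ideal_adjoin_ideal[OF pI a(1)] ideal_adjoin_contains[OF pI a(1)] p(1)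
      by (auto simp: ideal_adjoin_def)
    then show False
      using p(2) ideal_adjoin_contains[OF pI a(1)] a(2) by blast
  qed
  have "primeideal p R"
  proof (rule primeI_by_elements[OF pI])
    show "\<one> \<notin> p" using p(1) T(2) by blast
    fix a b assume ab: "a \<in> carrier R" "b \<in> carrier R" "a \<notin> p" "b \<notin> p"
    obtain i r where i: "i \<in> p" "r \<in> carrier R" "i \<oplus> r \<otimes> a \<in> T" using meets[OF ab(1,3)] by blast
    obtain j s where j: "j \<in> p" "s \<in> carrier R" "j \<oplus> s \<otimes> b \<in> T" using meets[OF ab(2,4)] by blast
    have C: "i \<in> carrier R" "j \<in> carrier R" using i j ideal_mem(1)[OF pI] by auto
    show "a \<otimes> b \<notin> p"
    proof
      assume *: "a \<otimes> b \<in> p"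
      have "(i \<oplus> r \<otimes> a) \<otimes> (j \<oplus> s \<otimes> b) = i \<otimes> (j \<oplus> s \<otimes> b) \<oplus> (r \<otimes> a) \<otimes> j \<oplus> (r \<otimes> s) \<otimes> (a \<otimes> b)"
        using C ab i j by algebra
      also have "\<dots> \<in> p"
        using * C ab i j ideal_mem(3,6,7)[OF pI] by simp
      finally show False using T(3)[OF i(3) j(3)] p(1) by auto
    qed
  qed
  then show ?thesis using that p(1) by auto
qed

section \<open>Krull's principal ideal theorem\<close>

lemma colon_ideal:
  assumes "ideal I R" "r \<in> carrier R"
  shows "ideal {a \<in> carrier R. a \<otimes> r \<in> I} R"
proof (rule ideal_by_closure)
  note I = ideal_mem[OF assms(1)]
  show "\<zero> \<in> {a \<in> carrier R. a \<otimes> r \<in> I}" using I(2) assms(2) by simp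
  show "a \<oplus> b \<in> {a \<in> carrier R. a \<otimes> r \<in> I}"
    if "a \<in> {a \<in> carrier R. a \<otimes> r \<in> I}" "b \<in> {a \<in> carrier R. a \<otimes> r \<in> I}" for a b
    using that I(3) assms(2) by (simp add: l_distr)
  show "c \<otimes> a \<in> {a \<in> carrier R. a \<otimes> r \<in> I}"
    if "a \<in> {a \<in> carrier R. a \<otimes> r \<in> I}" "c \<in> carrier R" for a c
    using that I(6) assms(2) by (simp add: m_assoc)
qed auto

text \<open>In \<open>R\<^sub>p\<close> the ideal \<open>p\<close> is associated to \<open>R/I\<close> when it is minimal over \<open>I\<close>: a maximal member of the set
  of all \<open>(I : r)\<close>, \<open>r \<notin> I\<close>, is prime, and saturation keeps it inside \<open>p\<close>. The element \<open>r\<close> is what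
  makes the ideal generated by \<open>I\<close> and \<open>r\<close> a simple extension of \<open>I\<close> locally at \<open>p\<close>.\<close>
lemma minimal_prime_is_colon:
  assumes p: "primeideal p R" and I: "ideal I R" "saturation R p I = I" "I \<noteq> carrier R"
    and min: "\<And>q. \<lbrakk>primeideal q R; I \<subseteq> q; q \<subseteq> p\<rbrakk> \<Longrightarrow> q = p"
  obtains r where "r \<in> carrier R" "r \<notin> I" "\<And>a. a \<in> p \<Longrightarrow> a \<otimes> r \<in> I"
proof -
  let ?col = "\<lambda>r. {a \<in> carrier R. a \<otimes> r \<in> I}"
  let ?F = "?col ` (carrier R - I)"
  note I' = ideal_mem[OF I(1)]
  have "?F \<noteq> {}" using I(3) I'(1) by blast
  moreover have "ideal K R" if "K \<in> ?F" for K using that colon_ideal[OF I(1)] by blast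
  ultimately obtain K where K: "K \<in> ?F" "\<And>L. \<lbrakk>L \<in> ?F; K \<subseteq> L\<rbrakk> \<Longrightarrow> L = K"
    using ideal_maximal_element[of ?F] by blast
  then obtain r where r: "r \<in> carrier R" "r \<notin> I" "K = ?col r" by blast
  have "primeideal K R"
  proof (rule primeI_by_elements)
    show "ideal K R" using colon_ideal[OF I(1) r(1)] r(3) by simp
    show "\<one> \<notin> K" using r by simp
    fix a b assume ab: "a \<in> carrier R" "b \<in> carrier R" "a \<notin> K" "b \<notin> K"
    show "a \<otimes> b \<notin> K"
    proof
      assume "a \<otimes> b \<in> K"
      then have *: "b \<in> ?col (a \<otimes> r)" using r ab by (simp add: m_ac)
      have "a \<otimes> r \<in> carrier R - I" using ab r by auto
      then have "?col (a \<otimes> r) \<in> ?F" by blast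
      moreover have "K \<subseteq> ?col (a \<otimes> r)"
      proof
        fix c assume c: "c \<in> K"
        have "c \<otimes> (a \<otimes> r) = a \<otimes> (c \<otimes> r)" using c ab r by (simp add: m_ac)
        then show "c \<in> ?col (a \<otimes> r)" using c r ab I'(6) by simp
      qed
      ultimately have "?col (a \<otimes> r) = K" by (rule K(2))
      then show False using * ab(4) by blast
    qed
  qed
  moreover have "I \<subseteq> K"
  proof
    fix i assume "i \<in> I"
    then show "i \<in> K" using r I'(1,7) by auto
  qed
  moreover have "K \<subseteq> p"
  proof
    fix a assume "a \<in> K"
    then show "a \<in> p" using saturatedD[OF I(2), of a r] r by blast
  qed
  ultimately have "K = p" by (rule min)
  then show ?thesis using that[of r] r by blast
qed

text \<open>The descending chain condition in the Artinian ring \<open>R\<^sub>p/I\<close>, by Noetherian induction on \<open>I\<close>. Enlarge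
  \<open>I\<close> to \<open>I'\<close> by an element \<open>r\<close> with \<open>pr \<subseteq> I\<close>. The sums of \<open>A\<^sub>n\<close> and \<open>I'\<close> become stationary by
  induction. Since \<open>I'/I\<close> is simple, the intersections of \<open>A\<^sub>n\<close> and \<open>I'\<close> take only the values \<open>I'\<close>
  and \<open>I\<close>, so they become stationary too, and by the modular law so do the \<open>A\<^sub>n\<close>.\<close>
lemma saturated_chain_stabilizes:
  fixes A :: "nat \<Rightarrow> 'a set"
  assumes p: "primeideal p R" and I: "ideal I R" "saturation R p I = I"
    and min: "\<And>q. \<lbrakk>primeideal q R; I \<subseteq> q; q \<subseteq> p\<rbrakk> \<Longrightarrow> q = p"
    and A: "\<And>n. ideal (A n) R" "\<And>n. saturation R p (A n) = A n" "\<And>n. I \<subseteq> A n"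
      "\<And>n. A (Suc n) \<subseteq> A n"
  shows "\<exists>N. \<forall>n\<ge>N. A n = A N"
  using I min A
proof (induction I arbitrary: A rule: ideal_noetherian_induct)
  case (step I A)
  note A = step.prems(3-6)
  note Amem = ideal_mem[OF A(1)]
  have dec: "A n \<subseteq> A m" if "m \<le> n" for m n
    using lift_Suc_antimono_le[of A] A(4) that by blast
  show ?case
  proof (cases "I = carrier R")
    case True
    then have "A n = carrier R" for n using Amem(1) A(3) by blast
    then show ?thesis by simp
  next
    case False
    obtain r where r: "r \<in> carrier R" "r \<notin> I" "\<And>a. a \<in> p \<Longrightarrow> a \<otimes> r \<in> I"
      using minimal_prime_is_colon[OF p step.hyps step.prems(1) False step.prems(2)] by blast
    let ?I' = "saturation R p (ideal_adjoin R I r)"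
    let ?B = "\<lambda>n. saturation R p (ideal_adjoin R (A n) r)"
    note adI = ideal_adjoin_ideal[OF step.hyps r(1)] and adA = ideal_adjoin_ideal[OF A(1) r(1)]
    have I'1: "ideal ?I' R" by (rule saturation_ideal[OF p adI])
    have I'2: "I \<subseteq> ?I'" "r \<in> ?I'"
      using saturation_contains[OF p adI] ideal_adjoin_contains[OF step.hyps r(1)] by auto
    \<comment> \<open>The induction hypothesis for \<open>I' \<supset> I\<close>, applied to the sums of \<open>A n\<close> and \<open>I'\<close>.\<close>
    have "\<exists>N. \<forall>n\<ge>N. ?B n = ?B N"
    proof (rule step.IH[OF I'1])
      show "I \<subset> ?I'" using I'2 r(2) by blast
      show "saturation R p ?I' = ?I'" by (rule saturation_idem[OF p adI])
      show "q = p" if "primeideal q R" "?I' \<subseteq> q" "q \<subseteq> p" for q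
        using step.prems(2)[OF that(1) _ that(3)] that(2) I'2(1) by blast
      fix n
      show "ideal (?B n) R" by (rule saturation_ideal[OF p adA])
      show "saturation R p (?B n) = ?B n" by (rule saturation_idem[OF p adA])
      show "?I' \<subseteq> ?B n"
        by (rule saturation_mono) (use A(3)[of n] in \<open>auto simp: ideal_adjoin_def\<close>)
      show "?B (Suc n) \<subseteq> ?B n"
        by (rule saturation_mono) (use A(4)[of n] in \<open>auto simp: ideal_adjoin_def\<close>)
    qed
    then obtain N where N: "\<And>n. n \<ge> N \<Longrightarrow> ?B n = ?B N" by blast
    show ?thesis
    proof (cases "\<forall>n. r \<in> A n")
      case True
      have "?B n = A n" for n
      proof -
        have "ideal_adjoin R (A n) r = A n"
          using ideal_adjoin_least[OF A(1) subset_refl] ideal_adjoin_contains(1)[OF A(1) r(1)] True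
          by blast
        then show ?thesis using A(2) by simp
      qed
      then have "A n = A N" if "n \<ge> N" for n using N[OF that] by metis
      then show ?thesis by blast
    next
      case False
      then obtain m where m: "r \<notin> A m" by blast
      let ?M = "max N m"
      have rM: "r \<notin> A ?M" using m dec[of m ?M] by auto
      have "A ?M \<subseteq> A n" if n: "n \<ge> ?M" for n
      proof
        fix a assume a: "a \<in> A ?M"
        then have aR: "a \<in> carrier R" using Amem(1) by blast
        have "a \<in> ?B ?M"
          using a saturation_contains[OF p adA] ideal_adjoin_contains(1)[OF A(1) r(1)] by blast
        then have "a \<in> ?B n" using N[of ?M] N[of n] n by simp
        then obtain s a' c where s: "s \<in> carrier R" "s \<notin> p" and a': "a' \<in> A n" and c: "c \<in> carrier R"
            and eq: "s \<otimes> a = a' \<oplus> c \<otimes> r"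
          by (auto simp: saturation_def ideal_adjoin_def)
        have a'R: "a' \<in> carrier R" using a' Amem(1) by blast
        have "c \<otimes> r = s \<otimes> a \<ominus> a'"
          unfolding eq using a'R c r(1) by algebra
        then have "c \<otimes> r \<in> A ?M" using Amem(4,6)[of _ ?M] a a' s dec[OF n] by auto
        then have "c \<in> p" using saturatedD[OF A(2) c _ r(1)] rM by blast
        then have "c \<otimes> r \<in> A n" using r(3) A(3) by blast
        then have "s \<otimes> a \<in> A n" using eq a' Amem(3) by simp
        then show "a \<in> A n" using saturatedD[OF A(2) s aR] by blast
      qed
      then have "A n = A ?M" if "n \<ge> ?M" for n using dec[OF that] that by blast
      then show ?thesis by blast
    qed
  qed
qed

text \<open>Nakayama's lemma for \<open>A/B\<close> over \<open>R\<^sub>p\<close>. If \<open>B\<close> were smaller than \<open>A\<close>, choose \<open>L\<close> maximal among the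
  proper saturated ideals between them. Locally \<open>A/L\<close> is simple, so that \<open>x \<in> p\<close> acts on it as zero;
  but then \<open>B\<close> and \<open>xA\<close> are both contained in \<open>L\<close>, and together they generate \<open>A\<close>.\<close>
lemma saturated_nakayama:
  assumes p: "primeideal p R" and x: "x \<in> p"
    and A: "ideal A R" "saturation R p A = A" and B: "ideal B R" "saturation R p B = B" "B \<subseteq> A"
    and gen: "\<And>a. a \<in> A \<Longrightarrow> \<exists>s\<in>carrier R - p. \<exists>b\<in>B. \<exists>c\<in>A. s \<otimes> a = b \<oplus> x \<otimes> c"
  shows "A = B"
proof (rule ccontr)
  assume "A \<noteq> B"
  define F where "F = {L. ideal L R \<and> saturation R p L = L \<and> B \<subseteq> L \<and> L \<subset> A}"
  note P = primeD[OF p]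
  note A' = ideal_mem[OF A(1)]
  have "B \<in> F" using B \<open>A \<noteq> B\<close> by (auto simp: F_def)
  moreover have "ideal L R" if "L \<in> F" for L using that by (simp add: F_def)
  ultimately obtain L where L: "L \<in> F" "\<And>K. \<lbrakk>K \<in> F; L \<subseteq> K\<rbrakk> \<Longrightarrow> K = L"
    using ideal_maximal_element[of F] by blast
  note L1 = L(1)[unfolded F_def, simplified]
  have Li: "ideal L R" and Ls: "saturation R p L = L" using L1 by auto
  note L' = ideal_mem[OF Li]
  have xR: "x \<in> carrier R" using x P(3) by blast
  have xc: "x \<otimes> c \<in> L" if c: "c \<in> A" for c
  proof (rule ccontr)
    assume n: "x \<otimes> c \<notin> L"
    have cR: "c \<in> carrier R" using c A'(1) by blast
    have xcR: "x \<otimes> c \<in> carrier R" using cR xR by simp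
    note ad = ideal_adjoin_ideal[OF Li xcR]
    let ?K = "saturation R p (ideal_adjoin R L (x \<otimes> c))"
    have "?K \<subseteq> A"
    proof -
      have "ideal_adjoin R L (x \<otimes> c) \<subseteq> A"
        using L1 A'(6) c xR by (intro ideal_adjoin_least[OF A(1)]) auto
      then show ?thesis using saturation_mono[of _ A p] A(2) by blast
    qed
    moreover have LK: "L \<subseteq> ?K" "x \<otimes> c \<in> ?K"
      using saturation_contains[OF p ad] ideal_adjoin_contains[OF Li xcR] by auto
    moreover have "?K \<notin> F" using L(2)[of ?K] LK n by blast
    ultimately have "?K = A"
      using saturation_ideal[OF p ad] saturation_idem[OF p ad] L1 unfolding F_def by blast
    then have "c \<in> ?K" using c by simp
    then obtain s l d where s: "s \<in> carrier R" "s \<notin> p" and l: "l \<in> L" and d: "d \<in> carrier R"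
        and eq: "s \<otimes> c = l \<oplus> d \<otimes> (x \<otimes> c)"
      by (auto simp: saturation_def ideal_adjoin_def)
    have lR: "l \<in> carrier R" using l L'(1) by blast
    have "(s \<ominus> d \<otimes> x) \<otimes> c = s \<otimes> c \<ominus> d \<otimes> (x \<otimes> c)" using s d xR cR by algebra
    also have "\<dots> = l" unfolding eq using lR d xR cR by algebra
    finally have 1: "(s \<ominus> d \<otimes> x) \<otimes> c \<in> L" using l by simp
    \<comment> \<open>Locally at \<open>p\<close> the element \<open>s - dx\<close> is a unit, as \<open>x \<in> p\<close> and \<open>s \<notin> p\<close>.\<close>
    have 2: "s \<ominus> d \<otimes> x \<notin> p"
    proof
      assume "s \<ominus> d \<otimes> x \<in> p"
      then have "(s \<ominus> d \<otimes> x) \<oplus> d \<otimes> x \<in> p"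
        using ideal_mem(3,6)[OF P(1)] x d by simp
      moreover have "(s \<ominus> d \<otimes> x) \<oplus> d \<otimes> x = s" using s d xR by algebra
      ultimately show False using s(2) by simp
    qed
    have "c \<in> L" using saturatedD[OF Ls _ 2 cR 1] s d xR by simp
    then show False using n L'(6) xR by simp
  qed
  have "A \<subseteq> L"
  proof
    fix a assume a: "a \<in> A"
    then obtain s b c where s: "s \<in> carrier R" "s \<notin> p" and b: "b \<in> B" "c \<in> A" "s \<otimes> a = b \<oplus> x \<otimes> c"
      using gen by blast
    have "s \<otimes> a \<in> L" using b xc L'(3) L1 by auto
    then show "a \<in> L" using saturatedD[OF Ls s] a A'(1) by blast
  qed
  then show False using L1 by blast
qed

text \<open>Suppose that \<open>q\<^sub>0\<close> is a prime with \<open>J \<subseteq> q\<^sub>0 \<subset> q\<close>, and pick \<open>y\<close> in \<open>q\<close> but not in \<open>q\<^sub>0\<close>. The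
  \<open>q\<close>-saturations \<open>Q\<^sub>n\<close> of \<open>q\<^sub>0 + (y\<^sup>n)\<close> form a descending chain of the kind formed by the symbolic powers of
  \<open>q\<close> in the usual proof. Modulo \<open>x\<close> the chain becomes stationary locally at \<open>p\<close>. As \<open>x \<notin> q\<close> is a
  nonzerodivisor modulo \<open>Q\<^sub>n\<close>, Nakayama's lemma gives \<open>Q\<^sub>N = Q\<^sub>N\<^sub>+\<^sub>1\<close> for some \<open>N\<close>. Then \<open>y\<^sup>N\<close> is a
  multiple of \<open>y\<^sup>N\<^sup>+\<^sup>1\<close> in the domain \<open>R\<^sub>q/q\<^sub>0\<close>, which makes the element \<open>y\<close> of its maximal ideal
  a unit.\<close>
theorem krull_principal_ideal:
  assumes J: "ideal J R" and x: "x \<in> carrier R" and p: "minimal_prime_over R p (ideal_adjoin R J x)"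
    and q: "primeideal q R" "J \<subseteq> q" "q \<subset> p"
  shows "minimal_prime_over R q J"
proof -
  have "q0 = q" if q0: "primeideal q0 R" "J \<subseteq> q0" "q0 \<subseteq> q" for q0
  proof (rule ccontr)
    assume "q0 \<noteq> q"
    then obtain y where y: "y \<in> q" "y \<notin> q0" using q0(3) by blast
    have pp: "primeideal p R" and pJ: "ideal_adjoin R J x \<subseteq> p"
      and min: "\<And>q. \<lbrakk>primeideal q R; ideal_adjoin R J x \<subseteq> q; q \<subseteq> p\<rbrakk> \<Longrightarrow> q = p"
      using p by (auto simp: minimal_prime_over_def)
    note Q = primeD[OF q(1)] and Q0 = primeD[OF q0(1)] and PP = primeD[OF pp]
    have xp: "x \<in> p" using pJ ideal_adjoin_contains(2)[OF J x] by blast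
    have xq: "x \<notin> q"
      using min[OF q(1)] ideal_adjoin_least[OF Q(1) q(2)] q(3) by blast
    have yR: "y \<in> carrier R" using y Q(3) by blast
    have ynR: "y [^] (n::nat) \<in> carrier R" for n using yR by simp
    let ?C = "\<lambda>n::nat. ideal_adjoin R q0 (y [^] n)"
    let ?Q = "\<lambda>n::nat. saturation R q (?C n)"
    note Ci = ideal_adjoin_ideal[OF Q0(1) ynR]
    have Qi: "ideal (?Q n) R" for n by (rule saturation_ideal[OF q(1) Ci])
    have Qq: "saturation R q (?Q n) = ?Q n" for n by (rule saturation_idem[OF q(1) Ci])
    have Qp: "saturation R p (?Q n) = ?Q n" for n
      using saturation_anti_mono[of q p "?Q n"] q(3) Qq[of n] saturation_contains[OF pp Qi[of n]] by blast
    have q0Q: "q0 \<subseteq> ?Q n" for n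
      using saturation_contains[OF q(1) Ci[of n]] ideal_adjoin_contains(1)[OF Q0(1) ynR[of n]] by blast
    have Qdec: "?Q (Suc n) \<subseteq> ?Q n" for n
    proof (rule saturation_mono, rule ideal_adjoin_least[OF Ci])
      show "q0 \<subseteq> ?C n" by (rule ideal_adjoin_contains(1)[OF Q0(1) ynR])
      show "y [^] Suc n \<in> ?C n"
        using ideal_mem(7)[OF Ci ideal_adjoin_contains(2)[OF Q0(1) ynR] yR, of n] by simp
    qed
    let ?I = "saturation R p (ideal_adjoin R q0 x)"
    let ?A = "\<lambda>n. saturation R p (ideal_adjoin R (?Q n) x)"
    note Ii = ideal_adjoin_ideal[OF Q0(1) x] and Ai = ideal_adjoin_ideal[OF Qi x]
    have "\<exists>N. \<forall>n\<ge>N. ?A n = ?A N"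
    proof (rule saturated_chain_stabilizes[OF pp, of ?I])
      show "ideal ?I R" by (rule saturation_ideal[OF pp Ii])
      show "saturation R p ?I = ?I" by (rule saturation_idem[OF pp Ii])
      have "ideal_adjoin R J x \<subseteq> ?I"
        using saturation_contains[OF pp Ii] q0(2) unfolding ideal_adjoin_def by blast
      then show "q' = p" if "primeideal q' R" "?I \<subseteq> q'" "q' \<subseteq> p" for q'
        using min that by blast
      fix n
      show "ideal (?A n) R" by (rule saturation_ideal[OF pp Ai])
      show "saturation R p (?A n) = ?A n" by (rule saturation_idem[OF pp Ai])
      show "?I \<subseteq> ?A n"
        by (rule saturation_mono) (use q0Q[of n] in \<open>unfold ideal_adjoin_def, blast\<close>)
      show "?A (Suc n) \<subseteq> ?A n"
        by (rule saturation_mono) (use Qdec[of n] in \<open>unfold ideal_adjoin_def, blast\<close>)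
    qed
    then obtain N where N: "?A (Suc N) = ?A N" by (meson le_SucI order_refl)
    have "?Q N = ?Q (Suc N)"
    proof (rule saturated_nakayama[OF pp xp Qi Qp Qi Qp Qdec])
      fix a assume a: "a \<in> ?Q N"
      have "a \<in> ?A (Suc N)"
        using a N saturation_contains[OF pp Ai] ideal_adjoin_contains(1)[OF Qi x] by blast
      then obtain s b c where s: "s \<in> carrier R" "s \<notin> p" and b: "b \<in> ?Q (Suc N)" and c: "c \<in> carrier R"
          and eq: "s \<otimes> a = b \<oplus> c \<otimes> x"
        unfolding saturation_def[of R p] ideal_adjoin_def[of R "?Q (Suc N)"] by blast
      have bR: "b \<in> carrier R" using b ideal_mem(1)[OF Qi] by blast
      have "x \<otimes> c = s \<otimes> a \<ominus> b" unfolding eq using bR c x by algebra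
      moreover have "s \<otimes> a \<ominus> b \<in> ?Q N"
        using ideal_mem(4,6)[OF Qi[of N]] a b s Qdec[of N] by blast
      ultimately have "x \<otimes> c \<in> ?Q N" by metis
      then have "c \<in> ?Q N" by (rule saturatedD[OF Qq x xq c])
      moreover have "s \<otimes> a = b \<oplus> x \<otimes> c" using eq c x by (simp add: m_comm)
      ultimately show "\<exists>s\<in>carrier R - p. \<exists>b\<in>?Q (Suc N). \<exists>c\<in>?Q N. s \<otimes> a = b \<oplus> x \<otimes> c"
        using s b by blast
    qed
    moreover have "y [^] N \<in> ?Q N"
      using saturation_contains[OF q(1) Ci] ideal_adjoin_contains(2)[OF Q0(1) ynR] by blast
    ultimately have "y [^] N \<in> ?Q (Suc N)" by blast
    then obtain s e c where s: "s \<in> carrier R" "s \<notin> q" and e: "e \<in> q0" and c: "c \<in> carrier R"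
        and eq: "s \<otimes> y [^] N = e \<oplus> c \<otimes> y [^] Suc N"
      unfolding saturation_def[of R q] ideal_adjoin_def by blast
    have eR: "e \<in> carrier R" using e Q0(3) by blast
    have "(s \<ominus> c \<otimes> y) \<otimes> y [^] N = s \<otimes> y [^] N \<ominus> c \<otimes> (y [^] N \<otimes> y)"
      using s c yR ynR[of N] by algebra
    also have "\<dots> = (e \<oplus> c \<otimes> (y [^] N \<otimes> y)) \<ominus> c \<otimes> (y [^] N \<otimes> y)" using eq by simp
    also have "\<dots> = e" using eR c yR ynR[of N] by algebra
    finally have "(s \<ominus> c \<otimes> y) \<otimes> y [^] N \<in> q0" using e by simp
    then have "s \<ominus> c \<otimes> y \<in> q0"
      using Q0(5)[of "s \<ominus> c \<otimes> y" "y [^] N"] prime_pow[OF q0(1) yR] y(2) s c yR by auto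
    then have "(s \<ominus> c \<otimes> y) \<oplus> c \<otimes> y \<in> q"
      using ideal_mem(3,6)[OF Q(1)] q0(3) y(1) c by blast
    moreover have "(s \<ominus> c \<otimes> y) \<oplus> c \<otimes> y = s" using s c yR by algebra
    ultimately show False using s by simp
  qed
  then show ?thesis using q by (auto simp: minimal_prime_over_def)
qed

text \<open>The radical of \<open>I\<close> in \<open>R\<^sub>p\<close> is \<open>p\<close>: otherwise some prime containing \<open>I\<close> avoids the
  multiplicative set of all \<open>s y\<^sup>k\<close> with \<open>s \<notin> p\<close>, and lies strictly below \<open>p\<close>.\<close>
lemma minimal_prime_local_radical:
  assumes I: "ideal I R" and p: "minimal_prime_over R p I" and y: "y \<in> p"
  obtains s k where "s \<in> carrier R" "s \<notin> p" "s \<otimes> y [^] (k::nat) \<in> I"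
proof (rule ccontr)
  note witness = that
  assume not_thesis: "\<not> thesis"
  have pp: "primeideal p R" using p by (simp add: minimal_prime_over_def)
  note P = primeD[OF pp]
  have yR: "y \<in> carrier R" using y P(3) by blast
  define T where "T = {s \<otimes> y [^] k | s k. s \<in> carrier R \<and> s \<notin> p \<and> k \<in> (UNIV :: nat set)}"
  have TI: "s \<otimes> y [^] (k::nat) \<in> T" if "s \<in> carrier R" "s \<notin> p" for s k
    using that unfolding T_def by blast
  obtain q where q: "primeideal q R" "I \<subseteq> q" "q \<inter> T = {}"
  proof (rule exists_prime_disjoint[OF I])
    show "T \<subseteq> carrier R" using yR by (auto simp: T_def)
    show "\<one> \<in> T" using TI[of \<one> 0] P(2) by simp
    show "a \<otimes> b \<in> T" if ab: "a \<in> T" "b \<in> T" for a b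
    proof -
      obtain s k where a: "a = s \<otimes> y [^] (k::nat)" "s \<in> carrier R" "s \<notin> p"
        using ab unfolding T_def by blast
      obtain t l where b: "b = t \<otimes> y [^] (l::nat)" "t \<in> carrier R" "t \<notin> p"
        using ab unfolding T_def by blast
      have "a \<otimes> b = (s \<otimes> t) \<otimes> (y [^] k \<otimes> y [^] l)" using a b yR by (simp add: m_ac)
      also have "\<dots> = (s \<otimes> t) \<otimes> y [^] (k + l)" using yR by (simp add: nat_pow_mult)
      finally show ?thesis using TI[of "s \<otimes> t" "k + l"] P(5)[of s t] a b by auto
    qed
    show "I \<inter> T = {}" using not_thesis witness unfolding T_def by blast
  qed
  have "q \<subseteq> p"
  proof
    fix z assume z: "z \<in> q"
    then have "z \<in> carrier R" using primeD(3)[OF q(1)] by blast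
    then show "z \<in> p" using TI[of z 0] z q(3) by auto
  qed
  then have "q = p" using p q by (simp add: minimal_prime_over_def)
  moreover have "y \<in> T" using TI[of \<one> 1] P(2) yR by simp
  ultimately show False using y q(3) by blast
qed

end

section \<open>Heights of primes\<close>

primrec height_at_least :: "('a, 'r) ring_scheme \<Rightarrow> nat \<Rightarrow> 'a set \<Rightarrow> bool" where
  "height_at_least R 0 p \<longleftrightarrow> primeideal p R"
| "height_at_least R (Suc n) p \<longleftrightarrow> primeideal p R \<and> (\<exists>q. q \<subset> p \<and> height_at_least R n q)"

lemma height_at_least_prime: "height_at_least R n p \<Longrightarrow> primeideal p R"
  by (cases n) simp_all

lemma height_at_least_mono:
  assumes "height_at_least R n p" "primeideal q R" "p \<subseteq> q"
  shows "height_at_least R n q"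
proof (cases n)
  case 0
  then show ?thesis using assms(2) by simp
next
  case (Suc m)
  then obtain r where "r \<subset> p" "height_at_least R m r"
    using assms(1) unfolding Suc height_at_least.simps(2) by blast
  then show ?thesis unfolding Suc height_at_least.simps(2) using assms(2,3) by blast
qed

lemma height_at_least_Suc_D: "height_at_least R (Suc n) p \<Longrightarrow> height_at_least R n p"
proof (induction n arbitrary: p)
  case 0
  then show ?case by simp
next
  case (Suc n)
  then obtain q where "primeideal p R" "q \<subset> p" "height_at_least R (Suc n) q"
    unfolding height_at_least.simps(2)[of R "Suc n"] by blast
  then show ?case using Suc.IH by (simp only: height_at_least.simps(2)[of R n]) blast
qed

lemma height_at_least_antimono:
  assumes "m \<le> n" "height_at_least R n p"
  shows "height_at_least R m p"
  using assms
proof (induction n rule: dec_induct)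
  case base
  then show ?case .
next
  case (step n)
  then show ?case using height_at_least_Suc_D[OF step.prems] by simp
qed

text \<open>The link to the prime chains that define the Krull dimension.\<close>
lemma height_at_least_iff_chain:
  "height_at_least R n p \<longleftrightarrow>
     (\<exists>P. (\<forall>i\<le>n. primeideal (P i) R) \<and> (\<forall>i<n. P i \<subset> P (Suc i)) \<and> P n = p)"
proof (induction n arbitrary: p)
  case 0 then show ?case by auto
next
  case (Suc n)
  show ?case
  proof
    assume "height_at_least R (Suc n) p"
    then obtain q where q: "primeideal p R" "q \<subset> p" "height_at_least R n q"
      unfolding height_at_least.simps(2) by blast
    obtain P where P: "\<forall>i\<le>n. primeideal (P i) R" "\<forall>i<n. P i \<subset> P (Suc i)" "P n = q"
      using q(3) unfolding Suc.IH by blast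
    let ?P = "P(Suc n := p)"
    have "\<forall>i\<le>Suc n. primeideal (?P i) R" using P(1) q(1) by (simp add: le_Suc_eq)
    moreover have "\<forall>i<Suc n. ?P i \<subset> ?P (Suc i)" using P(2,3) q(2) by (simp add: less_Suc_eq)
    ultimately show "\<exists>P. (\<forall>i\<le>Suc n. primeideal (P i) R) \<and> (\<forall>i<Suc n. P i \<subset> P (Suc i)) \<and> P (Suc n) = p"
      by (intro exI[of _ ?P]) simp
  next
    assume "\<exists>P. (\<forall>i\<le>Suc n. primeideal (P i) R) \<and> (\<forall>i<Suc n. P i \<subset> P (Suc i)) \<and> P (Suc n) = p"
    then obtain P where P: "\<forall>i\<le>Suc n. primeideal (P i) R" "\<forall>i<Suc n. P i \<subset> P (Suc i)" "P (Suc n) = p"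
      by blast
    have "height_at_least R n (P n)"
      unfolding Suc.IH using P(1,2) by (intro exI[of _ P]) simp
    moreover have "P n \<subset> p" "primeideal p R" using P by auto
    ultimately show "height_at_least R (Suc n) p" unfolding height_at_least.simps(2) by blast
  qed
qed

context noetherian_cring
begin

text \<open>Take a prime \<open>q\<close> immediately below \<open>p\<close>, in a chain that is too long, and a generator \<open>x \<in> S\<close> outside \<open>q\<close>.
  Then \<open>p\<close> is minimal over \<open>q + (x)\<close>, hence each further generator \<open>y\<close> has, locally at \<open>p\<close>, a power
  that is congruent modulo \<open>x\<close> to some \<open>b\<^sub>y \<in> q\<close>. So \<open>p\<close> is minimal over \<open>x\<close> together with the
  \<open>b\<^sub>y\<close>, and the principal ideal theorem makes \<open>q\<close> minimal over the \<open>b\<^sub>y\<close>, which are fewer by one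
  than the elements of \<open>S\<close>. The induction hypothesis bounds the height of \<open>q\<close>.\<close>
theorem krull_height:
  assumes "finite S" "S \<subseteq> carrier R" "card S \<le> n" "minimal_prime_over R p (Idl S)"
  shows "\<not> height_at_least R (Suc n) p"
  using assms
proof (induction n arbitrary: S p)
  case 0
  then have "S = {}" by simp
  then have "Idl S \<subseteq> q" if "primeideal q R" for q
    using genideal_minimal[OF primeD(1)[OF that], of S] by simp
  then show ?case
    using 0(4) by (auto simp: minimal_prime_over_def)
next
  case (Suc n)
  show ?case
  proof
    assume "height_at_least R (Suc (Suc n)) p"
    then obtain q0 where q0: "q0 \<subset> p" "height_at_least R (Suc n) q0"
      unfolding height_at_least.simps(2)[of R "Suc n"] by blast
    define F where "F = {q. primeideal q R \<and> q0 \<subseteq> q \<and> q \<subset> p}"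
    have "q0 \<in> F" using q0 height_at_least_prime by (auto simp: F_def)
    moreover have "ideal q R" if "q \<in> F" for q using that primeD(1) by (simp add: F_def)
    ultimately obtain q where q: "q \<in> F" "\<And>q'. \<lbrakk>q' \<in> F; q \<subseteq> q'\<rbrakk> \<Longrightarrow> q' = q"
      using ideal_maximal_element[of F] by blast
    have qp: "primeideal q R" "q \<subset> p" "q0 \<subseteq> q" using q(1) by (auto simp: F_def)
    have hq: "height_at_least R (Suc n) q" by (rule height_at_least_mono[OF q0(2) qp(1,3)])
    have pp: "primeideal p R" "Idl S \<subseteq> p"
      and min: "\<And>q. \<lbrakk>primeideal q R; Idl S \<subseteq> q; q \<subseteq> p\<rbrakk> \<Longrightarrow> q = p"
      using Suc.prems(4) by (auto simp: minimal_prime_over_def)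
    have Sp: "S \<subseteq> p" using genideal_self[OF Suc.prems(2)] pp(2) by blast
    have "\<not> S \<subseteq> q"
    proof
      assume "S \<subseteq> q"
      then have "q = p"
        using genideal_minimal[OF primeD(1)[OF qp(1)]] qp(2) by (intro min[OF qp(1)]) auto
      then show False using qp(2) by simp
    qed
    then obtain x where x: "x \<in> S" "x \<notin> q" by blast
    have xR: "x \<in> carrier R" using x Suc.prems(2) by blast
    note qx = ideal_adjoin_ideal[OF primeD(1)[OF qp(1)] xR]
      ideal_adjoin_contains[OF primeD(1)[OF qp(1)] xR]
    have minqx: "minimal_prime_over R p (ideal_adjoin R q x)"
      unfolding minimal_prime_over_def
    proof (intro conjI allI impI)
      show "ideal_adjoin R q x \<subseteq> p"
        using ideal_adjoin_least[OF primeD(1)[OF pp(1)]] qp(2) Sp x(1) by blast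
      fix q' assume q': "primeideal q' R" "ideal_adjoin R q x \<subseteq> q'" "q' \<subseteq> p"
      show "q' = p"
      proof (rule ccontr)
        assume "q' \<noteq> p"
        then have "q' \<in> F" "q \<subseteq> q'" using q' qp(3) qx(2) by (auto simp: F_def)
        then have "q' = q" by (rule q(2))
        then show False using q'(2) qx(3) x(2) by blast
      qed
    qed (rule pp(1))
    have "\<exists>b. b \<in> q \<and> (\<exists>s\<in>carrier R - p. \<exists>k::nat. \<exists>a\<in>carrier R. s \<otimes> y [^] k = b \<oplus> a \<otimes> x)"
      if y: "y \<in> S" for y
    proof -
      have yp: "y \<in> p" using y Sp by blast
      obtain s k where sk: "s \<in> carrier R" "s \<notin> p" "s \<otimes> y [^] (k::nat) \<in> ideal_adjoin R q x"
        by (rule minimal_prime_local_radical[OF qx(1) minqx yp])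
      then show ?thesis unfolding ideal_adjoin_def by blast
    qed
    then obtain b where b: "\<And>y. y \<in> S \<Longrightarrow> b y \<in> q"
        "\<And>y. y \<in> S \<Longrightarrow> \<exists>s\<in>carrier R - p. \<exists>k::nat. \<exists>a\<in>carrier R. s \<otimes> y [^] k = b y \<oplus> a \<otimes> x"
      by metis
    let ?B = "b ` (S - {x})"
    have Bq: "?B \<subseteq> q" using b(1) by blast
    then have BR: "?B \<subseteq> carrier R" using primeD(3)[OF qp(1)] by blast
    have Jq: "Idl ?B \<subseteq> q" by (rule genideal_minimal[OF primeD(1)[OF qp(1)] Bq])
    note Ji = genideal_ideal[OF BR]
    have "minimal_prime_over R p (ideal_adjoin R (Idl ?B) x)"
      unfolding minimal_prime_over_def
    proof (intro conjI allI impI)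
      show "ideal_adjoin R (Idl ?B) x \<subseteq> p"
        using ideal_adjoin_least[OF primeD(1)[OF pp(1)]] Jq qp(2) Sp x(1) by blast
      fix q' assume q': "primeideal q' R" "ideal_adjoin R (Idl ?B) x \<subseteq> q'" "q' \<subseteq> p"
      have xq': "x \<in> q'" using q'(2) ideal_adjoin_contains(2)[OF Ji xR] by blast
      have "y \<in> q'" if y: "y \<in> S" "y \<noteq> x" for y
      proof -
        have yR: "y \<in> carrier R" using y Suc.prems(2) by blast
        obtain s k a where s: "s \<in> carrier R" "s \<notin> p" "a \<in> carrier R" "s \<otimes> y [^] (k::nat) = b y \<oplus> a \<otimes> x"
          using b(2)[OF y(1)] by blast
        have "b y \<in> q'"
          using genideal_self[OF BR] ideal_adjoin_contains(1)[OF Ji xR] q'(2) y by blast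
        then have "s \<otimes> y [^] k \<in> q'"
          using s xq' ideal_mem(3,6)[OF primeD(1)[OF q'(1)]] by simp
        moreover have "s \<notin> q'" using s q'(3) by blast
        ultimately have "y [^] k \<in> q'" using primeD(5)[OF q'(1)] s yR by blast
        then show ?thesis by (rule prime_pow[OF q'(1) yR])
      qed
      then have "S \<subseteq> q'" using xq' by blast
      then show "q' = p" using min[OF q'(1) _ q'(3)] genideal_minimal[OF primeD(1)[OF q'(1)]] by blast
    qed (rule pp(1))
    then have "minimal_prime_over R q (Idl ?B)"
      by (rule krull_principal_ideal[OF Ji xR _ qp(1) Jq qp(2)])
    moreover have "card ?B \<le> n"
    proof -
      have "card ?B \<le> card (S - {x})" using Suc.prems(1) by (intro card_image_le) simp
      then show ?thesis using Suc.prems(1,3) x(1) by simp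
    qed
    ultimately show False using Suc.IH[of ?B q] Suc.prems(1) BR hq by blast
  qed
qed

end


section \<open>Prime avoidance and subsystems of parameters\<close>

context cring
begin

lemma element_of_others_outside_prime:
  assumes P: "primeideal P R" and I: "ideal I R" "\<not> I \<subseteq> P"
    and Q: "finite \<Q>" "\<And>Q. Q \<in> \<Q> \<Longrightarrow> ideal Q R \<and> \<not> Q \<subseteq> P"
  shows "\<exists>b\<in>I. b \<notin> P \<and> (\<forall>Q\<in>\<Q>. b \<in> Q)"
  using Q
proof (induction \<Q> rule: finite_induct)
  case empty
  then show ?case using I(2) by blast
next
  case (insert Q \<Q>)
  then obtain b where b: "b \<in> I" "b \<notin> P" "\<forall>Q\<in>\<Q>. b \<in> Q" by (metis insertCI)
  have Q: "ideal Q R" "\<not> Q \<subseteq> P" using insert.prems by auto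
  then obtain c where c: "c \<in> Q" "c \<notin> P" by blast
  have C: "b \<in> carrier R" "c \<in> carrier R"
    using b(1) c(1) ideal_mem(1)[OF I(1)] ideal_mem(1)[OF Q(1)] by auto
  have "b \<otimes> c \<notin> P" using primeD(5)[OF P C] b(2) c(2) by blast
  moreover have "b \<otimes> c \<in> I" using ideal_mem(7)[OF I(1) b(1) C(2)] .
  moreover have "b \<otimes> c \<in> Q" using ideal_mem(6)[OF Q(1) c(1) C(1)] .
  moreover have "b \<otimes> c \<in> Q'" if "Q' \<in> \<Q>" for Q'
  proof -
    have "ideal Q' R" "b \<in> Q'" using insert.prems that b(3) by auto
    then show ?thesis using ideal_mem(7) C(2) by blast
  qed
  ultimately show ?case by blast
qed

text \<open>One member of the family, \<open>J\<close>, need not be prime. After discarding members contained in others,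
  pick a prime \<open>P\<close> in the family. An element \<open>x\<close> that avoids the rest either avoids \<open>P\<close> as well, or
  becomes good after adding an element of \<open>I\<close> that lies in all other members but not in \<open>P\<close>.\<close>
theorem prime_avoidance:
  assumes "finite \<C>" and I: "ideal I R"
    and "\<And>C. C \<in> \<C> \<Longrightarrow> ideal C R \<and> (C = J \<or> primeideal C R) \<and> \<not> I \<subseteq> C"
  shows "\<exists>x\<in>I. \<forall>C\<in>\<C>. x \<notin> C"
  using assms(1,3)
proof (induction \<C> rule: finite_psubset_induct)
  case (psubset \<C>)
  have IH: "\<exists>x\<in>I. \<forall>C\<in>\<C> - {P}. x \<notin> C" if "P \<in> \<C>" for P
    using psubset.IH[of "\<C> - {P}"] psubset.prems that by blast
  consider (redundant) Q P where "Q \<in> \<C>" "P \<in> \<C>" "Q \<noteq> P" "Q \<subseteq> P"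
    | (trivial) "\<C> \<subseteq> {J}"
    | (antichain) P where "P \<in> \<C>" "P \<noteq> J" "\<And>Q. Q \<in> \<C> - {P} \<Longrightarrow> \<not> Q \<subseteq> P"
    by blast
  then show ?case
  proof cases
    case redundant
    then obtain x where "x \<in> I" "\<forall>C\<in>\<C> - {Q}. x \<notin> C" using IH by blast
    then show ?thesis using redundant by blast
  next
    case trivial
    then consider "\<C> = {}" | "\<C> = {J}" by blast
    then show ?thesis
    proof cases
      case 1 then show ?thesis using ideal_mem(2)[OF I] by blast
    next
      case 2 then show ?thesis using psubset.prems[of J] by blast
    qed
  next
    case antichain
    obtain x where x: "x \<in> I" "\<forall>C\<in>\<C> - {P}. x \<notin> C" using IH[OF antichain(1)] by blast
    have P: "primeideal P R" "\<not> I \<subseteq> P" "ideal P R"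
      using psubset.prems[OF antichain(1)] antichain(2) by auto
    show ?thesis
    proof (cases "x \<in> P")
      case False
      then show ?thesis using x by blast
    next
      case True
      have "\<exists>b\<in>I. b \<notin> P \<and> (\<forall>Q\<in>\<C> - {P}. b \<in> Q)"
        using psubset.hyps psubset.prems antichain(3)
        by (intro element_of_others_outside_prime[OF P(1) I P(2)]) auto
      then obtain b where b: "b \<in> I" "b \<notin> P" "\<forall>Q\<in>\<C> - {P}. b \<in> Q" by blast
      have C: "x \<in> carrier R" "b \<in> carrier R" using x(1) b(1) ideal_mem(1)[OF I] by auto
      have eq: "(x \<oplus> b) \<ominus> b = x" "(x \<oplus> b) \<ominus> x = b" using C by algebra+
      have "x \<oplus> b \<notin> Q" if Q: "Q \<in> \<C>" for Q
      proof
        assume *: "x \<oplus> b \<in> Q"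
        have Qi: "ideal Q R" using psubset.prems[OF Q] by blast
        show False
        proof (cases "Q = P")
          case True
          then show False using ideal_mem(4)[OF Qi * ] \<open>x \<in> P\<close> b(2) eq(2) by metis
        next
          case False
          then have "b \<in> Q" "x \<notin> Q" using Q b(3) x(2) by auto
          then show False using ideal_mem(4)[OF Qi * ] eq(1) by metis
        qed
      qed
      moreover have "x \<oplus> b \<in> I" using ideal_mem(3)[OF I] x(1) b(1) by blast
      ultimately show ?thesis by blast
    qed
  qed
qed

end

text \<open>Finiteness of the set of minimal primes, in a form that avoids speaking of minimality. By Noetherian
  induction: if \<open>ab \<in> I\<close> with \<open>a, b \<notin> I\<close>, each prime over \<open>I\<close> contains \<open>a\<close> or \<open>b\<close>.\<close>
lemma (in noetherian_cring) finite_primes_below_primes_over: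
  assumes "ideal I R"
  shows "\<exists>\<P>. finite \<P> \<and> (\<forall>P\<in>\<P>. primeideal P R \<and> I \<subseteq> P) \<and>
    (\<forall>P. primeideal P R \<longrightarrow> I \<subseteq> P \<longrightarrow> (\<exists>Q\<in>\<P>. Q \<subseteq> P))"
  using assms
proof (induction I rule: ideal_noetherian_induct)
  case (step I)
  consider "I = carrier R" | "primeideal I R"
    | a b where "a \<in> carrier R" "b \<in> carrier R" "a \<notin> I" "b \<notin> I" "a \<otimes> b \<in> I"
    using primeidealI[OF step.hyps is_cring] by metis
  then show ?case
  proof cases
    case 1
    have "\<not> carrier R \<subseteq> P" if "primeideal P R" for P
      using primeD(3,4)[OF that] by blast
    then show ?thesis unfolding 1 by (intro exI[of _ "{}"]) auto
  next
    case 2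
    then show ?thesis by (intro exI[of _ "{I}"]) simp
  next
    case (3 a b)
    have strict: "ideal (ideal_adjoin R I c) R" "I \<subset> ideal_adjoin R I c"
      if "c \<in> carrier R" "c \<notin> I" for c
      using ideal_adjoin_ideal[OF step.hyps that(1)] ideal_adjoin_contains[OF step.hyps that(1)] that(2)
      by auto
    obtain A where A: "finite A" "\<forall>P\<in>A. primeideal P R \<and> ideal_adjoin R I a \<subseteq> P"
        "\<forall>P. primeideal P R \<longrightarrow> ideal_adjoin R I a \<subseteq> P \<longrightarrow> (\<exists>Q\<in>A. Q \<subseteq> P)"
      using step.IH[OF strict[OF 3(1,3)]] by blast
    obtain B where B: "finite B" "\<forall>P\<in>B. primeideal P R \<and> ideal_adjoin R I b \<subseteq> P"
        "\<forall>P. primeideal P R \<longrightarrow> ideal_adjoin R I b \<subseteq> P \<longrightarrow> (\<exists>Q\<in>B. Q \<subseteq> P)"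
      using step.IH[OF strict[OF 3(2,4)]] by blast
    have cover: "\<exists>Q\<in>A \<union> B. Q \<subseteq> P" if P: "primeideal P R" "I \<subseteq> P" for P
    proof -
      have "a \<in> P \<or> b \<in> P" using primeD(5)[OF P(1) 3(1,2)] 3(5) P(2) by blast
      then show ?thesis
      proof
        assume "a \<in> P"
        then have "ideal_adjoin R I a \<subseteq> P" by (rule ideal_adjoin_least[OF primeD(1)[OF P(1)] P(2)])
        then show ?thesis using A(3) P(1) by blast
      next
        assume "b \<in> P"
        then have "ideal_adjoin R I b \<subseteq> P" by (rule ideal_adjoin_least[OF primeD(1)[OF P(1)] P(2)])
        then show ?thesis using B(3) P(1) by blast
      qed
    qed
    have "\<forall>P\<in>A \<union> B. primeideal P R \<and> I \<subseteq> P"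
      using A(2) B(2) strict(2)[OF 3(1,3)] strict(2)[OF 3(2,4)] by blast
    then show ?thesis using A(1) B(1) cover by (intro exI[of _ "A \<union> B"]) simp
  qed
qed

text \<open>The ideal generated by the sequence has the largest height that its number of generators allows.
  This property speaks of the sequence alone and not of its prolongations, so that it can be arranged
  one element at a time.\<close>
definition height_generic :: "('a, 'r) ring_scheme \<Rightarrow> 'a list \<Rightarrow> bool" where
  "height_generic R xs \<longleftrightarrow>
     (\<forall>P. primeideal P R \<longrightarrow> set xs \<subseteq> P \<longrightarrow> height_at_least R (length xs) P)"

context noetherian_local_ring
begin

lemma \<mm>_prime: "primeideal \<mm> R"
  by (rule maximalideal_prime[OF maximal])

lemmas \<mm>_ideal = primeD(1)[OF \<mm>_prime]
lemmas \<mm>_carrier = primeD(3)[OF \<mm>_prime]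

lemma proper_ideal_subset_maximal:
  assumes "ideal I R" "\<one> \<notin> I"
  shows "I \<subseteq> \<mm>"
proof -
  define F where "F = {K. ideal K R \<and> I \<subseteq> K \<and> \<one> \<notin> K}"
  have "I \<in> F" using assms by (simp add: F_def)
  moreover have "ideal K R" if "K \<in> F" for K using that by (simp add: F_def)
  ultimately obtain K where K: "K \<in> F" "\<And>L. \<lbrakk>L \<in> F; K \<subseteq> L\<rbrakk> \<Longrightarrow> L = K"
    using ideal_maximal_element[of F] by blast
  then have K1: "ideal K R" "I \<subseteq> K" "\<one> \<notin> K" by (auto simp: F_def)
  have "maximalideal K R"
  proof (rule maximalidealI[OF K1(1)])
    show "carrier R \<noteq> K" using K1(3) one_closed by blast
    fix L assume L: "ideal L R" "K \<subseteq> L" "L \<subseteq> carrier R"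
    show "L = K \<or> L = carrier R"
    proof (cases "\<one> \<in> L")
      case True
      then show ?thesis using ideal.one_imp_carrier[OF L(1)] by blast
    next
      case False
      then have "L \<in> F" using L(1,2) K1(2) by (auto simp: F_def)
      then show ?thesis using K(2) L(2) by blast
    qed
  qed
  then have "K = \<mm>" by (rule unique_maximal)
  then show ?thesis using K1(2) by simp
qed

lemma prime_subset_maximal: "primeideal P R \<Longrightarrow> P \<subseteq> \<mm>"
  by (rule proper_ideal_subset_maximal[OF primeD(1,2)])

lemma unit_outside_maximal:
  assumes "a \<in> carrier R" "a \<notin> \<mm>"
  obtains b where "b \<in> carrier R" "b \<otimes> a = \<one>"
proof -
  have "\<one> \<in> PIdl a"
    using proper_ideal_subset_maximal[OF cgenideal_ideal[OF assms(1)]] cgenideal_self[OF assms(1)] assms(2)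
    by blast
  then show ?thesis using that by (auto simp: cgenideal_def)
qed

lemma krull_dim_chain_iff:
  "(\<exists>P. (\<forall>i\<le>n. primeideal (P i) R) \<and> (\<forall>i<n. P i \<subset> P (Suc i))) \<longleftrightarrow> height_at_least R n \<mm>"
  (is "?chain \<longleftrightarrow> _")
proof
  assume ?chain
  then obtain P where P: "\<forall>i\<le>n. primeideal (P i) R" "\<forall>i<n. P i \<subset> P (Suc i)" by blast
  then have "height_at_least R n (P n)" unfolding height_at_least_iff_chain by blast
  moreover have "P n \<subseteq> \<mm>" using P(1) prime_subset_maximal by blast
  ultimately show "height_at_least R n \<mm>" using height_at_least_mono \<mm>_prime by blast
next
  assume "height_at_least R n \<mm>"
  then show ?chain unfolding height_at_least_iff_chain by blast
qed

text \<open>The maximal ideal has finitely many generators, and their number bounds its height.\<close>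
theorem krull_dim_finite:
  obtains d where "krull_dim R = enat d" "height_at_least R d \<mm>" "\<not> height_at_least R (Suc d) \<mm>"
proof -
  obtain A where A: "A \<subseteq> carrier R" "finite A" "\<mm> = Idl A"
    using finetely_gen[OF \<mm>_ideal] by blast
  have "minimal_prime_over R \<mm> (Idl A)"
    unfolding minimal_prime_over_def A(3)[symmetric] using \<mm>_prime by blast
  then have top: "\<not> height_at_least R (Suc (card A)) \<mm>"
    using krull_height[OF A(2,1) order_refl] by blast
  define d where "d = (LEAST n. \<not> height_at_least R (Suc n) \<mm>)"
  have d: "\<not> height_at_least R (Suc d) \<mm>" unfolding d_def by (rule LeastI[of "\<lambda>n. \<not> height_at_least R (Suc n) \<mm>", OF top])
  have d': "height_at_least R d \<mm>"
  proof (cases d)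
    case 0
    then show ?thesis using \<mm>_prime by simp
  next
    case (Suc n)
    then have "n < d" by simp
    then show ?thesis
      using not_less_Least[of n "\<lambda>n. \<not> height_at_least R (Suc n) \<mm>"]
      unfolding d_def[symmetric] Suc by blast
  qed
  have le: "n \<le> d" if "height_at_least R n \<mm>" for n
    using height_at_least_antimono[OF _ that, of "Suc d"] d by linarith
  have "krull_dim R = Sup {enat n | n. height_at_least R n \<mm>}"
    unfolding krull_dim_def krull_dim_chain_iff ..
  also have "\<dots> = enat d"
  proof (rule antisym)
    show "Sup {enat n | n. height_at_least R n \<mm>} \<le> enat d"
      using le by (intro Sup_least) auto
    show "enat d \<le> Sup {enat n | n. height_at_least R n \<mm>}"
      using d' by (intro Sup_upper) blast
  qed
  finally show ?thesis using that d d' by blast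
qed

lemma avoids_maximal:
  assumes "primeideal P R" "P \<noteq> \<mm>"
  shows "\<not> \<mm> \<subseteq> P"
  using prime_subset_maximal[OF assms(1)] assms(2) by blast

lemma height_generic_Nil: "height_generic R []"
  by (simp add: height_generic_def)

text \<open>An element outside the minimal primes \<open>Q \<noteq> \<mm>\<close> over the sequence keeps it generic: a prime \<open>P \<noteq> \<mm>\<close> over
  the longer sequence lies strictly above such a \<open>Q\<close>. The ideal \<open>\<mm>\<close> itself cannot be avoided, but its
  height is at least \<open>d\<close>, which exceeds the length of the sequence.\<close>
lemma height_generic_extend:
  assumes xs: "height_generic R xs" "set xs \<subseteq> \<mm>"
    and d: "height_at_least R d \<mm>" "length xs < d"
  obtains \<P> where "finite \<P>" "\<And>P. P \<in> \<P> \<Longrightarrow> primeideal P R \<and> \<not> \<mm> \<subseteq> P"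
    "\<And>y. (\<And>P. P \<in> \<P> \<Longrightarrow> y \<notin> P) \<Longrightarrow> height_generic R (xs @ [y])"
proof -
  have xsR: "set xs \<subseteq> carrier R" using xs(2) \<mm>_carrier by blast
  obtain \<P> where P: "finite \<P>" "\<forall>P\<in>\<P>. primeideal P R \<and> Idl (set xs) \<subseteq> P"
      "\<forall>P. primeideal P R \<longrightarrow> Idl (set xs) \<subseteq> P \<longrightarrow> (\<exists>Q\<in>\<P>. Q \<subseteq> P)"
    using finite_primes_below_primes_over[OF genideal_ideal[OF xsR]] by blast
  have "height_generic R (xs @ [y])" if y: "\<And>P. P \<in> \<P> - {\<mm>} \<Longrightarrow> y \<notin> P" for y
    unfolding height_generic_def
  proof (intro allI impI)
    fix P assume P': "primeideal P R" "set (xs @ [y]) \<subseteq> P"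
    show "height_at_least R (length (xs @ [y])) P"
    proof (cases "P = \<mm>")
      case True
      then show ?thesis
        using height_at_least_antimono[OF _ d(1), of "length (xs @ [y])"] d(2) by simp
    next
      case False
      have "Idl (set xs) \<subseteq> P" using genideal_minimal[OF primeD(1)[OF P'(1)]] P'(2) by simp
      then obtain Q where Q: "Q \<in> \<P>" "Q \<subseteq> P" using P(3) P'(1) by blast
      have "Q \<noteq> \<mm>" using Q(2) False prime_subset_maximal[OF P'(1)] by blast
      then have "Q \<subset> P" using y[of Q] Q P'(2) by auto
      moreover have "height_at_least R (length xs) Q"
        using xs(1) P(2) Q(1) genideal_self[OF xsR] unfolding height_generic_def by blast
      ultimately show ?thesis using P'(1) by auto
    qed
  qed
  then show ?thesis
    using that[of "\<P> - {\<mm>}"] P(1,2) avoids_maximal by blast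
qed

lemma exists_generic_element:
  assumes "finite \<P>" "\<And>P. P \<in> \<P> \<Longrightarrow> primeideal P R \<and> \<not> \<mm> \<subseteq> P"
  obtains y where "y \<in> \<mm>" "\<And>P. P \<in> \<P> \<Longrightarrow> y \<notin> P"
proof -
  have "ideal P R \<and> (P = {} \<or> primeideal P R) \<and> \<not> \<mm> \<subseteq> P" if "P \<in> \<P>" for P
    using assms(2)[OF that] primeD(1) by blast
  then have "\<exists>y\<in>\<mm>. \<forall>P\<in>\<P>. y \<notin> P" by (rule prime_avoidance[OF assms(1) \<mm>_ideal])
  then show ?thesis using that by blast
qed

text \<open>A prime \<open>P \<noteq> \<mm>\<close> over the sequence would have height \<open>dim R\<close>, and \<open>\<mm>\<close> a larger one. So \<open>\<mm>\<close> is the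
  only prime over the sequence.\<close>
lemma height_generic_system_of_parameters:
  assumes xs: "height_generic R xs" "set xs \<subseteq> \<mm>"
    and d: "krull_dim R = enat (length xs)" "\<not> height_at_least R (Suc (length xs)) \<mm>"
  shows "system_of_parameters R \<mm> xs"
proof -
  have xsR: "set xs \<subseteq> carrier R" using xs(2) \<mm>_carrier by blast
  have Idlm: "Idl (set xs) \<subseteq> \<mm>" by (rule genideal_minimal[OF \<mm>_ideal xs(2)])
  have only: "P = \<mm>" if P: "primeideal P R" "Idl (set xs) \<subseteq> P" for P
  proof (rule ccontr)
    assume "P \<noteq> \<mm>"
    then have "P \<subset> \<mm>" using prime_subset_maximal[OF P(1)] by blast
    moreover have "height_at_least R (length xs) P"
      using xs(1) P genideal_self[OF xsR] unfolding height_generic_def by blast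
    ultimately show False using d(2) \<mm>_prime by auto
  qed
  have "ideal_radical R (Idl (set xs)) = \<mm>"
  proof
    show "ideal_radical R (Idl (set xs)) \<subseteq> \<mm>"
      using Idlm prime_pow[OF \<mm>_prime] unfolding ideal_radical_def by blast
    show "\<mm> \<subseteq> ideal_radical R (Idl (set xs))"
    proof
      fix a assume a: "a \<in> \<mm>"
      then have aR: "a \<in> carrier R" using \<mm>_carrier by blast
      define T where "T = range (\<lambda>n::nat. a [^] n)"
      have "Idl (set xs) \<inter> T \<noteq> {}"
      proof
        assume disj: "Idl (set xs) \<inter> T = {}"
        have "\<exists>P. primeideal P R \<and> Idl (set xs) \<subseteq> P \<and> P \<inter> T = {}"
        proof (rule exists_prime_disjoint[OF genideal_ideal[OF xsR] _ _ _ disj])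
          show "T \<subseteq> carrier R" using aR by (auto simp: T_def)
          show "\<one> \<in> T" unfolding T_def by (rule range_eqI[of _ _ 0]) simp
          show "x \<otimes> y \<in> T" if xy: "x \<in> T" "y \<in> T" for x y
          proof -
            obtain i j where "x = a [^] (i::nat)" "y = a [^] (j::nat)" using xy unfolding T_def by blast
            then have "x \<otimes> y = a [^] (i + j)" using aR by (simp add: nat_pow_mult)
            then show ?thesis unfolding T_def by blast
          qed
        qed blast
        then obtain P where P: "primeideal P R" "Idl (set xs) \<subseteq> P" "P \<inter> T = {}" by blast
        have "a [^] (1::nat) \<in> T" unfolding T_def by blast
        then have "a \<in> T" using aR by simp
        then show False using P(3) a only[OF P(1,2)] by blast
      qed
      then show "a \<in> ideal_radical R (Idl (set xs))"
        using aR unfolding ideal_radical_def T_def by blast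
    qed
  qed
  then show ?thesis using xs(2) d(1) by (simp add: system_of_parameters_def)
qed

lemma height_generic_subsystem:
  assumes d: "krull_dim R = enat d" "height_at_least R d \<mm>" "\<not> height_at_least R (Suc d) \<mm>"
    and xs: "height_generic R xs" "set xs \<subseteq> \<mm>" "length xs \<le> d"
  shows "subsystem_of_parameters R \<mm> xs"
proof -
  have "\<exists>ys. system_of_parameters R \<mm> (xs @ ys)"
    using xs
  proof (induction "d - length xs" arbitrary: xs)
    case 0
    then have "length xs = d" by simp
    then have "system_of_parameters R \<mm> (xs @ [])"
      using height_generic_system_of_parameters[of xs] 0 d by simp
    then show ?case by blast
  next
    case (Suc k)
    then have len: "length xs < d" by simp
    obtain \<P> where P: "finite \<P>" "\<And>P. P \<in> \<P> \<Longrightarrow> primeideal P R \<and> \<not> \<mm> \<subseteq> P"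
        "\<And>y. (\<And>P. P \<in> \<P> \<Longrightarrow> y \<notin> P) \<Longrightarrow> height_generic R (xs @ [y])"
      using height_generic_extend[OF Suc.prems(1,2) d(2) len] by blast
    obtain y where y: "y \<in> \<mm>" "\<And>P. P \<in> \<P> \<Longrightarrow> y \<notin> P"
      using exists_generic_element[OF P(1,2)] by blast
    have "\<exists>ys. system_of_parameters R \<mm> ((xs @ [y]) @ ys)"
      using Suc.hyps(2) Suc.prems(2) len P(3)[OF y(2)] y(1) by (intro Suc.hyps(1)) auto
    then show ?case by auto
  qed
  then show ?thesis by (simp add: subsystem_of_parameters_def)
qed

end


section \<open>Noetherian modules\<close>

context module
begin

lemma submodule_iff:
  "submodule H R M \<longleftrightarrow> H \<subseteq> carrier M \<and> \<zero>\<^bsub>M\<^esub> \<in> H \<and> (\<forall>u\<in>H. \<forall>v\<in>H. u \<oplus>\<^bsub>M\<^esub> v \<in> H) \<and>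
     (\<forall>a\<in>carrier R. \<forall>v\<in>H. a \<odot>\<^bsub>M\<^esub> v \<in> H)"
proof
  assume H: "submodule H R M"
  have "\<zero>\<^bsub>M\<^esub> \<in> H" using H by (metis submodule_def subgroup.one_closed monoid.simps(2))
  then show "H \<subseteq> carrier M \<and> \<zero>\<^bsub>M\<^esub> \<in> H \<and> (\<forall>u\<in>H. \<forall>v\<in>H. u \<oplus>\<^bsub>M\<^esub> v \<in> H) \<and>
     (\<forall>a\<in>carrier R. \<forall>v\<in>H. a \<odot>\<^bsub>M\<^esub> v \<in> H)"
    using submoduleE[OF H] by blast
next
  assume H: "H \<subseteq> carrier M \<and> \<zero>\<^bsub>M\<^esub> \<in> H \<and> (\<forall>u\<in>H. \<forall>v\<in>H. u \<oplus>\<^bsub>M\<^esub> v \<in> H) \<and>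
     (\<forall>a\<in>carrier R. \<forall>v\<in>H. a \<odot>\<^bsub>M\<^esub> v \<in> H)"
  have "\<ominus>\<^bsub>M\<^esub> v \<in> H" if "v \<in> H" for v
  proof -
    have "v \<in> carrier M" using H that by blast
    then have "\<ominus>\<^bsub>M\<^esub> v = (\<ominus> \<one>) \<odot>\<^bsub>M\<^esub> v" by (simp add: smult_l_minus)
    then show ?thesis using H that by (simp only: R.a_inv_closed R.one_closed)
  qed
  then show "submodule H R M" using H by (intro submoduleI) auto
qed

lemma submodule_mem:
  assumes "submodule H R M"
  shows "H \<subseteq> carrier M" "\<zero>\<^bsub>M\<^esub> \<in> H"
    "\<And>u v. \<lbrakk>u \<in> H; v \<in> H\<rbrakk> \<Longrightarrow> u \<oplus>\<^bsub>M\<^esub> v \<in> H"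
    "\<And>u v. \<lbrakk>u \<in> H; v \<in> H\<rbrakk> \<Longrightarrow> u \<ominus>\<^bsub>M\<^esub> v \<in> H"
    "\<And>a v. \<lbrakk>a \<in> carrier R; v \<in> H\<rbrakk> \<Longrightarrow> a \<odot>\<^bsub>M\<^esub> v \<in> H"
proof -
  note H = assms[unfolded submodule_iff]
  show "H \<subseteq> carrier M" "\<zero>\<^bsub>M\<^esub> \<in> H" using H by simp_all
  show add: "u \<oplus>\<^bsub>M\<^esub> v \<in> H" if "u \<in> H" "v \<in> H" for u v using H that by simp
  show "u \<ominus>\<^bsub>M\<^esub> v \<in> H" if "u \<in> H" "v \<in> H" for u v
    using add[OF that(1) submoduleE(3)[OF assms that(2)]] by (simp add: a_minus_def)
  show "a \<odot>\<^bsub>M\<^esub> v \<in> H" if "a \<in> carrier R" "v \<in> H" for a v using H that by simp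
qed

lemma submodule_by_closure:
  assumes "H \<subseteq> carrier M" "\<zero>\<^bsub>M\<^esub> \<in> H"
    "\<And>u v. \<lbrakk>u \<in> H; v \<in> H\<rbrakk> \<Longrightarrow> u \<oplus>\<^bsub>M\<^esub> v \<in> H"
    "\<And>a v. \<lbrakk>a \<in> carrier R; v \<in> H\<rbrakk> \<Longrightarrow> a \<odot>\<^bsub>M\<^esub> v \<in> H"
  shows "submodule H R M"
  using assms unfolding submodule_iff by blast

lemma mod_span_contains: "S \<subseteq> mod_span R M S"
  by (auto simp: mod_span_def)

lemma mod_span_least: "\<lbrakk>submodule H R M; S \<subseteq> H\<rbrakk> \<Longrightarrow> mod_span R M S \<subseteq> H"
  by (auto simp: mod_span_def)

lemma mod_span_mono: "S \<subseteq> T \<Longrightarrow> mod_span R M S \<subseteq> mod_span R M T"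
  by (auto simp: mod_span_def)

lemma zero_submodule: "submodule {\<zero>\<^bsub>M\<^esub>} R M"
  by (rule submodule_by_closure) auto

lemma submodule_preimage_smult:
  assumes "submodule K R M" "a \<in> carrier R"
  shows "submodule {v \<in> carrier M. a \<odot>\<^bsub>M\<^esub> v \<in> K} R M"
proof (rule submodule_by_closure)
  note K = submodule_mem[OF assms(1)]
  show "\<zero>\<^bsub>M\<^esub> \<in> {v \<in> carrier M. a \<odot>\<^bsub>M\<^esub> v \<in> K}" using K(2) assms(2) by simp
  show "u \<oplus>\<^bsub>M\<^esub> v \<in> {v \<in> carrier M. a \<odot>\<^bsub>M\<^esub> v \<in> K}"
    if "u \<in> {v \<in> carrier M. a \<odot>\<^bsub>M\<^esub> v \<in> K}" "v \<in> {v \<in> carrier M. a \<odot>\<^bsub>M\<^esub> v \<in> K}" for u v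
    using that assms(2) K(3) by (simp add: smult_r_distr)
  show "c \<odot>\<^bsub>M\<^esub> v \<in> {v \<in> carrier M. a \<odot>\<^bsub>M\<^esub> v \<in> K}"
    if c: "c \<in> carrier R" and v: "v \<in> {v \<in> carrier M. a \<odot>\<^bsub>M\<^esub> v \<in> K}" for c v
  proof -
    have "a \<odot>\<^bsub>M\<^esub> (c \<odot>\<^bsub>M\<^esub> v) = c \<odot>\<^bsub>M\<^esub> (a \<odot>\<^bsub>M\<^esub> v)"
      using c v assms(2) by (simp flip: smult_assoc1 add: R.m_comm)
    then show ?thesis using K(5) c v by simp
  qed
qed auto

lemma submodule_image_smult:
  assumes "submodule K R M" "a \<in> carrier R"
  shows "submodule ((\<lambda>v. a \<odot>\<^bsub>M\<^esub> v) ` K) R M"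
proof (rule submodule_by_closure)
  note K = submodule_mem[OF assms(1)]
  have C: "v \<in> carrier M" if "v \<in> K" for v using K(1) that by blast
  show "(\<lambda>v. a \<odot>\<^bsub>M\<^esub> v) ` K \<subseteq> carrier M" using C assms(2) by blast
  have "\<zero>\<^bsub>M\<^esub> = a \<odot>\<^bsub>M\<^esub> \<zero>\<^bsub>M\<^esub>" using assms(2) by simp
  then show "\<zero>\<^bsub>M\<^esub> \<in> (\<lambda>v. a \<odot>\<^bsub>M\<^esub> v) ` K" using K(2) by blast
  show "x \<oplus>\<^bsub>M\<^esub> y \<in> (\<lambda>v. a \<odot>\<^bsub>M\<^esub> v) ` K"
    if xy: "x \<in> (\<lambda>v. a \<odot>\<^bsub>M\<^esub> v) ` K" "y \<in> (\<lambda>v. a \<odot>\<^bsub>M\<^esub> v) ` K" for x y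
  proof -
    obtain u v where u: "u \<in> K" "v \<in> K" "x = a \<odot>\<^bsub>M\<^esub> u" "y = a \<odot>\<^bsub>M\<^esub> v" using xy by blast
    then have "x \<oplus>\<^bsub>M\<^esub> y = a \<odot>\<^bsub>M\<^esub> (u \<oplus>\<^bsub>M\<^esub> v)" using C assms(2) by (simp add: smult_r_distr)
    then show ?thesis using K(3) u by blast
  qed
  show "c \<odot>\<^bsub>M\<^esub> x \<in> (\<lambda>v. a \<odot>\<^bsub>M\<^esub> v) ` K" if cx: "c \<in> carrier R" "x \<in> (\<lambda>v. a \<odot>\<^bsub>M\<^esub> v) ` K" for c x
  proof -
    obtain u where u: "u \<in> K" "x = a \<odot>\<^bsub>M\<^esub> u" using cx by blast
    then have "c \<odot>\<^bsub>M\<^esub> x = a \<odot>\<^bsub>M\<^esub> (c \<odot>\<^bsub>M\<^esub> u)"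
      using C cx(1) assms(2) by (simp flip: smult_assoc1 add: R.m_comm)
    then show ?thesis using K(5) u cx(1) by blast
  qed
qed

lemma colon_by_element_ideal:
  assumes "submodule K R M" "v \<in> carrier M"
  shows "ideal {a \<in> carrier R. a \<odot>\<^bsub>M\<^esub> v \<in> K} R"
proof (rule R.ideal_by_closure)
  note K = submodule_mem[OF assms(1)]
  show "\<zero> \<in> {a \<in> carrier R. a \<odot>\<^bsub>M\<^esub> v \<in> K}" using K(2) assms(2) by simp
  show "a \<oplus> b \<in> {a \<in> carrier R. a \<odot>\<^bsub>M\<^esub> v \<in> K}"
    if "a \<in> {a \<in> carrier R. a \<odot>\<^bsub>M\<^esub> v \<in> K}" "b \<in> {a \<in> carrier R. a \<odot>\<^bsub>M\<^esub> v \<in> K}" for a b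
    using that K(3) assms(2) by (simp add: smult_l_distr)
  show "c \<otimes> a \<in> {a \<in> carrier R. a \<odot>\<^bsub>M\<^esub> v \<in> K}"
    if "a \<in> {a \<in> carrier R. a \<odot>\<^bsub>M\<^esub> v \<in> K}" "c \<in> carrier R" for a c
    using that K(5) assms(2) by (simp add: smult_assoc1)
qed auto

text \<open>If \<open>M\<close> is generated by \<open>g\<close> and \<open>L\<close>, these are the coefficients at \<open>g\<close> of the elements of \<open>K\<close>.\<close>
lemma leading_coefficients_ideal:
  assumes K: "submodule K R M" and L: "submodule L R M" and g: "g \<in> carrier M"
  shows "ideal {a \<in> carrier R. \<exists>v\<in>L. a \<odot>\<^bsub>M\<^esub> g \<oplus>\<^bsub>M\<^esub> v \<in> K} R" (is "ideal ?J R")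
proof (rule R.ideal_by_closure)
  note K' = submodule_mem[OF K] and L' = submodule_mem[OF L]
  have LC: "v \<in> carrier M" if "v \<in> L" for v using L'(1) that by blast
  have "\<zero> \<odot>\<^bsub>M\<^esub> g \<oplus>\<^bsub>M\<^esub> \<zero>\<^bsub>M\<^esub> \<in> K" using K'(2) g by simp
  then show "\<zero> \<in> ?J" using L'(2) by blast
  show "a \<oplus> b \<in> ?J" if ab: "a \<in> ?J" "b \<in> ?J" for a b
  proof -
    obtain v w where v: "v \<in> L" "a \<odot>\<^bsub>M\<^esub> g \<oplus>\<^bsub>M\<^esub> v \<in> K" and w: "w \<in> L" "b \<odot>\<^bsub>M\<^esub> g \<oplus>\<^bsub>M\<^esub> w \<in> K"
      using ab by blast
    have "(a \<oplus> b) \<odot>\<^bsub>M\<^esub> g \<oplus>\<^bsub>M\<^esub> (v \<oplus>\<^bsub>M\<^esub> w) = (a \<odot>\<^bsub>M\<^esub> g \<oplus>\<^bsub>M\<^esub> v) \<oplus>\<^bsub>M\<^esub> (b \<odot>\<^bsub>M\<^esub> g \<oplus>\<^bsub>M\<^esub> w)"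
      using ab v w LC g by (simp add: smult_l_distr M.a_ac)
    then have "(a \<oplus> b) \<odot>\<^bsub>M\<^esub> g \<oplus>\<^bsub>M\<^esub> (v \<oplus>\<^bsub>M\<^esub> w) \<in> K" using K'(3)[OF v(2) w(2)] by simp
    then show ?thesis using L'(3)[OF v(1) w(1)] ab by blast
  qed
  show "c \<otimes> a \<in> ?J" if ac: "a \<in> ?J" "c \<in> carrier R" for a c
  proof -
    obtain v where v: "v \<in> L" "a \<odot>\<^bsub>M\<^esub> g \<oplus>\<^bsub>M\<^esub> v \<in> K" using ac by blast
    have "(c \<otimes> a) \<odot>\<^bsub>M\<^esub> g \<oplus>\<^bsub>M\<^esub> c \<odot>\<^bsub>M\<^esub> v = c \<odot>\<^bsub>M\<^esub> (a \<odot>\<^bsub>M\<^esub> g \<oplus>\<^bsub>M\<^esub> v)"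
      using ac v LC g by (simp add: smult_r_distr smult_assoc1)
    then have "(c \<otimes> a) \<odot>\<^bsub>M\<^esub> g \<oplus>\<^bsub>M\<^esub> c \<odot>\<^bsub>M\<^esub> v \<in> K" using K'(5)[OF ac(2) v(2)] by simp
    then show ?thesis using L'(5)[OF ac(2) v(1)] ac by blast
  qed
qed auto

end

locale fg_noetherian_module = noetherian_cring R + module R M
    for R (structure) and M (structure) +
  assumes finitely_generated: "\<exists>A. finite A \<and> A \<subseteq> carrier M \<and> mod_span R M A = carrier M"

lemma fg_noetherian_moduleI:
  fixes M :: "('a, 'b) module"
  assumes "noetherian_cring R" "fg_module R M"
  shows "fg_noetherian_module R M"
  using assms
  by (simp add: fg_module_def fg_noetherian_module_def fg_noetherian_module_axioms_def)

context fg_noetherian_module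
begin

text \<open>Induction on the number of generators: generators of \<open>H\<close> are obtained from those of its intersection
  with the span of \<open>A\<close>, together with one element of \<open>H\<close> for each generator of the ideal of
  coefficients at \<open>g\<close>.\<close>
lemma submodule_of_span_finitely_generated:
  assumes "finite A" "A \<subseteq> carrier M" "submodule H R M" "H \<subseteq> mod_span R M A"
  shows "\<exists>B. finite B \<and> B \<subseteq> carrier M \<and> mod_span R M B = H"
  using assms
proof (induction A arbitrary: H rule: finite_induct)
  case empty
  have "mod_span R M {} \<subseteq> {\<zero>\<^bsub>M\<^esub>}" by (rule mod_span_least[OF zero_submodule]) simp
  then have "mod_span R M {} = H"
    using empty(3) submodule_mem(2)[OF empty(2)] by blast
  then show ?case by blast
next
  case (insert g A)
  let ?L = "mod_span R M A"
  have g: "g \<in> carrier M" "A \<subseteq> carrier M" using insert.prems(1) by auto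
  have Ls: "submodule ?L R M" by (rule submodule_mod_span[OF g(2)])
  note L = submodule_mem[OF Ls] and H = submodule_mem[OF insert.prems(2)]
  let ?J = "{a \<in> carrier R. \<exists>v\<in>?L. a \<odot>\<^bsub>M\<^esub> g \<oplus>\<^bsub>M\<^esub> v \<in> H}"
  obtain F where F: "F \<subseteq> carrier R" "finite F" "?J = Idl F"
    using finetely_gen[OF leading_coefficients_ideal[OF insert.prems(2) Ls g(1)]] by blast
  have "\<exists>v\<in>?L. a \<odot>\<^bsub>M\<^esub> g \<oplus>\<^bsub>M\<^esub> v \<in> H" if "a \<in> F" for a
    using genideal_self[OF F(1)] F(3) that by blast
  then obtain v where v: "\<And>a. a \<in> F \<Longrightarrow> v a \<in> ?L \<and> a \<odot>\<^bsub>M\<^esub> g \<oplus>\<^bsub>M\<^esub> v a \<in> H" by metis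
  have HL: "submodule (H \<inter> ?L) R M"
    by (rule submodule_by_closure) (use H L in auto)
  obtain B where B: "finite B" "B \<subseteq> carrier M" "mod_span R M B = H \<inter> ?L"
    using insert.IH[OF g(2) HL] by blast
  let ?G = "B \<union> (\<lambda>a. a \<odot>\<^bsub>M\<^esub> g \<oplus>\<^bsub>M\<^esub> v a) ` F"
  have GH: "?G \<subseteq> H" using B(3) mod_span_contains[of B] v by blast
  then have GC: "?G \<subseteq> carrier M" using H(1) by blast
  let ?K = "mod_span R M ?G"
  have Ks: "submodule ?K R M" by (rule submodule_mod_span[OF GC])
  note K = submodule_mem[OF Ks]
  have KH: "?K \<subseteq> H" by (rule mod_span_least[OF insert.prems(2) GH])
  have BK: "H \<inter> ?L \<subseteq> ?K" unfolding B(3)[symmetric] by (rule mod_span_mono) simp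
  have "H \<subseteq> ?K"
  proof
    fix w assume w: "w \<in> H"
    then obtain a u where u: "w = a \<odot>\<^bsub>M\<^esub> g \<oplus>\<^bsub>M\<^esub> u" "a \<in> carrier R" "u \<in> ?L"
      using mod_span_insert_subset[OF insert.prems(1)] insert.prems(3) by blast
    have "F \<subseteq> {a \<in> carrier R. \<exists>v\<in>?L. a \<odot>\<^bsub>M\<^esub> g \<oplus>\<^bsub>M\<^esub> v \<in> ?K}"
      using v F(1) mod_span_contains[of ?G] by blast
    then have "Idl F \<subseteq> {a \<in> carrier R. \<exists>v\<in>?L. a \<odot>\<^bsub>M\<^esub> g \<oplus>\<^bsub>M\<^esub> v \<in> ?K}"
      by (rule genideal_minimal[OF leading_coefficients_ideal[OF Ks Ls g(1)]])
    moreover have "a \<in> Idl F" unfolding F(3)[symmetric] using u w by blast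
    ultimately obtain u' where u': "u' \<in> ?L" "a \<odot>\<^bsub>M\<^esub> g \<oplus>\<^bsub>M\<^esub> u' \<in> ?K" by blast
    have C: "u \<in> carrier M" "u' \<in> carrier M" "a \<odot>\<^bsub>M\<^esub> g \<in> carrier M" using u u' L(1) g by auto
    have "w \<ominus>\<^bsub>M\<^esub> (a \<odot>\<^bsub>M\<^esub> g \<oplus>\<^bsub>M\<^esub> u') = u \<ominus>\<^bsub>M\<^esub> u'"
      unfolding u(1) using C
      by (simp add: M.minus_add M.a_ac a_minus_def M.r_neg M.r_neg1 M.r_neg2)
    moreover have "w \<ominus>\<^bsub>M\<^esub> (a \<odot>\<^bsub>M\<^esub> g \<oplus>\<^bsub>M\<^esub> u') \<in> H" using H(4) w u'(2) KH by blast
    moreover have "u \<ominus>\<^bsub>M\<^esub> u' \<in> ?L" using L(4) u(3) u'(1) by blast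
    ultimately have "u \<ominus>\<^bsub>M\<^esub> u' \<in> ?K" using BK by auto
    then have "(a \<odot>\<^bsub>M\<^esub> g \<oplus>\<^bsub>M\<^esub> u') \<oplus>\<^bsub>M\<^esub> (u \<ominus>\<^bsub>M\<^esub> u') \<in> ?K" using K(3) u'(2) by blast
    moreover have "(a \<odot>\<^bsub>M\<^esub> g \<oplus>\<^bsub>M\<^esub> u') \<oplus>\<^bsub>M\<^esub> (u \<ominus>\<^bsub>M\<^esub> u') = w"
      unfolding u(1) a_minus_def M.a_comm[OF C(1) M.a_inv_closed[OF C(2)]] using C
      by (simp add: M.a_assoc M.r_neg2)
    ultimately show "w \<in> ?K" by simp
  qed
  then have "?K = H" using KH by blast
  moreover have "finite ?G" using B(1) F(2) by simp
  ultimately show ?case using GC by blast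
qed

lemma submodule_finitely_generated:
  assumes "submodule H R M"
  obtains B where "finite B" "B \<subseteq> carrier M" "mod_span R M B = H"
proof -
  obtain A where A: "finite A" "A \<subseteq> carrier M" "mod_span R M A = carrier M"
    using finitely_generated by blast
  have "H \<subseteq> mod_span R M A" unfolding A(3) by (rule submodule_mem(1)[OF assms])
  then show ?thesis using submodule_of_span_finitely_generated[OF A(1,2) assms] that by blast
qed

lemma submodule_maximal_element:
  assumes "F \<noteq> {}" and F: "\<And>H. H \<in> F \<Longrightarrow> submodule H R M"
  obtains K where "K \<in> F" "\<And>H. \<lbrakk>H \<in> F; K \<subseteq> H\<rbrakk> \<Longrightarrow> H = K"
proof -
  have "\<exists>K\<in>F. \<forall>H\<in>F. K \<subseteq> H \<longrightarrow> H = K"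
  proof (rule subset_Zorn_nonempty[OF assms(1)])
    fix C assume C: "C \<noteq> {}" "subset.chain F C"
    have CF: "H \<in> F" if "H \<in> C" for H using C(2) that by (auto simp: subset.chain_def)
    have Cs: "submodule H R M" if "H \<in> C" for H using F[OF CF[OF that]] .
    have lin: "H \<subseteq> K \<or> K \<subseteq> H" if "H \<in> C" "K \<in> C" for H K
      using C(2) that by (auto simp: subset_chain_def)
    have U: "submodule (\<Union>C) R M"
    proof (rule submodule_by_closure)
      show "\<Union>C \<subseteq> carrier M" using submodule_mem(1)[OF Cs] by blast
      show "\<zero>\<^bsub>M\<^esub> \<in> \<Union>C" using submodule_mem(2)[OF Cs] C(1) by blast
      show "a \<odot>\<^bsub>M\<^esub> v \<in> \<Union>C" if "a \<in> carrier R" "v \<in> \<Union>C" for a v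
        using submodule_mem(5)[OF Cs] that by blast
      show "u \<oplus>\<^bsub>M\<^esub> v \<in> \<Union>C" if uv: "u \<in> \<Union>C" "v \<in> \<Union>C" for u v
      proof -
        obtain H K where HK: "H \<in> C" "K \<in> C" "u \<in> H" "v \<in> K" using uv by blast
        then have "(u \<in> H \<and> v \<in> H) \<or> (u \<in> K \<and> v \<in> K)" using lin[OF HK(1,2)] by blast
        then show ?thesis using submodule_mem(3)[OF Cs] HK(1,2) by blast
      qed
    qed
    obtain B where B: "finite B" "B \<subseteq> carrier M" "mod_span R M B = \<Union>C"
      by (rule submodule_finitely_generated[OF U])
    have "B \<subseteq> \<Union>C" using B(3) mod_span_contains[of B] by blast
    then obtain H where H: "H \<in> C" "B \<subseteq> H"
      by (rule finite_subset_Union_chain[OF B(1) _ C])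
    have "\<Union>C \<subseteq> H" unfolding B(3)[symmetric] by (rule mod_span_least[OF Cs[OF H(1)] H(2)])
    then have "\<Union>C = H" using H(1) by blast
    then show "\<Union>C \<in> F" using CF[OF H(1)] by simp
  qed
  then show ?thesis using that by blast
qed

text \<open>Maximal elements among the ideals \<open>(K : v)\<close>, \<open>v \<notin> K\<close>, are prime, and every element that is a
  zerodivisor on \<open>M/K\<close> lies in one of them. There are only finitely many: the vectors that give rise to
  them lie in the span of a finite set \<open>S\<close> of such vectors. If \<open>v\<close> is one of them, the intersection of the \<open>(K : w)\<close>,
  \<open>w \<in> S\<close>, is contained in the prime \<open>(K : v)\<close>; so one of these ideals is, and by maximality it is equal
  to \<open>(K : v)\<close>.\<close>
lemma finite_maximal_colons:
  assumes K: "submodule K R M"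
  obtains \<P> where "finite \<P>"
    "\<And>P. P \<in> \<P> \<Longrightarrow> primeideal P R \<and> (\<exists>v\<in>carrier M - K. P = {a \<in> carrier R. a \<odot>\<^bsub>M\<^esub> v \<in> K})"
    "\<And>v. v \<in> carrier M - K \<Longrightarrow> \<exists>P\<in>\<P>. {a \<in> carrier R. a \<odot>\<^bsub>M\<^esub> v \<in> K} \<subseteq> P"
proof -
  define col where "col v = {a \<in> carrier R. a \<odot>\<^bsub>M\<^esub> v \<in> K}" for v
  note K' = submodule_mem[OF K]
  have coli: "ideal (col v) R" if "v \<in> carrier M" for v
    unfolding col_def by (rule colon_by_element_ideal[OF K that])
  define V where "V = {v \<in> carrier M - K. \<forall>w\<in>carrier M - K. col v \<subseteq> col w \<longrightarrow> col w = col v}"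
  have below: "\<exists>w\<in>V. col v \<subseteq> col w" if v: "v \<in> carrier M - K" for v
  proof -
    define F where "F = col ` {w \<in> carrier M - K. col v \<subseteq> col w}"
    have "F \<noteq> {}" using v by (auto simp: F_def)
    moreover have "ideal I R" if "I \<in> F" for I using that coli by (auto simp: F_def)
    ultimately obtain I where I: "I \<in> F" "\<And>J. \<lbrakk>J \<in> F; I \<subseteq> J\<rbrakk> \<Longrightarrow> J = I"
      using ideal_maximal_element[of F] by blast
    then obtain w where w: "w \<in> carrier M - K" "col v \<subseteq> col w" "I = col w" by (auto simp: F_def)
    have "col u = col w" if u: "u \<in> carrier M - K" "col w \<subseteq> col u" for u
    proof -
      have "col u \<in> F" using u w(2) by (auto simp: F_def)
      then show ?thesis using I(2) u(2) w(3) by blast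
    qed
    then have "w \<in> V" using w(1) by (auto simp: V_def)
    then show ?thesis using w(2) by blast
  qed
  have prime: "primeideal (col v) R" if v: "v \<in> V" for v
  proof (rule primeI_by_elements)
    have vM: "v \<in> carrier M" "v \<notin> K" using v by (auto simp: V_def)
    show "ideal (col v) R" by (rule coli[OF vM(1)])
    show "\<one> \<notin> col v" using vM by (simp add: col_def)
    fix a b assume ab: "a \<in> carrier R" "b \<in> carrier R" "a \<notin> col v" "b \<notin> col v"
    show "a \<otimes> b \<notin> col v"
    proof
      assume "a \<otimes> b \<in> col v"
      then have b: "b \<in> col (a \<odot>\<^bsub>M\<^esub> v)"
        using ab vM by (simp add: col_def m_comm[of a b] flip: smult_assoc1)
      have "a \<odot>\<^bsub>M\<^esub> v \<in> carrier M - K" using ab vM by (auto simp: col_def)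
      moreover have "col v \<subseteq> col (a \<odot>\<^bsub>M\<^esub> v)"
      proof
        fix c assume c: "c \<in> col v"
        then have "c \<odot>\<^bsub>M\<^esub> (a \<odot>\<^bsub>M\<^esub> v) = a \<odot>\<^bsub>M\<^esub> (c \<odot>\<^bsub>M\<^esub> v)"
          using ab vM by (simp add: col_def m_comm[of a c] flip: smult_assoc1)
        then show "c \<in> col (a \<odot>\<^bsub>M\<^esub> v)" using c K'(5) ab(1) by (simp add: col_def)
      qed
      ultimately have "col (a \<odot>\<^bsub>M\<^esub> v) = col v" using v by (simp add: V_def)
      then show False using b ab(4) by simp
    qed
  qed
  have VM: "V \<subseteq> carrier M" by (auto simp: V_def)
  define F where "F = {mod_span R M S | S. finite S \<and> S \<subseteq> V}"
  have "F \<noteq> {}" unfolding F_def by blast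
  moreover have "submodule H R M" if "H \<in> F" for H
    using that submodule_mod_span VM unfolding F_def by blast
  ultimately obtain H where H: "H \<in> F" "\<And>H'. \<lbrakk>H' \<in> F; H \<subseteq> H'\<rbrakk> \<Longrightarrow> H' = H"
    using submodule_maximal_element[of F] by blast
  then obtain S where S: "finite S" "S \<subseteq> V" "H = mod_span R M S" unfolding F_def by blast
  have VH: "v \<in> H" if v: "v \<in> V" for v
  proof -
    have "mod_span R M (insert v S) \<in> F" unfolding F_def using S v by blast
    moreover have "H \<subseteq> mod_span R M (insert v S)" unfolding S(3) by (rule mod_span_mono) blast
    ultimately have "mod_span R M (insert v S) = H" by (rule H(2))
    then show ?thesis using mod_span_contains[of "insert v S"] by blast
  qed
  have "col v \<in> col ` S" if v: "v \<in> V" for v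
  proof -
    have "\<exists>w\<in>S. col w \<subseteq> col v"
    proof (rule ccontr)
      assume no: "\<not> (\<exists>w\<in>S. col w \<subseteq> col v)"
      have "\<exists>b\<in>carrier R. b \<notin> col v \<and> (\<forall>Q\<in>col ` S. b \<in> Q)"
      proof (rule element_of_others_outside_prime[OF prime[OF v] oneideal])
        show "\<not> carrier R \<subseteq> col v" using primeD(3,4)[OF prime[OF v]] by blast
        show "finite (col ` S)" using S(1) by simp
        show "ideal Q R \<and> \<not> Q \<subseteq> col v" if "Q \<in> col ` S" for Q
          using that no coli S(2) VM by blast
      qed
      then obtain b where b: "b \<in> carrier R" "b \<notin> col v" "\<And>w. w \<in> S \<Longrightarrow> b \<in> col w" by blast
      have "S \<subseteq> {u \<in> carrier M. b \<odot>\<^bsub>M\<^esub> u \<in> K}" using b(3) S(2) VM by (auto simp: col_def)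
      then have "H \<subseteq> {u \<in> carrier M. b \<odot>\<^bsub>M\<^esub> u \<in> K}"
        unfolding S(3) by (rule mod_span_least[OF submodule_preimage_smult[OF K b(1)]])
      then have "b \<in> col v" using VH[OF v] b(1) by (auto simp: col_def)
      then show False using b(2) by simp
    qed
    then obtain w where w: "w \<in> S" "col w \<subseteq> col v" by blast
    then have "col v = col w" using S(2) v unfolding V_def by blast
    then show ?thesis using w(1) by blast
  qed
  then have "col ` V \<subseteq> col ` S" by blast
  then have "finite (col ` V)" using S(1) finite_subset by blast
  moreover have "primeideal P R \<and> (\<exists>v\<in>carrier M - K. P = {a \<in> carrier R. a \<odot>\<^bsub>M\<^esub> v \<in> K})"
    if P: "P \<in> col ` V" for P
  proof -
    obtain v where v: "v \<in> V" "P = col v" using P by blast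
    have "v \<in> carrier M - K" using v(1) by (auto simp: V_def)
    then show ?thesis using prime[OF v(1)] v(2) unfolding col_def by blast
  qed
  moreover have "\<exists>P\<in>col ` V. {a \<in> carrier R. a \<odot>\<^bsub>M\<^esub> v \<in> K} \<subseteq> P" if "v \<in> carrier M - K" for v
    using below[OF that] unfolding col_def by blast
  ultimately show ?thesis by (rule that)
qed

end


section \<open>Multiplication maps in prethick subcategories\<close>

lemma submodule_of_restriction:
  assumes "module R M" "submodule H R M" "submodule K R (M\<lparr>carrier := H\<rparr>)"
  shows "submodule K R M"
proof -
  interpret M: module R M by fact
  interpret H: module R "M\<lparr>carrier := H\<rparr>" by (rule submodule.submodule_is_module[OF assms(2,1)])
  note K = H.submodule_mem[OF assms(3), simplified] and H = M.submodule_mem[OF assms(2)]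
  show ?thesis
    by (rule M.submodule_by_closure) (use K H in auto)
qed

lemma fg_module_restriction:
  fixes R :: "('a, 'r) ring_scheme" and M :: "('a, 'b) module"
  assumes "noetherian_cring R" "fg_module R M" "submodule H R M"
  shows "fg_module R (M\<lparr>carrier := H\<rparr>)"
proof -
  interpret fg_noetherian_module R M by (rule fg_noetherian_moduleI[OF assms(1,2)])
  have mod: "module R (M\<lparr>carrier := H\<rparr>)"
    by (rule submodule.submodule_is_module[OF assms(3) module_axioms])
  interpret H: module R "M\<lparr>carrier := H\<rparr>" by (rule mod)
  obtain B where B: "finite B" "B \<subseteq> carrier M" "mod_span R M B = H"
    by (rule submodule_finitely_generated[OF assms(3)])
  have BH: "B \<subseteq> H" using mod_span_contains[of B] B(3) by simp
  have "submodule (mod_span R (M\<lparr>carrier := H\<rparr>) B) R (M\<lparr>carrier := H\<rparr>)"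
    using BH by (intro H.submodule_mod_span) simp
  then have "submodule (mod_span R (M\<lparr>carrier := H\<rparr>) B) R M"
    by (rule submodule_of_restriction[OF module_axioms assms(3)])
  then have "mod_span R M B \<subseteq> mod_span R (M\<lparr>carrier := H\<rparr>) B"
    using H.mod_span_contains[of B] by (rule mod_span_least)
  then have "H \<subseteq> mod_span R (M\<lparr>carrier := H\<rparr>) B" by (simp only: B(3))
  moreover have "mod_span R (M\<lparr>carrier := H\<rparr>) B \<subseteq> H"
    using H.mod_span_least[OF H.carrier_is_submodule, of B] BH by simp
  ultimately have "mod_span R (M\<lparr>carrier := H\<rparr>) B = H" by blast
  then show ?thesis unfolding fg_module_def using mod B(1) BH by auto
qed

lemma short_exact_smult:
  assumes "module R M" "submodule H R M" "y \<in> carrier R"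
  shows "short_exact R (M\<lparr>carrier := {v \<in> H. y \<odot>\<^bsub>M\<^esub> v = \<zero>\<^bsub>M\<^esub>}\<rparr>) (M\<lparr>carrier := H\<rparr>)
    (M\<lparr>carrier := (\<lambda>v. y \<odot>\<^bsub>M\<^esub> v) ` H\<rparr>) (\<lambda>v. v) (\<lambda>v. y \<odot>\<^bsub>M\<^esub> v)"
proof -
  interpret module R M by fact
  note H = submodule_mem[OF assms(2)]
  have HC: "v \<in> carrier M" if "v \<in> H" for v using H(1) that by blast
  have "y \<odot>\<^bsub>M\<^esub> (a \<odot>\<^bsub>M\<^esub> v) = a \<odot>\<^bsub>M\<^esub> (y \<odot>\<^bsub>M\<^esub> v)" if "a \<in> carrier R" "v \<in> H" for a v
    using that HC assms(3) by (simp flip: smult_assoc1 add: R.m_comm)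
  then show ?thesis
    unfolding short_exact_def mod_hom_def using HC assms(3)
    by (auto simp: smult_r_distr)
qed

locale prethick_noetherian = noetherian_cring R + prethick R \<XX>
    for R (structure) and \<XX>
begin

lemma smult_kernel_closed:
  assumes "fg_module R M" "submodule H R M" "y \<in> carrier R"
    and "M\<lparr>carrier := H\<rparr> \<in> \<XX>" "M\<lparr>carrier := (\<lambda>v. y \<odot>\<^bsub>M\<^esub> v) ` H\<rparr> \<in> \<XX>"
  shows "M\<lparr>carrier := {v \<in> H. y \<odot>\<^bsub>M\<^esub> v = \<zero>\<^bsub>M\<^esub>}\<rparr> \<in> \<XX>"
proof -
  interpret fg_noetherian_module R M by (rule fg_noetherian_moduleI[OF noetherian_cring_axioms assms(1)])
  have "{v \<in> H. y \<odot>\<^bsub>M\<^esub> v = \<zero>\<^bsub>M\<^esub>} = H \<inter> {v \<in> carrier M. y \<odot>\<^bsub>M\<^esub> v \<in> {\<zero>\<^bsub>M\<^esub>}}"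
    using submodule_mem(1)[OF assms(2)] by blast
  moreover have "submodule (H \<inter> {v \<in> carrier M. y \<odot>\<^bsub>M\<^esub> v \<in> {\<zero>\<^bsub>M\<^esub>}}) R M"
    using submodule_mem[OF assms(2)] submodule_mem[OF submodule_preimage_smult[OF zero_submodule assms(3)]]
    by (intro submodule_by_closure) auto
  ultimately have "submodule {v \<in> H. y \<odot>\<^bsub>M\<^esub> v = \<zero>\<^bsub>M\<^esub>} R M" by simp
  then have "fg_module R (M\<lparr>carrier := {v \<in> H. y \<odot>\<^bsub>M\<^esub> v = \<zero>\<^bsub>M\<^esub>}\<rparr>)"
    by (rule fg_module_restriction[OF noetherian_cring_axioms assms(1)])
  then show ?thesis
    using short_exact_smult[OF module_axioms assms(2,3)] assms(4,5) by (rule kernel_closed)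
qed

lemma smult_image_closed:
  assumes "fg_module R M" "submodule H R M" "y \<in> carrier R"
    and "M\<lparr>carrier := H\<rparr> \<in> \<XX>" "M\<lparr>carrier := {v \<in> H. y \<odot>\<^bsub>M\<^esub> v = \<zero>\<^bsub>M\<^esub>}\<rparr> \<in> \<XX>"
  shows "M\<lparr>carrier := (\<lambda>v. y \<odot>\<^bsub>M\<^esub> v) ` H\<rparr> \<in> \<XX>"
proof -
  interpret fg_noetherian_module R M by (rule fg_noetherian_moduleI[OF noetherian_cring_axioms assms(1)])
  have "fg_module R (M\<lparr>carrier := (\<lambda>v. y \<odot>\<^bsub>M\<^esub> v) ` H\<rparr>)"
    by (rule fg_module_restriction[OF noetherian_cring_axioms assms(1) submodule_image_smult[OF assms(2,3)]])
  then show ?thesis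
    using short_exact_smult[OF module_axioms assms(2,3)] assms(5,4) by (rule cokernel_closed)
qed

end

section \<open>Torsion with respect to the maximal ideal\<close>

text \<open>The zeroth local cohomology module: as \<open>\<mm>\<close> is finitely generated over a Noetherian ring, the condition
  on single elements is equivalent to \<open>v\<close> being killed by a power of \<open>\<mm>\<close>.\<close>
definition maximal_torsion :: "('a, 'r) ring_scheme \<Rightarrow> 'a set \<Rightarrow> ('a, 'b, 'm) module_scheme \<Rightarrow> 'b set" where
  "maximal_torsion R \<mm> M = {v \<in> carrier M. \<forall>y\<in>\<mm>. \<exists>n::nat. (y [^]\<^bsub>R\<^esub> n) \<odot>\<^bsub>M\<^esub> v = \<zero>\<^bsub>M\<^esub>}"

locale fg_local_module = noetherian_local_ring R \<mm> + fg_noetherian_module R M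
    for R (structure) and \<mm> and M (structure)
begin

lemma pow_smult_zero_mono:
  assumes "y \<in> carrier R" "v \<in> carrier M" "y [^] (n::nat) \<odot>\<^bsub>M\<^esub> v = \<zero>\<^bsub>M\<^esub>" "n \<le> k"
  shows "y [^] k \<odot>\<^bsub>M\<^esub> v = \<zero>\<^bsub>M\<^esub>"
proof -
  have "y [^] k = y [^] (k - n) \<otimes> y [^] n"
    using assms(1,4) by (simp add: nat_pow_mult)
  then show ?thesis using assms(1-3) by (simp add: smult_assoc1)
qed

lemma maximal_torsion_submodule: "submodule (maximal_torsion R \<mm> M) R M"
proof (rule submodule_by_closure)
  show "maximal_torsion R \<mm> M \<subseteq> carrier M" by (auto simp: maximal_torsion_def)
  have mR: "y \<in> carrier R" if "y \<in> \<mm>" for y using \<mm>_carrier that by blast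
  have "y [^] (0::nat) \<odot>\<^bsub>M\<^esub> \<zero>\<^bsub>M\<^esub> = \<zero>\<^bsub>M\<^esub>" for y by simp
  then show "\<zero>\<^bsub>M\<^esub> \<in> maximal_torsion R \<mm> M" unfolding maximal_torsion_def by blast
  show "u \<oplus>\<^bsub>M\<^esub> v \<in> maximal_torsion R \<mm> M"
    if u: "u \<in> maximal_torsion R \<mm> M" and v: "v \<in> maximal_torsion R \<mm> M" for u v
  proof -
    have C: "u \<in> carrier M" "v \<in> carrier M" using u v by (auto simp: maximal_torsion_def)
    have "\<exists>n::nat. y [^] n \<odot>\<^bsub>M\<^esub> (u \<oplus>\<^bsub>M\<^esub> v) = \<zero>\<^bsub>M\<^esub>" if y: "y \<in> \<mm>" for y
    proof -
      obtain i j :: nat where ij: "y [^] i \<odot>\<^bsub>M\<^esub> u = \<zero>\<^bsub>M\<^esub>" "y [^] j \<odot>\<^bsub>M\<^esub> v = \<zero>\<^bsub>M\<^esub>"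
        using u v y unfolding maximal_torsion_def by blast
      have "y [^] (max i j) \<odot>\<^bsub>M\<^esub> u = \<zero>\<^bsub>M\<^esub>" "y [^] (max i j) \<odot>\<^bsub>M\<^esub> v = \<zero>\<^bsub>M\<^esub>"
        using pow_smult_zero_mono[OF mR[OF y]] C ij by auto
      then have "y [^] (max i j) \<odot>\<^bsub>M\<^esub> (u \<oplus>\<^bsub>M\<^esub> v) = \<zero>\<^bsub>M\<^esub>"
        using C mR[OF y] by (simp add: smult_r_distr)
      then show ?thesis by blast
    qed
    then show ?thesis using C by (simp add: maximal_torsion_def)
  qed
  show "a \<odot>\<^bsub>M\<^esub> v \<in> maximal_torsion R \<mm> M"
    if a: "a \<in> carrier R" and v: "v \<in> maximal_torsion R \<mm> M" for a v
  proof -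
    have C: "v \<in> carrier M" using v by (auto simp: maximal_torsion_def)
    have "\<exists>n::nat. y [^] n \<odot>\<^bsub>M\<^esub> (a \<odot>\<^bsub>M\<^esub> v) = \<zero>\<^bsub>M\<^esub>" if y: "y \<in> \<mm>" for y
    proof -
      obtain i :: nat where i: "y [^] i \<odot>\<^bsub>M\<^esub> v = \<zero>\<^bsub>M\<^esub>"
        using v y unfolding maximal_torsion_def by blast
      have "y [^] i \<odot>\<^bsub>M\<^esub> (a \<odot>\<^bsub>M\<^esub> v) = a \<odot>\<^bsub>M\<^esub> (y [^] i \<odot>\<^bsub>M\<^esub> v)"
        using a C mR[OF y] by (simp flip: smult_assoc1 add: m_comm)
      then have "y [^] i \<odot>\<^bsub>M\<^esub> (a \<odot>\<^bsub>M\<^esub> v) = \<zero>\<^bsub>M\<^esub>" using i a by simp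
      then show ?thesis by blast
    qed
    then show ?thesis using C a by (simp add: maximal_torsion_def)
  qed
qed

lemma maximal_torsion_bounded:
  assumes y: "y \<in> \<mm>"
  obtains n :: nat where "\<And>v. v \<in> maximal_torsion R \<mm> M \<Longrightarrow> y [^] n \<odot>\<^bsub>M\<^esub> v = \<zero>\<^bsub>M\<^esub>"
proof -
  have yR: "y \<in> carrier R" using \<mm>_carrier y by blast
  define K where "K n = {v \<in> carrier M. y [^] (n::nat) \<odot>\<^bsub>M\<^esub> v \<in> {\<zero>\<^bsub>M\<^esub>}}" for n
  have "submodule H R M" if "H \<in> range K" for H
    using that submodule_preimage_smult[OF zero_submodule] yR unfolding K_def by blast
  then obtain H where H: "H \<in> range K" "\<And>H'. \<lbrakk>H' \<in> range K; H \<subseteq> H'\<rbrakk> \<Longrightarrow> H' = H"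
    using submodule_maximal_element[of "range K"] by blast
  then obtain n where n: "H = K n" by blast
  have "y [^] n \<odot>\<^bsub>M\<^esub> v = \<zero>\<^bsub>M\<^esub>" if v: "v \<in> maximal_torsion R \<mm> M" for v
  proof -
    obtain k :: nat where k: "v \<in> carrier M" "y [^] k \<odot>\<^bsub>M\<^esub> v = \<zero>\<^bsub>M\<^esub>"
      using v y unfolding maximal_torsion_def by blast
    have "K n \<subseteq> K (max n k)" using pow_smult_zero_mono[OF yR] by (auto simp: K_def)
    then have "K (max n k) = K n" using H(2)[of "K (max n k)"] n by blast
    moreover have "v \<in> K (max n k)" using pow_smult_zero_mono[OF yR k] k(1) by (simp add: K_def)
    ultimately have "v \<in> K n" by simp
    then show ?thesis by (simp add: K_def)
  qed
  then show ?thesis by (rule that)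
qed

text \<open>The primes are the maximal ones among the \<open>(\<Gamma> : v)\<close> with \<open>v \<notin> \<Gamma>\<close>, where \<open>\<Gamma>\<close> is the torsion
  submodule. None of them is \<open>\<mm>\<close>: if \<open>\<mm>v \<subseteq> \<Gamma>\<close>, then a power of each element of \<open>\<mm>\<close> kills \<open>v\<close>.\<close>
lemma generic_elements_regular_mod_torsion:
  obtains \<P> where "finite \<P>" "\<And>P. P \<in> \<P> \<Longrightarrow> primeideal P R \<and> \<not> \<mm> \<subseteq> P"
    "\<And>y v. \<lbrakk>y \<in> carrier R; \<And>P. P \<in> \<P> \<Longrightarrow> y \<notin> P; v \<in> carrier M; y \<odot>\<^bsub>M\<^esub> v \<in> maximal_torsion R \<mm> M\<rbrakk>
       \<Longrightarrow> v \<in> maximal_torsion R \<mm> M"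
proof -
  let ?\<Gamma> = "maximal_torsion R \<mm> M"
  obtain \<P> where P: "finite \<P>"
    "\<And>P. P \<in> \<P> \<Longrightarrow> primeideal P R \<and> (\<exists>v\<in>carrier M - ?\<Gamma>. P = {a \<in> carrier R. a \<odot>\<^bsub>M\<^esub> v \<in> ?\<Gamma>})"
    "\<And>v. v \<in> carrier M - ?\<Gamma> \<Longrightarrow> \<exists>P\<in>\<P>. {a \<in> carrier R. a \<odot>\<^bsub>M\<^esub> v \<in> ?\<Gamma>} \<subseteq> P"
    by (rule finite_maximal_colons[OF maximal_torsion_submodule]) blast
  have "\<not> \<mm> \<subseteq> P" if PP: "P \<in> \<P>" for P
  proof
    assume sub: "\<mm> \<subseteq> P"
    obtain v where v: "v \<in> carrier M - ?\<Gamma>" "P = {a \<in> carrier R. a \<odot>\<^bsub>M\<^esub> v \<in> ?\<Gamma>}"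
      using P(2)[OF PP] by blast
    have "\<exists>n::nat. y [^] n \<odot>\<^bsub>M\<^esub> v = \<zero>\<^bsub>M\<^esub>" if y: "y \<in> \<mm>" for y
    proof -
      have "y \<in> carrier R" "y \<odot>\<^bsub>M\<^esub> v \<in> ?\<Gamma>" using y sub v(2) by auto
      then obtain n :: nat where "y \<in> carrier R" "y [^] n \<odot>\<^bsub>M\<^esub> (y \<odot>\<^bsub>M\<^esub> v) = \<zero>\<^bsub>M\<^esub>"
        using y unfolding maximal_torsion_def by blast
      then have "y [^] Suc n \<odot>\<^bsub>M\<^esub> v = \<zero>\<^bsub>M\<^esub>" using v(1) by (simp add: smult_assoc1)
      then show ?thesis by blast
    qed
    then have "v \<in> ?\<Gamma>" using v(1) by (simp add: maximal_torsion_def)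
    then show False using v(1) by simp
  qed
  moreover have "v \<in> ?\<Gamma>" if "y \<in> carrier R" "\<And>P. P \<in> \<P> \<Longrightarrow> y \<notin> P" "v \<in> carrier M" "y \<odot>\<^bsub>M\<^esub> v \<in> ?\<Gamma>" for y v
    using P(3)[of v] that by blast
  ultimately show ?thesis using that[of \<P>] P(1,2) by blast
qed

text \<open>If \<open>L\<close> is a maximal proper submodule, the quotient \<open>M/L\<close> is simple, so that \<open>\<mm>M \<subseteq> L\<close>.\<close>
lemma nakayama_maximal:
  assumes "carrier M \<noteq> {\<zero>\<^bsub>M\<^esub>}" "I \<subseteq> \<mm>"
  shows "mod_span R M {a \<odot>\<^bsub>M\<^esub> v | a v. a \<in> I \<and> v \<in> carrier M} \<noteq> carrier M"
proof -
  define F where "F = {L. submodule L R M \<and> L \<noteq> carrier M}"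
  have "{\<zero>\<^bsub>M\<^esub>} \<in> F" using zero_submodule assms(1) by (auto simp: F_def)
  moreover have "submodule H R M" if "H \<in> F" for H using that by (simp add: F_def)
  ultimately obtain L where L: "L \<in> F" "\<And>K. \<lbrakk>K \<in> F; L \<subseteq> K\<rbrakk> \<Longrightarrow> K = L"
    using submodule_maximal_element[of F] by blast
  have Ls: "submodule L R M" "L \<noteq> carrier M" using L(1) by (auto simp: F_def)
  note L' = submodule_mem[OF Ls(1)]
  have "a \<odot>\<^bsub>M\<^esub> v \<in> L" if a: "a \<in> \<mm>" and v: "v \<in> carrier M" for a v
  proof (rule ccontr)
    assume n: "a \<odot>\<^bsub>M\<^esub> v \<notin> L"
    have aR: "a \<in> carrier R" using a \<mm>_carrier by blast
    let ?K = "mod_span R M (insert (a \<odot>\<^bsub>M\<^esub> v) L)"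
    have ins: "insert (a \<odot>\<^bsub>M\<^esub> v) L \<subseteq> carrier M" using L'(1) aR v by auto
    have K: "L \<subseteq> ?K" "a \<odot>\<^bsub>M\<^esub> v \<in> ?K" using mod_span_contains[of "insert (a \<odot>\<^bsub>M\<^esub> v) L"] by auto
    then have "?K \<notin> F" using L(2)[of ?K] n by blast
    then have "v \<in> ?K" using submodule_mod_span[OF ins] v by (auto simp: F_def)
    then obtain c l where c: "v = c \<odot>\<^bsub>M\<^esub> (a \<odot>\<^bsub>M\<^esub> v) \<oplus>\<^bsub>M\<^esub> l" "c \<in> carrier R" "l \<in> mod_span R M L"
      using mod_span_insert_subset[OF ins] by blast
    have l: "l \<in> L" using c(3) mod_span_least[OF Ls(1) order_refl] by blast
    have lM: "l \<in> carrier M" using l L'(1) by blast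
    have ca: "c \<otimes> a \<in> \<mm>" "c \<otimes> a \<in> carrier R" using ideal_mem(6)[OF \<mm>_ideal a c(2)] c(2) aR by auto
    have "\<one> \<ominus> c \<otimes> a \<notin> \<mm>"
    proof
      assume "\<one> \<ominus> c \<otimes> a \<in> \<mm>"
      then have "(\<one> \<ominus> c \<otimes> a) \<oplus> c \<otimes> a \<in> \<mm>" using ideal_mem(3)[OF \<mm>_ideal] ca(1) by blast
      moreover have "(\<one> \<ominus> c \<otimes> a) \<oplus> c \<otimes> a = \<one>" using c(2) aR by algebra
      ultimately show False using primeD(2)[OF \<mm>_prime] by simp
    qed
    then obtain u where u: "u \<in> carrier R" "u \<otimes> (\<one> \<ominus> c \<otimes> a) = \<one>"
      using unit_outside_maximal[of "\<one> \<ominus> c \<otimes> a"] ca(2) by auto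
    have cav: "(c \<otimes> a) \<odot>\<^bsub>M\<^esub> v \<in> carrier M" using ca(2) v by simp
    have "(\<one> \<ominus> c \<otimes> a) \<odot>\<^bsub>M\<^esub> v = v \<ominus>\<^bsub>M\<^esub> (c \<otimes> a) \<odot>\<^bsub>M\<^esub> v"
      using ca(2) v by (simp add: a_minus_def smult_l_distr smult_l_minus)
    also have "\<dots> = ((c \<otimes> a) \<odot>\<^bsub>M\<^esub> v \<oplus>\<^bsub>M\<^esub> l) \<ominus>\<^bsub>M\<^esub> (c \<otimes> a) \<odot>\<^bsub>M\<^esub> v"
      using c(1) by (simp only: smult_assoc1[OF c(2) aR v])
    also have "\<dots> = l" using cav lM by (simp add: a_minus_def M.a_ac M.r_neg1 M.r_neg2 M.r_neg)
    finally have "(\<one> \<ominus> c \<otimes> a) \<odot>\<^bsub>M\<^esub> v \<in> L" using l by simp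
    then have "u \<odot>\<^bsub>M\<^esub> ((\<one> \<ominus> c \<otimes> a) \<odot>\<^bsub>M\<^esub> v) \<in> L" using L'(5) u(1) by blast
    then have "v \<in> L" using u v ca(2) by (simp flip: smult_assoc1)
    then show False using n L'(5) aR by blast
  qed
  then have "mod_span R M {a \<odot>\<^bsub>M\<^esub> v | a v. a \<in> I \<and> v \<in> carrier M} \<subseteq> L"
    using assms(2) by (intro mod_span_least[OF Ls(1)]) blast
  then show ?thesis using Ls(2) L'(1) by blast
qed

end


section \<open>The residue field as a direct summand\<close>

locale prethick_local = noetherian_local_ring R \<mm> + prethick R \<XX>
  for R (structure) and \<mm> and \<XX>

sublocale prethick_local \<subseteq> prethick_noetherian R \<XX> ..

lemma (in abelian_group) minus_add_cancel_left:
  assumes "c \<in> carrier G" "x \<in> carrier G" "y \<in> carrier G"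
  shows "(c \<oplus> x) \<ominus> (c \<oplus> y) = x \<ominus> y"
proof -
  have "(c \<oplus> x) \<ominus> (c \<oplus> y) = (c \<oplus> \<ominus> c) \<oplus> (x \<oplus> \<ominus> y)"
    using assms by (simp add: a_minus_def minus_add a_ac)
  then show ?thesis using assms by (simp add: r_neg a_minus_def)
qed

lemma (in abelian_group) minus_eq_zero_iff:
  assumes "x \<in> carrier G" "y \<in> carrier G"
  shows "x \<ominus> y = \<zero> \<longleftrightarrow> x = y"
proof
  assume "x \<ominus> y = \<zero>"
  then have "\<ominus> (\<ominus> y) = x" using assms by (intro minus_equality) (simp_all add: a_minus_def)
  then show "x = y" using assms by simp
qed (use assms in \<open>simp add: a_minus_def r_neg\<close>)

lemma isomorphic_direct_sum_of_complements:
  assumes "module R V" "submodule H R V" "submodule K R V" "H \<inter> K = {\<zero>\<^bsub>V\<^esub>}"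
    and sum: "\<And>w. w \<in> carrier V \<Longrightarrow> \<exists>h\<in>H. \<exists>k\<in>K. w = h \<oplus>\<^bsub>V\<^esub> k"
  shows "mod_isomorphic R (direct_sum [V\<lparr>carrier := H\<rparr>, V\<lparr>carrier := K\<rparr>]) V"
proof -
  interpret module R V by fact
  note H = submodule_mem[OF assms(2)] and K = submodule_mem[OF assms(3)]
  let ?S = "direct_sum [V\<lparr>carrier := H\<rparr>, V\<lparr>carrier := K\<rparr>]"
  define f where "f xs = xs ! 0 \<oplus>\<^bsub>V\<^esub> xs ! 1" for xs
  have elem: "xs \<in> carrier ?S \<longleftrightarrow> (\<exists>h\<in>H. \<exists>k\<in>K. xs = [h, k])" for xs
  proof
    assume "xs \<in> carrier ?S"
    then have "length xs = 2" "xs ! 0 \<in> H" "xs ! 1 \<in> K"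
      by (auto simp: direct_sum_def All_less_Suc numeral_2_eq_2)
    moreover from this have "xs = [xs ! 0, xs ! 1]"
      by (intro nth_equalityI) (auto simp: less_Suc_eq numeral_2_eq_2)
    ultimately show "\<exists>h\<in>H. \<exists>k\<in>K. xs = [h, k]" by blast
  next
    assume "\<exists>h\<in>H. \<exists>k\<in>K. xs = [h, k]"
    then show "xs \<in> carrier ?S" by (auto simp: direct_sum_def less_Suc_eq)
  qed
  have add: "[h, k] \<oplus>\<^bsub>?S\<^esub> [h', k'] = [h \<oplus>\<^bsub>V\<^esub> h', k \<oplus>\<^bsub>V\<^esub> k']" for h k h' k'
    by (simp add: direct_sum_def)
  have smult: "a \<odot>\<^bsub>?S\<^esub> [h, k] = [a \<odot>\<^bsub>V\<^esub> h, a \<odot>\<^bsub>V\<^esub> k]" for a h k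
    by (simp add: direct_sum_def)
  have C: "h \<in> carrier V" if "h \<in> H \<or> h \<in> K" for h using H(1) K(1) that by blast
  have "f \<in> mod_hom R ?S V"
    unfolding mod_hom_def
  proof (intro CollectI conjI ballI funcsetI)
    show "f xs \<in> carrier V" if "xs \<in> carrier ?S" for xs using that C by (auto simp: elem f_def)
    show "f (xs \<oplus>\<^bsub>?S\<^esub> ys) = f xs \<oplus>\<^bsub>V\<^esub> f ys" if "xs \<in> carrier ?S" "ys \<in> carrier ?S" for xs ys
      using that C by (auto simp: elem add f_def M.a_ac)
    show "f (a \<odot>\<^bsub>?S\<^esub> xs) = a \<odot>\<^bsub>V\<^esub> f xs" if "a \<in> carrier R" "xs \<in> carrier ?S" for a xs
      using that C by (auto simp: elem smult f_def smult_r_distr)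
  qed
  moreover have "bij_betw f (carrier ?S) (carrier V)"
  proof (rule bij_betwI')
    fix xs ys assume "xs \<in> carrier ?S" "ys \<in> carrier ?S"
    then obtain h k h' k' where e: "h \<in> H" "k \<in> K" "xs = [h, k]" "h' \<in> H" "k' \<in> K" "ys = [h', k']"
      unfolding elem by blast
    show "f xs = f ys \<longleftrightarrow> xs = ys"
    proof
      assume "f xs = f ys"
      then have eq: "h \<oplus>\<^bsub>V\<^esub> k = h' \<oplus>\<^bsub>V\<^esub> k'" using e by (simp add: f_def)
      have cc: "h \<in> carrier V" "k \<in> carrier V" "h' \<in> carrier V" "k' \<in> carrier V" using e C by auto
      have "h \<ominus>\<^bsub>V\<^esub> h' = (k \<oplus>\<^bsub>V\<^esub> h) \<ominus>\<^bsub>V\<^esub> (k \<oplus>\<^bsub>V\<^esub> h')"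
        using M.minus_add_cancel_left[of k h h'] cc by simp
      also have "\<dots> = (h' \<oplus>\<^bsub>V\<^esub> k') \<ominus>\<^bsub>V\<^esub> (h' \<oplus>\<^bsub>V\<^esub> k)"
        using cc eq by (simp add: M.a_comm)
      also have "\<dots> = k' \<ominus>\<^bsub>V\<^esub> k" using M.minus_add_cancel_left[of h' k' k] cc by simp
      finally have d: "h \<ominus>\<^bsub>V\<^esub> h' = k' \<ominus>\<^bsub>V\<^esub> k" .
      then have "h \<ominus>\<^bsub>V\<^esub> h' \<in> H \<inter> K" using H(4) K(4) e by (metis IntI)
      then have "h \<ominus>\<^bsub>V\<^esub> h' = \<zero>\<^bsub>V\<^esub>" "k' \<ominus>\<^bsub>V\<^esub> k = \<zero>\<^bsub>V\<^esub>" using assms(4) d by auto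
      then have "h = h'" "k' = k" using cc by (simp_all add: M.minus_eq_zero_iff)
      then show "xs = ys" using e by simp
    qed simp
  next
    show "f xs \<in> carrier V" if "xs \<in> carrier ?S" for xs using that C by (auto simp: elem f_def)
    fix w assume "w \<in> carrier V"
    then obtain h k where "h \<in> H" "k \<in> K" "w = h \<oplus>\<^bsub>V\<^esub> k" using sum by blast
    then have "[h, k] \<in> carrier ?S" "w = f [h, k]" by (auto simp: elem f_def)
    then show "\<exists>xs\<in>carrier ?S. w = f xs" by blast
  qed
  ultimately show ?thesis unfolding mod_isomorphic_def by blast
qed

lemma residue_module_isomorphic_line:
  fixes R :: "('a, 'r) ring_scheme" (structure) and V :: "('a, 'b) module"
  assumes "noetherian_local_ring R \<mm>" "module R V"
    and v: "v \<in> carrier V" "v \<noteq> \<zero>\<^bsub>V\<^esub>" and kill: "\<And>a. a \<in> \<mm> \<Longrightarrow> a \<odot>\<^bsub>V\<^esub> v = \<zero>\<^bsub>V\<^esub>"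
  shows "mod_isomorphic R (residue_module R \<mm>) (V\<lparr>carrier := (\<lambda>a. a \<odot>\<^bsub>V\<^esub> v) ` carrier R\<rparr>)"
proof -
  interpret noetherian_local_ring R \<mm> by fact
  interpret V: module R V by fact
  interpret I: ideal \<mm> R by (rule \<mm>_ideal)
  have eq_iff: "a \<odot>\<^bsub>V\<^esub> v = b \<odot>\<^bsub>V\<^esub> v \<longleftrightarrow> a \<ominus> b \<in> \<mm>" if ab: "a \<in> carrier R" "b \<in> carrier R" for a b
  proof -
    have d: "(a \<ominus> b) \<odot>\<^bsub>V\<^esub> v = a \<odot>\<^bsub>V\<^esub> v \<ominus>\<^bsub>V\<^esub> b \<odot>\<^bsub>V\<^esub> v"
      using ab v(1) by (simp add: a_minus_def V.smult_l_distr V.smult_l_minus)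
    have "a \<odot>\<^bsub>V\<^esub> v = b \<odot>\<^bsub>V\<^esub> v \<longleftrightarrow> (a \<ominus> b) \<odot>\<^bsub>V\<^esub> v = \<zero>\<^bsub>V\<^esub>"
      unfolding d using ab v(1) by (simp add: V.M.minus_eq_zero_iff)
    also have "\<dots> \<longleftrightarrow> a \<ominus> b \<in> \<mm>"
    proof
      assume z: "(a \<ominus> b) \<odot>\<^bsub>V\<^esub> v = \<zero>\<^bsub>V\<^esub>"
      show "a \<ominus> b \<in> \<mm>"
      proof (rule ccontr)
        assume "a \<ominus> b \<notin> \<mm>"
        then obtain c where c: "c \<in> carrier R" "c \<otimes> (a \<ominus> b) = \<one>"
          using unit_outside_maximal[of "a \<ominus> b"] ab by auto
        then have "v = c \<odot>\<^bsub>V\<^esub> ((a \<ominus> b) \<odot>\<^bsub>V\<^esub> v)" using ab v(1) by (simp flip: V.smult_assoc1)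
        then show False using z c(1) v(2) by simp
      qed
    qed (rule kill)
    finally show ?thesis .
  qed
  have coset: "b \<odot>\<^bsub>V\<^esub> v = a \<odot>\<^bsub>V\<^esub> v" if "a \<in> carrier R" "b \<in> \<mm> +> a" for a b
  proof -
    have "b \<in> carrier R" using I.a_elemrcos_carrier[OF that] .
    then show ?thesis
      using eq_iff that I.a_rcos_module_minus[OF ring_axioms that(1), of b] by blast
  qed
  define h where "h C = (SOME b. b \<in> C) \<odot>\<^bsub>V\<^esub> v" for C
  have h: "h (\<mm> +> a) = a \<odot>\<^bsub>V\<^esub> v" if a: "a \<in> carrier R" for a
  proof -
    have "(SOME b. b \<in> \<mm> +> a) \<in> \<mm> +> a" using I.a_rcos_self[OF a] by (rule someI)
    then show ?thesis unfolding h_def by (rule coset[OF a])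
  qed
  let ?k = "residue_module R \<mm>" and ?L = "V\<lparr>carrier := (\<lambda>a. a \<odot>\<^bsub>V\<^esub> v) ` carrier R\<rparr>"
  have carr: "C \<in> carrier ?k \<longleftrightarrow> (\<exists>a\<in>carrier R. C = \<mm> +> a)" for C
    by (auto simp: residue_module_def FactRing_simps)
  have add: "(\<mm> +> a) \<oplus>\<^bsub>?k\<^esub> (\<mm> +> b) = \<mm> +> (a \<oplus> b)" if "a \<in> carrier R" "b \<in> carrier R" for a b
    using I.a_rcos_sum[OF that] by (simp add: residue_module_def FactRing_def)
  have smult: "a \<odot>\<^bsub>?k\<^esub> (\<mm> +> b) = \<mm> +> (a \<otimes> b)" if "a \<in> carrier R" "b \<in> carrier R" for a b
    using I.rcoset_mult_add[OF that] by (simp add: residue_module_def FactRing_def)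
  have "h \<in> mod_hom R ?k ?L"
    unfolding mod_hom_def
  proof (intro CollectI conjI ballI funcsetI)
    show "h C \<in> carrier ?L" if "C \<in> carrier ?k" for C using that h by (auto simp: carr)
    show "h (C \<oplus>\<^bsub>?k\<^esub> D) = h C \<oplus>\<^bsub>?L\<^esub> h D" if CD: "C \<in> carrier ?k" "D \<in> carrier ?k" for C D
    proof -
      obtain a b where "a \<in> carrier R" "C = \<mm> +> a" "b \<in> carrier R" "D = \<mm> +> b"
        using CD unfolding carr by blast
      then show ?thesis using h add v(1) by (simp add: V.smult_l_distr)
    qed
    show "h (a \<odot>\<^bsub>?k\<^esub> C) = a \<odot>\<^bsub>?L\<^esub> h C" if aC: "a \<in> carrier R" "C \<in> carrier ?k" for a C
    proof -
      obtain b where "b \<in> carrier R" "C = \<mm> +> b" using aC(2) unfolding carr by blast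
      then show ?thesis using h smult aC(1) v(1) by (simp add: V.smult_assoc1)
    qed
  qed
  moreover have "bij_betw h (carrier ?k) (carrier ?L)"
  proof (rule bij_betwI')
    fix C D assume "C \<in> carrier ?k" "D \<in> carrier ?k"
    then obtain a b where ab: "a \<in> carrier R" "C = \<mm> +> a" "b \<in> carrier R" "D = \<mm> +> b"
      unfolding carr by blast
    show "h C = h D \<longleftrightarrow> C = D"
    proof
      assume "h C = h D"
      then have "a \<odot>\<^bsub>V\<^esub> v = b \<odot>\<^bsub>V\<^esub> v" using ab h by simp
      then have "a \<in> \<mm> +> b"
        using eq_iff ab I.a_rcos_module_minus[OF ring_axioms ab(3,1)] by blast
      then show "C = D" using ab I.a_repr_independence'[of a b] by simp
    qed simp
  next
    show "h C \<in> carrier ?L" if "C \<in> carrier ?k" for C using that h by (auto simp: carr)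
    fix w assume "w \<in> carrier ?L"
    then obtain a where a: "a \<in> carrier R" "w = a \<odot>\<^bsub>V\<^esub> v" by auto
    then have "\<mm> +> a \<in> carrier ?k" "w = h (\<mm> +> a)" using h by (auto simp: carr)
    then show "\<exists>C\<in>carrier ?k. w = h C" by blast
  qed
  ultimately show ?thesis unfolding mod_isomorphic_def by blast
qed

context prethick_local
begin

text \<open>Let \<open>\<Gamma>\<close> be the torsion submodule of \<open>N\<close>. The subspace sought is \<open>z\<Gamma>\<close> for a product \<open>z\<close> of generic
  elements, possibly the empty product \<open>\<one>\<close>, such that \<open>z\<Gamma> \<noteq> 0\<close> and the kernel of \<open>z\<close> on \<open>\<Gamma>\<close> is as
  large as possible. A generic element \<open>y\<close> with \<open>yz\<Gamma> \<noteq> 0\<close> would have to act injectively on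
  \<open>z\<Gamma>\<close>, although some power of \<open>y\<close> kills \<open>\<Gamma>\<close>.\<close>
lemma torsion_contains_vector_space:
  assumes N: "N \<in> \<XX>" "maximal_torsion R \<mm> N \<noteq> {\<zero>\<^bsub>N\<^esub>}"
    and P: "finite \<P>" "\<And>P. P \<in> \<P> \<Longrightarrow> primeideal P R \<and> \<not> \<mm> \<subseteq> P"
    and gen: "\<And>y. \<lbrakk>y \<in> \<mm>; \<And>P. P \<in> \<P> \<Longrightarrow> y \<notin> P\<rbrakk> \<Longrightarrow> N\<lparr>carrier := (\<lambda>v. y \<odot>\<^bsub>N\<^esub> v) ` carrier N\<rparr> \<in> \<XX>"
  obtains V where "submodule V R N" "V \<noteq> {\<zero>\<^bsub>N\<^esub>}" "N\<lparr>carrier := V\<rparr> \<in> \<XX>"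
    "\<And>a v. \<lbrakk>a \<in> \<mm>; v \<in> V\<rbrakk> \<Longrightarrow> a \<odot>\<^bsub>N\<^esub> v = \<zero>\<^bsub>N\<^esub>"
proof -
  have fgN: "fg_module R N" by (rule objects[OF N(1)])
  interpret N: fg_noetherian_module R N by (rule fg_noetherian_moduleI[OF noetherian_cring_axioms fgN])
  interpret N: fg_local_module R \<mm> N ..
  let ?\<Gamma> = "maximal_torsion R \<mm> N"
  note Gs = N.maximal_torsion_submodule
  note G = N.submodule_mem[OF Gs]
  obtain \<Q> where Q: "finite \<Q>" "\<And>P. P \<in> \<Q> \<Longrightarrow> primeideal P R \<and> \<not> \<mm> \<subseteq> P"
    "\<And>y v. \<lbrakk>y \<in> carrier R; \<And>P. P \<in> \<Q> \<Longrightarrow> y \<notin> P; v \<in> carrier N; y \<odot>\<^bsub>N\<^esub> v \<in> ?\<Gamma>\<rbrakk> \<Longrightarrow> v \<in> ?\<Gamma>"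
    by (rule N.generic_elements_regular_mod_torsion) blast
  define gens where "gens = {y \<in> \<mm>. \<forall>P\<in>\<P> \<union> \<Q>. y \<notin> P}"
  have genR: "y \<in> carrier R" if "y \<in> gens" for y using that \<mm>_carrier by (auto simp: gens_def)
  have gen_mult: "y \<otimes> z \<in> gens" if y: "y \<in> gens" and z: "z \<in> gens" for y z
  proof -
    have "y \<otimes> z \<in> \<mm>" using ideal_mem(7)[OF \<mm>_ideal] y genR[OF z] by (simp add: gens_def)
    moreover have "y \<otimes> z \<notin> P" if "P \<in> \<P> \<union> \<Q>" for P
      using primeD(5)[of P y z] P(2) Q(2) that y z genR unfolding gens_def by blast
    ultimately show ?thesis by (simp add: gens_def)
  qed
  have gen_reg: "v \<in> ?\<Gamma>" if "y \<in> gens" "v \<in> carrier N" "y \<odot>\<^bsub>N\<^esub> v \<in> ?\<Gamma>" for y v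
    using Q(3)[of y v] that genR unfolding gens_def by blast
  have gen_X: "N\<lparr>carrier := {v \<in> carrier N. y \<odot>\<^bsub>N\<^esub> v = \<zero>\<^bsub>N\<^esub>}\<rparr> \<in> \<XX>" if y: "y \<in> gens" for y
  proof (rule smult_kernel_closed[OF fgN N.carrier_is_submodule genR[OF y]])
    show "N\<lparr>carrier := carrier N\<rparr> \<in> \<XX>" using N(1) by simp
    show "N\<lparr>carrier := (\<lambda>v. y \<odot>\<^bsub>N\<^esub> v) ` carrier N\<rparr> \<in> \<XX>" using gen y by (simp add: gens_def)
  qed
  \<comment> \<open>A generic element has its kernel on \<open>N\<close> inside \<open>\<Gamma>\<close>, so that this kernel is also its kernel on \<open>\<Gamma>\<close>.\<close>
  have ker_in_torsion: "v \<in> ?\<Gamma>" if "y \<in> gens" "v \<in> carrier N" "y \<odot>\<^bsub>N\<^esub> v = \<zero>\<^bsub>N\<^esub>" for y v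
    using gen_reg[OF that(1,2)] that(3) G(2) by simp
  obtain y where y: "y \<in> gens"
  proof -
    obtain y where "y \<in> \<mm>" "\<And>P. P \<in> \<P> \<union> \<Q> \<Longrightarrow> y \<notin> P"
      using exists_generic_element[of "\<P> \<union> \<Q>"] P Q(1,2) by blast
    then have "y \<in> gens" unfolding gens_def by blast
    then show ?thesis by (rule that)
  qed
  have pow_gen: "y [^] Suc n \<in> gens" if y: "y \<in> gens" for y n
    using y genR[OF y] gen_mult by (induction n) auto
  have torsion_X: "N\<lparr>carrier := ?\<Gamma>\<rparr> \<in> \<XX>"
  proof -
    obtain n :: nat where n: "\<And>v. v \<in> ?\<Gamma> \<Longrightarrow> y [^] n \<odot>\<^bsub>N\<^esub> v = \<zero>\<^bsub>N\<^esub>"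
      using N.maximal_torsion_bounded[of y] y by (auto simp: gens_def)
    have "{v \<in> carrier N. y [^] Suc n \<odot>\<^bsub>N\<^esub> v = \<zero>\<^bsub>N\<^esub>} = ?\<Gamma>"
    proof
      show "{v \<in> carrier N. y [^] Suc n \<odot>\<^bsub>N\<^esub> v = \<zero>\<^bsub>N\<^esub>} \<subseteq> ?\<Gamma>"
        using ker_in_torsion[OF pow_gen[OF y]] by blast
      show "?\<Gamma> \<subseteq> {v \<in> carrier N. y [^] Suc n \<odot>\<^bsub>N\<^esub> v = \<zero>\<^bsub>N\<^esub>}"
        using N.pow_smult_zero_mono[OF genR[OF y] _ n, of _ "Suc n"] G(1) by auto
    qed
    then show ?thesis using gen_X[OF pow_gen[OF y, of n]] by simp
  qed
  have image_X: "N\<lparr>carrier := (\<lambda>v. z \<odot>\<^bsub>N\<^esub> v) ` ?\<Gamma>\<rparr> \<in> \<XX>" if z: "z \<in> insert \<one> gens" for z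
  proof (cases "z = \<one>")
    case True
    have "(\<lambda>v. \<one> \<odot>\<^bsub>N\<^esub> v) ` ?\<Gamma> = ?\<Gamma>" using G(1) by force
    then show ?thesis using torsion_X True by simp
  next
    case False
    then have z: "z \<in> gens" using z by simp
    have "{v \<in> ?\<Gamma>. z \<odot>\<^bsub>N\<^esub> v = \<zero>\<^bsub>N\<^esub>} = {v \<in> carrier N. z \<odot>\<^bsub>N\<^esub> v = \<zero>\<^bsub>N\<^esub>}"
      using ker_in_torsion[OF z] G(1) by blast
    then show ?thesis
      using smult_image_closed[OF fgN Gs genR[OF z] torsion_X] gen_X[OF z] by simp
  qed
  define ker where "ker z = {v \<in> ?\<Gamma>. z \<odot>\<^bsub>N\<^esub> v = \<zero>\<^bsub>N\<^esub>}" for z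
  define F where "F = {ker z | z. z \<in> insert \<one> gens \<and> ker z \<noteq> ?\<Gamma>}"
  have oneF: "ker \<one> \<in> F"
  proof -
    have "ker \<one> \<subseteq> {\<zero>\<^bsub>N\<^esub>}" using G(1) by (auto simp: ker_def)
    then have "ker \<one> \<noteq> ?\<Gamma>" using N(2) G(2) by blast
    then show ?thesis unfolding F_def by blast
  qed
  have "submodule H R N" if HF: "H \<in> F" for H
  proof -
    obtain z where z: "z \<in> insert \<one> gens" "H = ker z" using HF unfolding F_def by blast
    have zR: "z \<in> carrier R" using z(1) genR by auto
    have "submodule (?\<Gamma> \<inter> {v \<in> carrier N. z \<odot>\<^bsub>N\<^esub> v \<in> {\<zero>\<^bsub>N\<^esub>}}) R N"
      using G N.submodule_mem[OF N.submodule_preimage_smult[OF N.zero_submodule zR]]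
      by (intro N.submodule_by_closure) auto
    moreover have "?\<Gamma> \<inter> {v \<in> carrier N. z \<odot>\<^bsub>N\<^esub> v \<in> {\<zero>\<^bsub>N\<^esub>}} = H"
      using G(1) by (auto simp: z(2) ker_def)
    ultimately show ?thesis by simp
  qed
  then obtain H where H: "H \<in> F" "\<And>H'. \<lbrakk>H' \<in> F; H \<subseteq> H'\<rbrakk> \<Longrightarrow> H' = H"
    using N.submodule_maximal_element[of F] oneF by blast
  then obtain z where z: "z \<in> insert \<one> gens" "ker z \<noteq> ?\<Gamma>" "H = ker z" unfolding F_def by blast
  have zR: "z \<in> carrier R" using z(1) genR by auto
  let ?V = "(\<lambda>v. z \<odot>\<^bsub>N\<^esub> v) ` ?\<Gamma>"
  have Vs: "submodule ?V R N" by (rule N.submodule_image_smult[OF Gs zR])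
  note V = N.submodule_mem[OF Vs]
  have V0: "?V \<noteq> {\<zero>\<^bsub>N\<^esub>}"
  proof
    assume "?V = {\<zero>\<^bsub>N\<^esub>}"
    then have "ker z = ?\<Gamma>" by (auto simp: ker_def)
    then show False using z(2) by simp
  qed
  have gen_kill: "y \<odot>\<^bsub>N\<^esub> (z \<odot>\<^bsub>N\<^esub> v) = \<zero>\<^bsub>N\<^esub>" if y: "y \<in> gens" and v: "v \<in> ?\<Gamma>" for y v
  proof (rule ccontr)
    assume n: "y \<odot>\<^bsub>N\<^esub> (z \<odot>\<^bsub>N\<^esub> v) \<noteq> \<zero>\<^bsub>N\<^esub>"
    note yR = genR[OF y]
    have assoc: "(y \<otimes> z) \<odot>\<^bsub>N\<^esub> u = y \<odot>\<^bsub>N\<^esub> (z \<odot>\<^bsub>N\<^esub> u)" if "u \<in> ?\<Gamma>" for u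
      using that G(1) yR zR by (simp add: N.smult_assoc1 subset_iff)
    have "y \<otimes> z \<in> insert \<one> gens" using z(1) y gen_mult yR by auto
    moreover have "v \<notin> ker (y \<otimes> z)" using n assoc[OF v] by (simp add: ker_def)
    then have "ker (y \<otimes> z) \<noteq> ?\<Gamma>" using v by blast
    ultimately have "ker (y \<otimes> z) \<in> F" unfolding F_def by blast
    moreover have "ker z \<subseteq> ker (y \<otimes> z)" using assoc yR by (auto simp: ker_def)
    ultimately have eq: "ker (y \<otimes> z) = ker z" using H(2) z(3) by blast
    \<comment> \<open>By maximality \<open>y\<close> acts injectively on \<open>z\<Gamma>\<close>, and hence so do its powers.\<close>
    have inj: "z \<odot>\<^bsub>N\<^esub> u = \<zero>\<^bsub>N\<^esub>" if "u \<in> ?\<Gamma>" "z \<odot>\<^bsub>N\<^esub> (y [^] (k::nat) \<odot>\<^bsub>N\<^esub> u) = \<zero>\<^bsub>N\<^esub>" for u k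
      using that
    proof (induction k arbitrary: u)
      case 0
      then show ?case using G(1) by auto
    next
      case (Suc k)
      have uC: "u \<in> carrier N" using Suc.prems(1) G(1) by blast
      have yu: "y \<odot>\<^bsub>N\<^esub> u \<in> ?\<Gamma>" using G(5)[OF yR Suc.prems(1)] .
      have "y [^] Suc k \<odot>\<^bsub>N\<^esub> u = y [^] k \<odot>\<^bsub>N\<^esub> (y \<odot>\<^bsub>N\<^esub> u)" using uC yR by (simp add: N.smult_assoc1)
      then have "z \<odot>\<^bsub>N\<^esub> (y \<odot>\<^bsub>N\<^esub> u) = \<zero>\<^bsub>N\<^esub>" using Suc.IH[OF yu] Suc.prems(2) by simp
      moreover have "z \<odot>\<^bsub>N\<^esub> (y \<odot>\<^bsub>N\<^esub> u) = (y \<otimes> z) \<odot>\<^bsub>N\<^esub> u"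
        using uC yR zR by (simp add: m_comm[of y z] N.smult_assoc1)
      ultimately have "u \<in> ker (y \<otimes> z)" using Suc.prems(1) by (simp add: ker_def)
      then show ?case unfolding eq by (simp add: ker_def)
    qed
    obtain k :: nat where k: "\<And>v. v \<in> ?\<Gamma> \<Longrightarrow> y [^] k \<odot>\<^bsub>N\<^esub> v = \<zero>\<^bsub>N\<^esub>"
      using N.maximal_torsion_bounded[of y] y by (auto simp: gens_def)
    have "z \<odot>\<^bsub>N\<^esub> u = \<zero>\<^bsub>N\<^esub>" if "u \<in> ?\<Gamma>" for u
      using inj[OF that, of k] k[OF that] zR by simp
    then have "ker z = ?\<Gamma>" by (auto simp: ker_def)
    then show False using z(2) by simp
  qed
  define J where "J = {a \<in> carrier R. \<forall>w\<in>?V. a \<odot>\<^bsub>N\<^esub> w = \<zero>\<^bsub>N\<^esub>}"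
  have VC: "w \<in> carrier N" if "w \<in> ?V" for w using V(1) that by blast
  have J: "ideal J R"
    by (rule ideal_by_closure) (use VC in \<open>auto simp: J_def N.smult_l_distr N.smult_assoc1\<close>)
  \<comment> \<open>Otherwise prime avoidance yields a generic element outside the annihilator \<open>J\<close> of \<open>z\<Gamma>\<close>.\<close>
  have "\<mm> \<subseteq> J"
  proof (rule ccontr)
    assume n: "\<not> \<mm> \<subseteq> J"
    have "\<exists>x\<in>\<mm>. \<forall>C\<in>insert J (\<P> \<union> \<Q>). x \<notin> C"
    proof (rule prime_avoidance[OF _ \<mm>_ideal, of _ J])
      show "finite (insert J (\<P> \<union> \<Q>))" using P(1) Q(1) by simp
      show "ideal C R \<and> (C = J \<or> primeideal C R) \<and> \<not> \<mm> \<subseteq> C" if "C \<in> insert J (\<P> \<union> \<Q>)" for C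
        using that n J P(2) Q(2) primeD(1) by blast
    qed
    then obtain x where x: "x \<in> \<mm>" "x \<notin> J" "x \<in> gens" by (auto simp: gens_def)
    then have "x \<in> J" using gen_kill[OF x(3)] genR[OF x(3)] by (auto simp: J_def)
    then show False using x(2) by simp
  qed
  then have "a \<odot>\<^bsub>N\<^esub> w = \<zero>\<^bsub>N\<^esub>" if "a \<in> \<mm>" "w \<in> ?V" for a w using that unfolding J_def by blast
  then show ?thesis using that[OF Vs V0 image_X[OF z(1)]] by blast
qed

text \<open>A complement of the line through \<open>v \<noteq> 0\<close> is found as a submodule \<open>K\<close> that is maximal among those not
  containing \<open>v\<close>.\<close>
lemma vector_space_contains_residue_field:
  assumes V: "V \<in> \<XX>" "carrier V \<noteq> {\<zero>\<^bsub>V\<^esub>}"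
    and kill: "\<And>a v. \<lbrakk>a \<in> \<mm>; v \<in> carrier V\<rbrakk> \<Longrightarrow> a \<odot>\<^bsub>V\<^esub> v = \<zero>\<^bsub>V\<^esub>"
  shows "contains_up_to_iso R \<XX> (residue_module R \<mm>)"
proof -
  have fgV: "fg_module R V" by (rule objects[OF V(1)])
  interpret V: fg_noetherian_module R V by (rule fg_noetherian_moduleI[OF noetherian_cring_axioms fgV])
  obtain v where v: "v \<in> carrier V" "v \<noteq> \<zero>\<^bsub>V\<^esub>" using V(2) V.M.zero_closed by blast
  define F where "F = {K. submodule K R V \<and> v \<notin> K}"
  have "{\<zero>\<^bsub>V\<^esub>} \<in> F" using V.zero_submodule v(2) by (simp add: F_def)
  moreover have "submodule K R V" if "K \<in> F" for K using that by (simp add: F_def)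
  ultimately obtain K where K: "K \<in> F" "\<And>L. \<lbrakk>L \<in> F; K \<subseteq> L\<rbrakk> \<Longrightarrow> L = K"
    using V.submodule_maximal_element[of F] by blast
  have Ks: "submodule K R V" "v \<notin> K" using K(1) by (auto simp: F_def)
  note K' = V.submodule_mem[OF Ks(1)]
  let ?L = "(\<lambda>a. a \<odot>\<^bsub>V\<^esub> v) ` carrier R"
  have Ls: "submodule ?L R V"
  proof (rule V.submodule_by_closure)
    show "?L \<subseteq> carrier V" using v(1) by blast
    show "\<zero>\<^bsub>V\<^esub> \<in> ?L" using v(1) by (intro image_eqI[of _ _ \<zero>]) auto
    show "x \<oplus>\<^bsub>V\<^esub> y \<in> ?L" if "x \<in> ?L" "y \<in> ?L" for x y
      using that v(1) by (auto simp flip: V.smult_l_distr)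
    show "a \<odot>\<^bsub>V\<^esub> x \<in> ?L" if "a \<in> carrier R" "x \<in> ?L" for a x
      using that v(1) by (auto simp flip: V.smult_assoc1)
  qed
  note L = V.submodule_mem[OF Ls]
  have scale: "v \<in> H" if H: "submodule H R V" "a \<in> carrier R" "a \<notin> \<mm>" "a \<odot>\<^bsub>V\<^esub> v \<in> H" for a H
  proof -
    obtain b where b: "b \<in> carrier R" "b \<otimes> a = \<one>" using unit_outside_maximal[OF H(2,3)] by blast
    then have "v = b \<odot>\<^bsub>V\<^esub> (a \<odot>\<^bsub>V\<^esub> v)" using H(2) v(1) by (simp flip: V.smult_assoc1)
    then show ?thesis using V.submodule_mem(5)[OF H(1) b(1) H(4)] by simp
  qed
  have "?L \<inter> K = {\<zero>\<^bsub>V\<^esub>}"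
  proof
    show "?L \<inter> K \<subseteq> {\<zero>\<^bsub>V\<^esub>}" using scale[OF Ks(1)] Ks(2) kill[OF _ v(1)] by blast
    show "{\<zero>\<^bsub>V\<^esub>} \<subseteq> ?L \<inter> K" using L(2) K'(2) by blast
  qed
  moreover have "\<exists>h\<in>?L. \<exists>k\<in>K. w = h \<oplus>\<^bsub>V\<^esub> k" if w: "w \<in> carrier V" for w
  proof (cases "w \<in> K")
    case True
    then have "w = \<zero>\<^bsub>V\<^esub> \<oplus>\<^bsub>V\<^esub> w" using w by simp
    then show ?thesis using L(2) True by blast
  next
    case False
    have ins: "insert w K \<subseteq> carrier V" using K'(1) w by simp
    let ?W = "mod_span R V (insert w K)"
    have "insert w K \<subseteq> ?W" by (rule V.mod_span_contains)
    then have "?W \<notin> F" using K(2)[of ?W] False by blast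
    then have "v \<in> ?W" using V.submodule_mod_span[OF ins] by (simp add: F_def)
    then obtain c u where c: "v = c \<odot>\<^bsub>V\<^esub> w \<oplus>\<^bsub>V\<^esub> u" "c \<in> carrier R" "u \<in> mod_span R V K"
      using V.mod_span_insert_subset[OF ins] by blast
    have u: "u \<in> K" using c(3) V.mod_span_least[OF Ks(1) order_refl] by blast
    have uC: "u \<in> carrier V" using u K'(1) by blast
    have "c \<notin> \<mm>"
    proof
      assume "c \<in> \<mm>"
      then have "v = u" using c(1) kill[OF _ w] uC by simp
      then show False using u Ks(2) by simp
    qed
    then obtain b where b: "b \<in> carrier R" "b \<otimes> c = \<one>" using unit_outside_maximal[OF c(2)] by blast
    have "w = b \<odot>\<^bsub>V\<^esub> (c \<odot>\<^bsub>V\<^esub> w)" using b c(2) w by (simp flip: V.smult_assoc1)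
    also have "c \<odot>\<^bsub>V\<^esub> w = v \<ominus>\<^bsub>V\<^esub> u"
      unfolding c(1) using c(2) w uC by (simp add: a_minus_def V.M.a_assoc V.M.r_neg)
    also have "b \<odot>\<^bsub>V\<^esub> (v \<ominus>\<^bsub>V\<^esub> u) = b \<odot>\<^bsub>V\<^esub> v \<oplus>\<^bsub>V\<^esub> (\<ominus>\<^bsub>V\<^esub> (b \<odot>\<^bsub>V\<^esub> u))"
      using b(1) v(1) uC by (simp add: a_minus_def V.smult_r_distr V.smult_r_minus)
    finally have "w = b \<odot>\<^bsub>V\<^esub> v \<oplus>\<^bsub>V\<^esub> (\<ominus>\<^bsub>V\<^esub> (b \<odot>\<^bsub>V\<^esub> u))" .
    moreover have "\<ominus>\<^bsub>V\<^esub> (b \<odot>\<^bsub>V\<^esub> u) \<in> K" using K'(5)[OF b(1) u] V.submoduleE(3)[OF Ks(1)] by blast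
    ultimately show ?thesis using b(1) by blast
  qed
  ultimately have "mod_isomorphic R (direct_sum [V\<lparr>carrier := ?L\<rparr>, V\<lparr>carrier := K\<rparr>]) V"
    by (rule isomorphic_direct_sum_of_complements[OF V.module_axioms Ls Ks(1)])
  moreover have "fg_module R (V\<lparr>carrier := ?L\<rparr>)" "fg_module R (V\<lparr>carrier := K\<rparr>)"
    using fg_module_restriction[OF noetherian_cring_axioms fgV] Ls Ks(1) by auto
  ultimately have "V\<lparr>carrier := ?L\<rparr> \<in> \<XX>" using summand_closed[OF V(1)] by blast
  moreover have "mod_isomorphic R (residue_module R \<mm>) (V\<lparr>carrier := ?L\<rparr>)"
    by (rule residue_module_isomorphic_line[OF noetherian_local_ring_axioms V.module_axioms v kill[OF _ v(1)]])
  ultimately show ?thesis unfolding contains_up_to_iso_def by blast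
qed

end


section \<open>Quotients by sequences\<close>

lemma mod_homD:
  assumes "h \<in> mod_hom R M N"
  shows "\<And>v. v \<in> carrier M \<Longrightarrow> h v \<in> carrier N"
    "\<And>v w. \<lbrakk>v \<in> carrier M; w \<in> carrier M\<rbrakk> \<Longrightarrow> h (v \<oplus>\<^bsub>M\<^esub> w) = h v \<oplus>\<^bsub>N\<^esub> h w"
    "\<And>a v. \<lbrakk>a \<in> carrier R; v \<in> carrier M\<rbrakk> \<Longrightarrow> h (a \<odot>\<^bsub>M\<^esub> v) = a \<odot>\<^bsub>N\<^esub> h v"
  using assms unfolding mod_hom_def by blast+

lemma mod_hom_minus:
  assumes "module R M" "module R N" "h \<in> mod_hom R M N" "v \<in> carrier M" "w \<in> carrier M"
  shows "h (v \<ominus>\<^bsub>M\<^esub> w) = h v \<ominus>\<^bsub>N\<^esub> h w"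
proof -
  interpret M: module R M by fact
  interpret N: module R N by fact
  note h = mod_homD[OF assms(3)]
  have "\<ominus>\<^bsub>M\<^esub> w = (\<ominus>\<^bsub>R\<^esub> \<one>\<^bsub>R\<^esub>) \<odot>\<^bsub>M\<^esub> w" using assms(5) by (simp add: M.smult_l_minus)
  then have "h (\<ominus>\<^bsub>M\<^esub> w) = \<ominus>\<^bsub>N\<^esub> (h w)"
    using assms(5) h by (simp add: N.smult_l_minus)
  then show ?thesis using assms(4,5) h(2)[of v "\<ominus>\<^bsub>M\<^esub> w"] by (simp add: a_minus_def)
qed

lemma mod_hom_zero:
  assumes "module R M" "module R N" "h \<in> mod_hom R M N"
  shows "h \<zero>\<^bsub>M\<^esub> = \<zero>\<^bsub>N\<^esub>"
proof -
  interpret M: module R M by fact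
  interpret N: module R N by fact
  have "h (\<zero>\<^bsub>R\<^esub> \<odot>\<^bsub>M\<^esub> \<zero>\<^bsub>M\<^esub>) = \<zero>\<^bsub>R\<^esub> \<odot>\<^bsub>N\<^esub> h \<zero>\<^bsub>M\<^esub>" by (rule mod_homD(3)[OF assms(3)]) simp_all
  then show ?thesis using mod_homD(1)[OF assms(3) M.M.zero_closed] by simp
qed

context module
begin

lemma submodule_abelian_subgroup:
  assumes "submodule K R M"
  shows "abelian_subgroup K M"
  using assms by (intro abelian_subgroupI3 additive_subgroup.intro M.abelian_group_axioms)
    (simp add: submodule_def)

lemma coset_eq_submodule_iff:
  assumes "submodule K R M" "v \<in> carrier M"
  shows "K +>\<^bsub>M\<^esub> v = K \<longleftrightarrow> v \<in> K"
proof -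
  interpret K: abelian_subgroup K M by (rule submodule_abelian_subgroup[OF assms(1)])
  show ?thesis using K.a_rcos_self[OF assms(2)] K.a_rcos_const by blast
qed

end

text \<open>Quotient modules are defined only for module records without further fields.\<close>
locale plain_module = module R M
  for R :: "('a, 'r) ring_scheme" (structure) and M :: "('a, 'b) module" (structure)
begin

lemma quot_module_carrier: "carrier (quot_module M K) = (\<lambda>v. K +>\<^bsub>M\<^esub> v) ` carrier M"
  by (auto simp: quot_module_def A_RCOSETS_defs a_r_coset_def)

lemma quot_module_zero: "\<zero>\<^bsub>quot_module M K\<^esub> = K"
  by (simp add: quot_module_def)

lemma quot_module_add:
  assumes "submodule K R M" "v \<in> carrier M" "w \<in> carrier M"
  shows "(K +>\<^bsub>M\<^esub> v) \<oplus>\<^bsub>quot_module M K\<^esub> (K +>\<^bsub>M\<^esub> w) = K +>\<^bsub>M\<^esub> (v \<oplus>\<^bsub>M\<^esub> w)"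
proof -
  interpret K: abelian_subgroup K M by (rule submodule_abelian_subgroup[OF assms(1)])
  show ?thesis using K.a_rcos_sum[OF assms(2,3)] by (simp add: quot_module_def)
qed

lemma quot_module_smult:
  assumes "submodule K R M" "a \<in> carrier R" "v \<in> carrier M"
  shows "a \<odot>\<^bsub>quot_module M K\<^esub> (K +>\<^bsub>M\<^esub> v) = K +>\<^bsub>M\<^esub> (a \<odot>\<^bsub>M\<^esub> v)"
proof -
  interpret K: abelian_subgroup K M by (rule submodule_abelian_subgroup[OF assms(1)])
  have "K +>\<^bsub>M\<^esub> (a \<odot>\<^bsub>M\<^esub> u) = K +>\<^bsub>M\<^esub> (a \<odot>\<^bsub>M\<^esub> v)" if u: "u \<in> K +>\<^bsub>M\<^esub> v" for u
  proof -
    have uM: "u \<in> carrier M" using K.a_elemrcos_carrier[OF assms(3) u] .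
    have "u \<oplus>\<^bsub>M\<^esub> \<ominus>\<^bsub>M\<^esub> v \<in> K" by (rule K.a_rcos_module_imp[OF assms(3) u])
    then have "a \<odot>\<^bsub>M\<^esub> (u \<oplus>\<^bsub>M\<^esub> \<ominus>\<^bsub>M\<^esub> v) \<in> K" by (rule submodule_mem(5)[OF assms(1,2)])
    then have "a \<odot>\<^bsub>M\<^esub> u \<oplus>\<^bsub>M\<^esub> \<ominus>\<^bsub>M\<^esub> (a \<odot>\<^bsub>M\<^esub> v) \<in> K"
      using uM assms(2,3) by (simp add: smult_r_distr smult_r_minus)
    then have "a \<odot>\<^bsub>M\<^esub> u \<in> K +>\<^bsub>M\<^esub> (a \<odot>\<^bsub>M\<^esub> v)"
      using uM assms(2,3) by (intro K.a_rcos_module_rev) auto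
    then show ?thesis using K.a_repr_independence' assms(2,3) by blast
  qed
  then have "(\<Union>u\<in>K +>\<^bsub>M\<^esub> v. K +>\<^bsub>M\<^esub> (a \<odot>\<^bsub>M\<^esub> u)) = K +>\<^bsub>M\<^esub> (a \<odot>\<^bsub>M\<^esub> v)"
    using K.a_rcos_self[OF assms(3)] by blast
  then show ?thesis by (simp add: quot_module_def)
qed

lemma nonzerodivisor_on_quot_module_iff:
  assumes K: "submodule K R M" and y: "y \<in> carrier R"
  shows "nonzerodivisor_on y (quot_module M K) \<longleftrightarrow> (\<forall>v\<in>carrier M. y \<odot>\<^bsub>M\<^esub> v \<in> K \<longrightarrow> v \<in> K)"
  unfolding nonzerodivisor_on_def quot_module_carrier quot_module_zero
  using quot_module_smult[OF K y] coset_eq_submodule_iff[OF K] y by auto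

lemma quot_module_nonzero:
  assumes K: "submodule K R M" and "K \<noteq> carrier M"
  shows "carrier (quot_module M K) \<noteq> {\<zero>\<^bsub>quot_module M K\<^esub>}"
proof
  assume z: "carrier (quot_module M K) = {\<zero>\<^bsub>quot_module M K\<^esub>}"
  have "v \<in> K" if "v \<in> carrier M" for v
    using z that coset_eq_submodule_iff[OF K that] unfolding quot_module_carrier quot_module_zero by blast
  then show False using assms(2) submodule_mem(1)[OF K] by blast
qed

text \<open>Replaces cosets by a surjection from \<open>M\<close>, so that modules isomorphic to different quotients of \<open>M\<close> can be
  compared through elements of \<open>M\<close>.\<close>
lemma quotient_presentation:
  fixes N :: "('a, 'n) module"
  assumes K: "submodule K R M" and N: "module R N" "mod_isomorphic R (quot_module M K) N"
  obtains \<phi> where "\<phi> \<in> mod_hom R M N" "\<phi> ` carrier M = carrier N"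
    "\<And>v. v \<in> carrier M \<Longrightarrow> \<phi> v = \<zero>\<^bsub>N\<^esub> \<longleftrightarrow> v \<in> K"
proof -
  interpret N: module R N by fact
  obtain h where h: "h \<in> mod_hom R (quot_module M K) N"
      "bij_betw h (carrier (quot_module M K)) (carrier N)"
    using N(2) unfolding mod_isomorphic_def by blast
  note h' = mod_homD[OF h(1)]
  define \<phi> where "\<phi> v = h (K +>\<^bsub>M\<^esub> v)" for v
  have C: "K +>\<^bsub>M\<^esub> v \<in> carrier (quot_module M K)" if "v \<in> carrier M" for v
    using that by (simp add: quot_module_carrier)
  have hom: "\<phi> \<in> mod_hom R M N"
    unfolding mod_hom_def
  proof (intro CollectI conjI ballI funcsetI)
    show "\<phi> v \<in> carrier N" if "v \<in> carrier M" for v unfolding \<phi>_def using h'(1) C that by blast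
    show "\<phi> (v \<oplus>\<^bsub>M\<^esub> w) = \<phi> v \<oplus>\<^bsub>N\<^esub> \<phi> w" if "v \<in> carrier M" "w \<in> carrier M" for v w
      unfolding \<phi>_def using h'(2)[OF C[OF that(1)] C[OF that(2)]] quot_module_add[OF K that] by simp
    show "\<phi> (a \<odot>\<^bsub>M\<^esub> v) = a \<odot>\<^bsub>N\<^esub> \<phi> v" if "a \<in> carrier R" "v \<in> carrier M" for a v
      unfolding \<phi>_def using h'(3)[OF that(1) C[OF that(2)]] quot_module_smult[OF K that] by simp
  qed
  have "\<phi> ` carrier M = h ` carrier (quot_module M K)"
    unfolding quot_module_carrier image_image \<phi>_def ..
  then have surj: "\<phi> ` carrier M = carrier N" using h(2) by (simp add: bij_betw_def)
  have "\<phi> v = \<zero>\<^bsub>N\<^esub> \<longleftrightarrow> v \<in> K" if v: "v \<in> carrier M" for v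
  proof -
    have "K +>\<^bsub>M\<^esub> \<zero>\<^bsub>M\<^esub> = K" using coset_eq_submodule_iff[OF K] submodule_mem(2)[OF K] by simp
    then have KQ: "K \<in> carrier (quot_module M K)" and hK: "h K = \<phi> \<zero>\<^bsub>M\<^esub>"
      using C[of "\<zero>\<^bsub>M\<^esub>"] by (simp_all add: \<phi>_def)
    have "h K = \<zero>\<^bsub>N\<^esub>" unfolding hK by (rule mod_hom_zero[OF module_axioms N(1) hom])
    then have "\<phi> v = \<zero>\<^bsub>N\<^esub> \<longleftrightarrow> h (K +>\<^bsub>M\<^esub> v) = h K" by (simp add: \<phi>_def)
    also have "\<dots> \<longleftrightarrow> K +>\<^bsub>M\<^esub> v = K"
      using h(2) C[OF v] KQ unfolding bij_betw_def by (metis inj_on_eq_iff)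
    also have "\<dots> \<longleftrightarrow> v \<in> K" by (rule coset_eq_submodule_iff[OF K v])
    finally show ?thesis .
  qed
  then show ?thesis using that hom surj by blast
qed

end

lemma ideal_smult_submodule:
  assumes "module R M" "I \<subseteq> carrier R"
  shows "submodule (ideal_smult R I M) R M"
proof -
  interpret module R M by fact
  show ?thesis unfolding ideal_smult_def using assms(2) by (intro submodule_mod_span) auto
qed

lemma ideal_smult_contains:
  assumes "module R M" "a \<in> I" "v \<in> carrier M"
  shows "a \<odot>\<^bsub>M\<^esub> v \<in> ideal_smult R I M"
proof -
  interpret module R M by fact
  have "a \<odot>\<^bsub>M\<^esub> v \<in> {a \<odot>\<^bsub>M\<^esub> v | a v. a \<in> I \<and> v \<in> carrier M}" using assms(2,3) by blast
  then show ?thesis unfolding ideal_smult_def by (rule subsetD[OF mod_span_contains])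
qed

lemma ideal_smult_mono:
  assumes "I \<subseteq> J"
  shows "ideal_smult R I M \<subseteq> ideal_smult R J M"
proof -
  have "{a \<odot>\<^bsub>M\<^esub> v | a v. a \<in> I \<and> v \<in> carrier M} \<subseteq> {a \<odot>\<^bsub>M\<^esub> v | a v. a \<in> J \<and> v \<in> carrier M}"
    using assms by blast
  then show ?thesis unfolding ideal_smult_def mod_span_def by (intro Inter_anti_mono) auto
qed

text \<open>With \<open>N = M/(S)M\<close> this is the identity \<open>(S, y)M/(S)M = yN\<close>.\<close>
lemma ideal_smult_insert_iff:
  fixes R :: "('a, 'r) ring_scheme" and M :: "('a, 'b) module" and N :: "('a, 'n) module"
  assumes M: "module R M" and N: "module R N"
    and \<phi>: "\<phi> \<in> mod_hom R M N" "\<phi> ` carrier M = carrier N"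
      "\<And>v. v \<in> carrier M \<Longrightarrow> \<phi> v = \<zero>\<^bsub>N\<^esub> \<longleftrightarrow> v \<in> ideal_smult R (Idl\<^bsub>R\<^esub> S) M"
    and S: "S \<subseteq> carrier R" and y: "y \<in> carrier R" and v: "v \<in> carrier M"
  shows "v \<in> ideal_smult R (Idl\<^bsub>R\<^esub> (insert y S)) M \<longleftrightarrow> \<phi> v \<in> (\<lambda>n. y \<odot>\<^bsub>N\<^esub> n) ` carrier N"
proof -
  interpret M: module R M by fact
  interpret N: module R N by fact
  note \<phi>' = mod_homD[OF \<phi>(1)]
  let ?yN = "(\<lambda>n. y \<odot>\<^bsub>N\<^esub> n) ` carrier N"
  let ?K = "ideal_smult R (Idl\<^bsub>R\<^esub> S) M" and ?K' = "ideal_smult R (Idl\<^bsub>R\<^esub> (insert y S)) M"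
  have Ns: "submodule ?yN R N" by (rule N.submodule_image_smult[OF N.carrier_is_submodule y])
  note yN = N.submodule_mem[OF Ns]
  have Sy: "insert y S \<subseteq> carrier R" using S y by simp
  have self: "insert y S \<subseteq> Idl\<^bsub>R\<^esub> (insert y S)" by (rule M.R.genideal_self[OF Sy])
  have IdlR: "Idl\<^bsub>R\<^esub> (insert y S) \<subseteq> carrier R"
    by (rule M.R.ideal_mem(1)[OF M.R.genideal_ideal[OF Sy]])
  have K's: "submodule ?K' R M" by (rule ideal_smult_submodule[OF M IdlR])
  note K' = M.submodule_mem[OF K's]
  have KK': "?K \<subseteq> ?K'"
    by (rule ideal_smult_mono, rule M.R.genideal_minimal[OF M.R.genideal_ideal[OF Sy]]) (use self in blast)
  show ?thesis
  proof
    define W where "W = {v \<in> carrier M. \<phi> v \<in> ?yN}"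
    have "submodule W R M"
      unfolding W_def
      by (rule M.submodule_by_closure) (use yN \<phi>' mod_hom_zero[OF M N \<phi>(1)] in auto)
    moreover have "{a \<odot>\<^bsub>M\<^esub> v | a v. a \<in> Idl\<^bsub>R\<^esub> (insert y S) \<and> v \<in> carrier M} \<subseteq> W"
    proof -
      define J where "J = {a \<in> carrier R. \<forall>v\<in>carrier M. a \<odot>\<^bsub>N\<^esub> \<phi> v \<in> ?yN}"
      have "ideal J R"
      proof (rule M.R.ideal_by_closure)
        show "J \<subseteq> carrier R" by (auto simp: J_def)
        show "\<zero>\<^bsub>R\<^esub> \<in> J" using yN(2) \<phi>'(1) by (simp add: J_def)
        show "a \<oplus>\<^bsub>R\<^esub> b \<in> J" if "a \<in> J" "b \<in> J" for a b
          using that yN(3) \<phi>'(1) by (simp add: J_def N.smult_l_distr)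
        show "r \<otimes>\<^bsub>R\<^esub> a \<in> J" if "a \<in> J" "r \<in> carrier R" for a r
          using that yN(5) \<phi>'(1) by (simp add: J_def N.smult_assoc1)
      qed
      moreover have "insert y S \<subseteq> J"
      proof -
        have "y \<in> J" using y \<phi>'(1) by (simp add: J_def)
        moreover have "s \<in> J" if s: "s \<in> S" for s
        proof -
          have sR: "s \<in> carrier R" using s S by blast
          have "s \<odot>\<^bsub>N\<^esub> \<phi> v \<in> ?yN" if v: "v \<in> carrier M" for v
          proof -
            have "s \<odot>\<^bsub>M\<^esub> v \<in> ?K"
              by (rule ideal_smult_contains[OF M _ v]) (use M.R.genideal_self[OF S] s in blast)
            then have "\<phi> (s \<odot>\<^bsub>M\<^esub> v) = \<zero>\<^bsub>N\<^esub>" using \<phi>(3) sR v by simp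
            then show ?thesis using \<phi>'(3)[OF sR v] yN(2) by simp
          qed
          then show ?thesis using sR by (simp add: J_def)
        qed
        ultimately show ?thesis by blast
      qed
      ultimately have IJ: "Idl\<^bsub>R\<^esub> (insert y S) \<subseteq> J" by (rule M.R.genideal_minimal)
      show ?thesis
      proof
        fix w assume "w \<in> {a \<odot>\<^bsub>M\<^esub> v | a v. a \<in> Idl\<^bsub>R\<^esub> (insert y S) \<and> v \<in> carrier M}"
        then obtain a v where w: "w = a \<odot>\<^bsub>M\<^esub> v" "a \<in> J" "v \<in> carrier M" using IJ by blast
        then show "w \<in> W" using \<phi>'(3) by (simp add: W_def J_def)
      qed
    qed
    ultimately have "?K' \<subseteq> W" unfolding ideal_smult_def by (rule M.mod_span_least)
    then show "v \<in> ?K' \<Longrightarrow> \<phi> v \<in> ?yN" by (auto simp: W_def)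
  next
    assume "\<phi> v \<in> ?yN"
    then obtain n where n: "n \<in> carrier N" "\<phi> v = y \<odot>\<^bsub>N\<^esub> n" by blast
    then have "n \<in> \<phi> ` carrier M" by (simp only: \<phi>(2))
    then obtain w where w: "w \<in> carrier M" "\<phi> v = y \<odot>\<^bsub>N\<^esub> \<phi> w" using n(2) by blast
    have yw: "y \<odot>\<^bsub>M\<^esub> w \<in> carrier M" using y w(1) by simp
    have "\<phi> (v \<ominus>\<^bsub>M\<^esub> y \<odot>\<^bsub>M\<^esub> w) = \<phi> v \<ominus>\<^bsub>N\<^esub> \<phi> v"
      using mod_hom_minus[OF M N \<phi>(1) v yw] \<phi>'(3)[OF y w(1)] w(2) by simp
    also have "\<dots> = \<zero>\<^bsub>N\<^esub>" using \<phi>'(1)[OF v] by (simp add: N.M.minus_eq_zero_iff)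
    finally have "v \<ominus>\<^bsub>M\<^esub> y \<odot>\<^bsub>M\<^esub> w \<in> ?K'" using \<phi>(3) v yw KK' by auto
    moreover have "y \<odot>\<^bsub>M\<^esub> w \<in> ?K'" using self w(1) by (intro ideal_smult_contains[OF M]) auto
    ultimately have "(v \<ominus>\<^bsub>M\<^esub> y \<odot>\<^bsub>M\<^esub> w) \<oplus>\<^bsub>M\<^esub> y \<odot>\<^bsub>M\<^esub> w \<in> ?K'" by (rule K'(3))
    moreover have "(v \<ominus>\<^bsub>M\<^esub> y \<odot>\<^bsub>M\<^esub> w) \<oplus>\<^bsub>M\<^esub> y \<odot>\<^bsub>M\<^esub> w = v"
      using v yw by (simp add: a_minus_def M.M.a_assoc M.M.l_neg)
    ultimately show "v \<in> ?K'" by simp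
  qed
qed

text \<open>The kernel of the surjection from \<open>N = M/(S)M\<close> to \<open>N' = M/(S, y)M\<close> is \<open>yN\<close>, and prethick
  subcategories are closed under kernels of epimorphisms.\<close>
lemma (in prethick_noetherian) smult_range_closed:
  fixes M :: "('a, 'm) module"
  assumes M: "module R M" and N: "N \<in> \<XX>" "N' \<in> \<XX>" and S: "S \<subseteq> carrier R" and y: "y \<in> carrier R"
    and iso: "mod_isomorphic R (quot_module M (ideal_smult R (Idl S) M)) N"
      "mod_isomorphic R (quot_module M (ideal_smult R (Idl (insert y S)) M)) N'"
  shows "N\<lparr>carrier := (\<lambda>n. y \<odot>\<^bsub>N\<^esub> n) ` carrier N\<rparr> \<in> \<XX>"
proof -
  interpret M: plain_module R M by (rule plain_module.intro[OF M])
  have fgN: "fg_module R N" and mN: "module R N" "module R N'"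
    using objects[OF N(1)] objects[OF N(2)] by (auto simp: fg_module_def)
  interpret N: module R N by (rule mN(1))
  interpret N': module R N' by (rule mN(2))
  have Sy: "insert y S \<subseteq> carrier R" using S y by simp
  have Ks: "submodule (ideal_smult R (Idl S) M) R M" "submodule (ideal_smult R (Idl (insert y S)) M) R M"
    using ideal_smult_submodule[OF M] ideal_mem(1)[OF genideal_ideal] S Sy by auto
  obtain \<phi> where \<phi>: "\<phi> \<in> mod_hom R M N" "\<phi> ` carrier M = carrier N"
    "\<And>v. v \<in> carrier M \<Longrightarrow> \<phi> v = \<zero>\<^bsub>N\<^esub> \<longleftrightarrow> v \<in> ideal_smult R (Idl S) M"
    by (rule M.quotient_presentation[OF Ks(1) mN(1) iso(1)]) blast
  obtain \<psi> where \<psi>: "\<psi> \<in> mod_hom R M N'" "\<psi> ` carrier M = carrier N'"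
    "\<And>v. v \<in> carrier M \<Longrightarrow> \<psi> v = \<zero>\<^bsub>N'\<^esub> \<longleftrightarrow> v \<in> ideal_smult R (Idl (insert y S)) M"
    by (rule M.quotient_presentation[OF Ks(2) mN(2) iso(2)]) blast
  note \<phi>' = mod_homD[OF \<phi>(1)] and \<psi>' = mod_homD[OF \<psi>(1)]
  let ?yN = "(\<lambda>n. y \<odot>\<^bsub>N\<^esub> n) ` carrier N"
  have ker: "\<psi> v = \<zero>\<^bsub>N'\<^esub> \<longleftrightarrow> \<phi> v \<in> ?yN" if "v \<in> carrier M" for v
    using \<psi>(3)[OF that] ideal_smult_insert_iff[OF M mN(1) \<phi> S y that] by blast
  have yNs: "submodule ?yN R N" by (rule N.submodule_image_smult[OF N.carrier_is_submodule y])
  have factor: "\<psi> v = \<psi> w" if vw: "v \<in> carrier M" "w \<in> carrier M" "\<phi> v = \<phi> w" for v w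
  proof -
    have "\<phi> (v \<ominus>\<^bsub>M\<^esub> w) = \<zero>\<^bsub>N\<^esub>"
      using mod_hom_minus[OF M mN(1) \<phi>(1) vw(1,2)] vw(3) \<phi>'(1)[OF vw(2)]
      by (simp add: N.M.minus_eq_zero_iff)
    then have "\<phi> (v \<ominus>\<^bsub>M\<^esub> w) \<in> ?yN" using N.submodule_mem(2)[OF yNs] by simp
    then have "\<psi> (v \<ominus>\<^bsub>M\<^esub> w) = \<zero>\<^bsub>N'\<^esub>" using ker vw(1,2) by simp
    then show ?thesis
      using mod_hom_minus[OF M mN(2) \<psi>(1) vw(1,2)] \<psi>'(1) vw(1,2) by (simp add: N'.M.minus_eq_zero_iff)
  qed
  define g where "g n = \<psi> (SOME v. v \<in> carrier M \<and> \<phi> v = n)" for n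
  have g: "g (\<phi> v) = \<psi> v" if v: "v \<in> carrier M" for v
  proof -
    have "(SOME w. w \<in> carrier M \<and> \<phi> w = \<phi> v) \<in> carrier M \<and> \<phi> (SOME w. w \<in> carrier M \<and> \<phi> w = \<phi> v) = \<phi> v"
      by (rule someI[of "\<lambda>w. w \<in> carrier M \<and> \<phi> w = \<phi> v" v]) (simp add: v)
    then show ?thesis unfolding g_def using factor v by blast
  qed
  have lift: "\<exists>v\<in>carrier M. n = \<phi> v" if "n \<in> carrier N" for n
    using that unfolding \<phi>(2)[symmetric] by blast
  have "g \<in> mod_hom R N N'"
    unfolding mod_hom_def
  proof (intro CollectI conjI ballI funcsetI)
    show "g n \<in> carrier N'" if "n \<in> carrier N" for n using lift[OF that] g \<psi>'(1) by auto
    show "g (n \<oplus>\<^bsub>N\<^esub> m) = g n \<oplus>\<^bsub>N'\<^esub> g m" if nm: "n \<in> carrier N" "m \<in> carrier N" for n m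
    proof -
      obtain v w where v: "v \<in> carrier M" "n = \<phi> v" "w \<in> carrier M" "m = \<phi> w" using lift nm by blast
      then have "g (n \<oplus>\<^bsub>N\<^esub> m) = \<psi> (v \<oplus>\<^bsub>M\<^esub> w)" using \<phi>'(2)[of v w] g[of "v \<oplus>\<^bsub>M\<^esub> w"] by simp
      then show ?thesis using v g \<psi>'(2) by simp
    qed
    show "g (a \<odot>\<^bsub>N\<^esub> n) = a \<odot>\<^bsub>N'\<^esub> g n" if an: "a \<in> carrier R" "n \<in> carrier N" for a n
    proof -
      obtain v where v: "v \<in> carrier M" "n = \<phi> v" using lift an by blast
      then have "g (a \<odot>\<^bsub>N\<^esub> n) = \<psi> (a \<odot>\<^bsub>M\<^esub> v)" using \<phi>'(3)[of a v] g[of "a \<odot>\<^bsub>M\<^esub> v"] an(1) by simp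
      then show ?thesis using v g \<psi>'(3) an(1) by simp
    qed
  qed
  moreover have "g ` carrier N = carrier N'"
  proof -
    have "g ` carrier N = (\<lambda>v. g (\<phi> v)) ` carrier M" unfolding \<phi>(2)[symmetric] image_image ..
    also have "\<dots> = \<psi> ` carrier M" using g by simp
    finally show ?thesis using \<psi>(2) by simp
  qed
  moreover have "?yN = {n \<in> carrier N. g n = \<zero>\<^bsub>N'\<^esub>}"
  proof (rule Set.set_eqI)
    fix n
    show "n \<in> ?yN \<longleftrightarrow> n \<in> {n \<in> carrier N. g n = \<zero>\<^bsub>N'\<^esub>}"
    proof (cases "n \<in> carrier N")
      case True
      then obtain v where "v \<in> carrier M" "n = \<phi> v" using lift by blast
      then show ?thesis using ker g True by simp
    next
      case False
      then show ?thesis using N.submodule_mem(1)[OF yNs] by blast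
    qed
  qed
  moreover have "(\<lambda>n. n) \<in> mod_hom R (N\<lparr>carrier := ?yN\<rparr>) N"
    using N.submodule_mem(1)[OF yNs] by (auto simp: mod_hom_def)
  ultimately have "short_exact R (N\<lparr>carrier := ?yN\<rparr>) N N' (\<lambda>n. n) g"
    unfolding short_exact_def by simp
  moreover have "fg_module R (N\<lparr>carrier := ?yN\<rparr>)"
    by (rule fg_module_restriction[OF noetherian_cring_axioms fgN yNs])
  ultimately show ?thesis using N kernel_closed by blast
qed


section \<open>Prethick subcategories containing quotients by parameters\<close>

theorem theorem1p3:
  fixes R :: "('a, 'r) ring_scheme" and \<mm> :: "'a set"
    and \<XX> :: "('a, 'a list) module set" and M :: "('a, 'b) module"
  assumes "noetherian_local_ring R \<mm>"
    and "prethick R \<XX>"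
    and "fg_module R M"
    and "krull_dim R \<ge> depth R \<mm> M + 1"
    and "\<And>i xs. \<lbrakk>enat i \<le> depth R \<mm> M + 1; length xs = i; subsystem_of_parameters R \<mm> xs\<rbrakk>
           \<Longrightarrow> contains_up_to_iso R \<XX> (quot_by_seq R M xs)"
  shows "contains_up_to_iso R \<XX> (residue_module R \<mm>)"
proof -
  interpret noetherian_local_ring R \<mm> by fact
  interpret prethick_local R \<mm> \<XX>
    using assms(1,2) by (rule prethick_local.intro)
  interpret M: fg_noetherian_module R M by (rule fg_noetherian_moduleI[OF noetherian_cring_axioms assms(3)])
  interpret M: fg_local_module R \<mm> M ..
  interpret M: plain_module R M ..
  note module_M = M.module_axioms
  obtain d where d: "krull_dim R = enat d" "height_at_least R d \<mm>" "\<not> height_at_least R (Suc d) \<mm>"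
    by (rule krull_dim_finite)
  obtain t where t: "depth R \<mm> M = enat t"
    using assms(4) d(1) by (cases "depth R \<mm> M") auto
  have td: "Suc t \<le> d" using assms(4) unfolding t d(1) by (simp add: one_enat_def)
  \<comment> \<open>The zero module has depth \<open>\<infinity>\<close>, but the depth of \<open>M\<close> is finite since \<open>dim R\<close> is.\<close>
  have M0: "carrier M \<noteq> {\<zero>\<^bsub>M\<^esub>}" using t by (auto simp: depth_def)
  define K where "K xs = ideal_smult R (Idl\<^bsub>R\<^esub> (set xs)) M" for xs
  have quot: "quot_by_seq R M xs = quot_module M (K xs)" for xs
    by (simp add: quot_by_seq_def K_def)
  have Idl_sub: "Idl\<^bsub>R\<^esub> (set xs) \<subseteq> \<mm>" if "set xs \<subseteq> \<mm>" for xs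
    by (rule genideal_minimal[OF \<mm>_ideal that])
  have Ks: "submodule (K xs) R M" if "set xs \<subseteq> \<mm>" for xs
    unfolding K_def using Idl_sub[OF that] \<mm>_carrier by (intro ideal_smult_submodule[OF module_M]) blast
  define good where "good xs \<longleftrightarrow> set xs \<subseteq> \<mm> \<and> height_generic R xs \<and>
    (\<forall>i<length xs. nonzerodivisor_on (xs ! i) (quot_by_seq R M (take i xs)))" for xs
  have good_length: "length xs \<le> t" if g: "good xs" for xs
  proof -
    have xs: "set xs \<subseteq> \<mm>" using g by (simp add: good_def)
    have "K xs \<noteq> carrier M"
      unfolding K_def ideal_smult_def by (rule M.nakayama_maximal[OF M0 Idl_sub[OF xs]])
    then have "regular_sequence R M xs"
      using g \<mm>_carrier M.quot_module_nonzero[OF Ks[OF xs]]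
      unfolding regular_sequence_def good_def quot by blast
    then have "enat (length xs) \<le> depth R \<mm> M"
      using M0 xs unfolding depth_def by (auto intro!: Sup_upper)
    then show ?thesis by (simp add: t)
  qed
  have "good []" by (simp add: good_def height_generic_Nil)
  then have "\<exists>xs. good xs \<and> (\<forall>ys. good ys \<longrightarrow> length ys \<le> length xs)"
    using good_length by (intro ex_has_greatest_nat[of good "[]" length "Suc t"]) (auto simp: less_Suc_eq_le)
  then obtain xs where xs: "good xs" and xs_max: "\<And>ys. good ys \<Longrightarrow> length ys \<le> length xs"
    by blast
  have xs': "set xs \<subseteq> \<mm>" "height_generic R xs" "length xs \<le> t"
    using xs good_length[OF xs] by (auto simp: good_def)
  have xsR: "set xs \<subseteq> carrier R" using xs'(1) \<mm>_carrier by blast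
  have in_X: "contains_up_to_iso R \<XX> (quot_module M (K ys))"
    if "height_generic R ys" "set ys \<subseteq> \<mm>" "length ys \<le> Suc t" for ys
  proof -
    have "subsystem_of_parameters R \<mm> ys"
      using that td by (intro height_generic_subsystem[OF d]) auto
    moreover have "enat (length ys) \<le> depth R \<mm> M + 1"
      using that(3) by (simp add: t one_enat_def)
    ultimately show ?thesis using assms(5)[of "length ys" ys] by (simp add: quot)
  qed
  obtain N where N: "N \<in> \<XX>" "mod_isomorphic R (quot_module M (K xs)) N"
    using in_X[of xs] xs' unfolding contains_up_to_iso_def by auto
  have fgN: "fg_module R N" by (rule objects[OF N(1)])
  interpret N: fg_noetherian_module R N by (rule fg_noetherian_moduleI[OF noetherian_cring_axioms fgN])
  interpret N: fg_local_module R \<mm> N ..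
  obtain \<phi> where \<phi>: "\<phi> \<in> mod_hom R M N" "\<phi> ` carrier M = carrier N"
    "\<And>v. v \<in> carrier M \<Longrightarrow> \<phi> v = \<zero>\<^bsub>N\<^esub> \<longleftrightarrow> v \<in> K xs"
    by (rule M.quotient_presentation[OF Ks[OF xs'(1)] N.module_axioms N(2)]) blast
  note \<phi>' = mod_homD[OF \<phi>(1)]
  have len: "length xs < d" using xs'(3) td by simp
  obtain \<P> where P: "finite \<P>" "\<And>P. P \<in> \<P> \<Longrightarrow> primeideal P R \<and> \<not> \<mm> \<subseteq> P"
    "\<And>y. (\<And>P. P \<in> \<P> \<Longrightarrow> y \<notin> P) \<Longrightarrow> height_generic R (xs @ [y])"
    by (rule height_generic_extend[OF xs'(2,1) d(2) len]) blast
  \<comment> \<open>Without torsion, a generic element of \<open>\<mm>\<close> would prolong the sequence \<open>xs\<close> of maximal length.\<close>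
  have torsion: "maximal_torsion R \<mm> N \<noteq> {\<zero>\<^bsub>N\<^esub>}"
  proof
    assume zero: "maximal_torsion R \<mm> N = {\<zero>\<^bsub>N\<^esub>}"
    obtain \<Q> where Q: "finite \<Q>" "\<And>P. P \<in> \<Q> \<Longrightarrow> primeideal P R \<and> \<not> \<mm> \<subseteq> P"
      "\<And>y v. \<lbrakk>y \<in> carrier R; \<And>P. P \<in> \<Q> \<Longrightarrow> y \<notin> P; v \<in> carrier N;
        y \<odot>\<^bsub>N\<^esub> v \<in> maximal_torsion R \<mm> N\<rbrakk> \<Longrightarrow> v \<in> maximal_torsion R \<mm> N"
      by (rule N.generic_elements_regular_mod_torsion) blast
    obtain y where y: "y \<in> \<mm>" "\<And>P. P \<in> \<P> \<union> \<Q> \<Longrightarrow> y \<notin> P"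
      using exists_generic_element[of "\<P> \<union> \<Q>"] P(1,2) Q(1,2) by blast
    have yR: "y \<in> carrier R" using y(1) \<mm>_carrier by blast
    have "v \<in> K xs" if v: "v \<in> carrier M" "y \<odot>\<^bsub>M\<^esub> v \<in> K xs" for v
    proof -
      have "y \<odot>\<^bsub>N\<^esub> \<phi> v = \<zero>\<^bsub>N\<^esub>" using \<phi>(3)[of "y \<odot>\<^bsub>M\<^esub> v"] \<phi>'(3)[OF yR v(1)] v yR by simp
      then have "\<phi> v \<in> maximal_torsion R \<mm> N"
        using Q(3)[OF yR _ \<phi>'(1)[OF v(1)]] y(2) zero by blast
      then show ?thesis using \<phi>(3)[OF v(1)] zero by simp
    qed
    then have "nonzerodivisor_on y (quot_by_seq R M xs)"
      unfolding quot M.nonzerodivisor_on_quot_module_iff[OF Ks[OF xs'(1)] yR] by blast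
    then have "good (xs @ [y])"
      using xs y P(3) by (auto simp: good_def less_Suc_eq nth_append)
    then show False using xs_max[of "xs @ [y]"] by simp
  qed
  have image: "N\<lparr>carrier := (\<lambda>v. y \<odot>\<^bsub>N\<^esub> v) ` carrier N\<rparr> \<in> \<XX>"
    if y: "y \<in> \<mm>" "\<And>P. P \<in> \<P> \<Longrightarrow> y \<notin> P" for y
  proof -
    have yR: "y \<in> carrier R" using y(1) \<mm>_carrier by blast
    have "contains_up_to_iso R \<XX> (quot_module M (K (xs @ [y])))"
      using P(3)[OF y(2)] xs' y(1) by (intro in_X) auto
    then obtain N' where N': "N' \<in> \<XX>" "mod_isomorphic R (quot_module M (K (xs @ [y]))) N'"
      unfolding contains_up_to_iso_def by blast
    have "K (xs @ [y]) = ideal_smult R (Idl\<^bsub>R\<^esub> (insert y (set xs))) M" by (simp add: K_def)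
    then show ?thesis
      using smult_range_closed[OF module_M N(1) N'(1) xsR yR] N(2) N'(2) by (simp add: K_def)
  qed
  obtain V where V: "submodule V R N" "V \<noteq> {\<zero>\<^bsub>N\<^esub>}" "N\<lparr>carrier := V\<rparr> \<in> \<XX>"
    "\<And>a v. \<lbrakk>a \<in> \<mm>; v \<in> V\<rbrakk> \<Longrightarrow> a \<odot>\<^bsub>N\<^esub> v = \<zero>\<^bsub>N\<^esub>"
    by (rule torsion_contains_vector_space[OF N(1) torsion P(1,2) image]) blast+
  show ?thesis
    by (rule vector_space_contains_residue_field[OF V(3)]) (use V(2,4) in simp_all)
qed

end
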